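(* Let $M$ be an oriented biconservative hypersurface of index $2$ in the pseudo-Euclidean space $\mathbb E^5_2$. Assume that, with respect to an orthonormal frame field $\{e_1=\nabla H/\|\nabla H\|,e_2,e_3,e_4\}$ of principal directions, its shape operator has the form $$S=\mathrm{diag}(k_1,k_2,k_2,0),\qquad k_2\neq 0 .$$ Then $M$ is (locally) congruent to one of the following eight types of cylinders, for some smooth functions $\phi=\phi(s)$ and $\psi=\psi(s)$: (i) $x(s,t,u,v)=(v,\phi\cosh t,\phi\sinh t\cos u,\phi\sinh t\sin u,\psi)$, with $\phi'^2-\psi'^2=1$; (ii) $x(s,t,u,v)=(v,\psi,\phi\cos t,\phi\sin t\cos u,\phi\sin t\sin u)$, with $\phi'^2-\psi'^2=-1$; (iii) $x(s,t,u,v)=(\phi\cosh t\sin u,\phi\cosh t\cos u,\phi\sinh t,\psi,v)$, with $\phi'^2-\psi'^2=1$; (iv) $x(s,t,u,v)=(\psi,\phi\sinh t,\phi\cosh t\cos u,\phi\cosh t\sin u,v)$, with $\phi'^2-\psi'^2=-1$; (v) $x(s,t,u,v)=(v,\phi\sinh t,\phi\cosh t\cos u,\phi\cosh t\sin u,\psi)$, with $\phi'^2+\psi'^2=1$; (vi) $x(s,t,u,v)=(\phi\sinh t\cos u,\phi\sinh t\sin u,\phi\cosh t,\psi,v)$, with $\phi'^2+\psi'^2=1$; (vii) $x(s,t,u,v)=\left(\frac{s(t^2+u^2)}{2}+\psi,\;v,\;st,\;su,\;\frac{s(t^2+u^2)}{2}+\psi-s\right)$, with $1-2\psi'<0$;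 (viii) $x(s,t,u,v)=\left(\frac{s(t^2-u^2)}{2}+\psi,\;st,\;su,\;v,\;\frac{s(t^2-u^2)}{2}+\psi+s\right)$, with $1+2\psi'<0$.
   Context: $\mathbb E^5_2$ is $\mathbb R^5$ with the metric $\langle\cdot,\cdot\rangle=-dx_1^2-dx_2^2+dx_3^2+dx_4^2+dx_5^2$. Hypersurfaces are smooth and connected. A hypersurface $x:M\to\mathbb E^5_2$ of index $2$ is one whose induced metric is non-degenerate of index $2$; its unit normal $N$ then satisfies $\langle N,N\rangle=1$. The shape operator is $S(X)=-\widetilde\nabla_XN$, where $\widetilde\nabla$ is the flat connection of $\mathbb E^5_2$, and the mean curvature is $H=\frac14\operatorname{tr}S$. $\nabla H$ is the gradient of $H$ for the induced metric and $\|\nabla H\|=|\langle\nabla H,\nabla H\rangle|^{1/2}$. $M$ is biconservative if the tangential part of $\Delta^2x$ vanishes identically ($\Delta$ the Laplace operator of $M$); for these hypersurfaces this is equivalent to $S(\nabla H)=-2H\nabla H$. Standing assumptions: $\nabla H$ vanishes nowhere and is nowhere light-like, so that $e_1=\nabla H/\|\nabla H\|$ is a unit principal direction with principal curvature $k_1=-2H$; moreover $k_1$ differs everywhere from the other principal curvatures. The result is local: "congruent to one of" means that every point of $M$ has a neighbourhood which, up to an isometry of $\mathbb E^5_2$, is parametrized by one of the listed maps on some open set of parameters $(s,t,u,v)$. Primes denote $d/ds$. *)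

theory Defs
  imports "HOL-Analysis.Analysis"
begin

section \<open>Smooth maps\<close>

text \<open>These notions are meant for open sets \<open>S\<close> only; there the within-derivative of
  \<open>differentiable_on\<close> agrees with \<open>frechet_derivative f (at q)\<close>.\<close>

fun Ck_on :: "nat \<Rightarrow> 'a::real_normed_vector set \<Rightarrow> ('a \<Rightarrow> 'b::real_normed_vector) \<Rightarrow> bool" where
  "Ck_on 0 S f \<longleftrightarrow> continuous_on S f"
| "Ck_on (Suc k) S f \<longleftrightarrow> f differentiable_on S \<and> (\<forall>v. Ck_on k S (\<lambda>q. frechet_derivative f (at q) v))"

definition smooth_on :: "'a::real_normed_vector set \<Rightarrow> ('a \<Rightarrow> 'b::real_normed_vector) \<Rightarrow> bool" where
  "smooth_on S f \<longleftrightarrow> (\<forall>k. Ck_on k S f)"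

definition pd :: "4 \<Rightarrow> (real^4 \<Rightarrow> 'b::real_normed_vector) \<Rightarrow> real^4 \<Rightarrow> 'b" where
  "pd i f q = frechet_derivative f (at q) (axis i 1)"


section \<open>The ambient space\<close>

definition ip52 :: "real^5 \<Rightarrow> real^5 \<Rightarrow> real" where
  "ip52 a b = - a$1 * b$1 - a$2 * b$2 + a$3 * b$3 + a$4 * b$4 + a$5 * b$5"

definition isometry52 :: "(real^5 \<Rightarrow> real^5) \<Rightarrow> bool" where
  "isometry52 F \<longleftrightarrow> bij F \<and> smooth_on UNIV F \<and> smooth_on UNIV (inv F) \<and>
     (\<forall>p a b. ip52 (frechet_derivative F (at p) a) (frechet_derivative F (at p) b) = ip52 a b)"

definition nondegenerate_on :: "(real^5) set \<Rightarrow> bool" where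
  "nondegenerate_on T \<longleftrightarrow> (\<forall>a\<in>T. (\<forall>b\<in>T. ip52 a b = 0) \<longrightarrow> a = 0)"

definition index_on :: "(real^5) set \<Rightarrow> nat" where
  "index_on T = Max {dim W | W. subspace W \<and> W \<subseteq> T \<and> (\<forall>a\<in>W. a \<noteq> 0 \<longrightarrow> ip52 a a < 0)}"


section \<open>Geometry of a local parametrization\<close>

text \<open>Throughout, \<open>y\<close> is a parametrized hypersurface defined on an open subset of \<open>real^4\<close>
  and \<open>n\<close> a unit normal field along \<open>y\<close>. A tangent vector at \<open>q\<close> is represented by its coordinate
  vector \<open>a\<close> in \<open>real^4\<close>; as a vector of the ambient space it is
  \<open>frechet_derivative y (at q) a\<close>.\<close>

definition tangent_space :: "(real^4 \<Rightarrow> real^5) \<Rightarrow> real^4 \<Rightarrow> (real^5) set" where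
  "tangent_space y q = range (frechet_derivative y (at q))"

definition immersion_index2 :: "(real^4) set \<Rightarrow> (real^4 \<Rightarrow> real^5) \<Rightarrow> bool" where
  "immersion_index2 U y \<longleftrightarrow> smooth_on U y \<and>
     (\<forall>q\<in>U. inj (frechet_derivative y (at q)) \<and>
        nondegenerate_on (tangent_space y q) \<and> index_on (tangent_space y q) = 2)"

definition unit_normal :: "(real^4) set \<Rightarrow> (real^4 \<Rightarrow> real^5) \<Rightarrow> (real^4 \<Rightarrow> real^5) \<Rightarrow> bool" where
  "unit_normal U y n \<longleftrightarrow> smooth_on U n \<and>
     (\<forall>q\<in>U. ip52 (n q) (n q) = 1 \<and> (\<forall>a\<in>tangent_space y q. ip52 (n q) a = 0))"

definition metric :: "(real^4 \<Rightarrow> real^5) \<Rightarrow> real^4 \<Rightarrow> real^4 \<Rightarrow> real^4 \<Rightarrow> real" where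
  "metric y q a b = ip52 (frechet_derivative y (at q) a) (frechet_derivative y (at q) b)"

definition gram :: "(real^4 \<Rightarrow> real^5) \<Rightarrow> real^4 \<Rightarrow> real^4^4" where
  "gram y q = (\<chi> i j. ip52 (pd i y q) (pd j y q))"

definition christoffel :: "(real^4 \<Rightarrow> real^5) \<Rightarrow> real^4 \<Rightarrow> 4 \<Rightarrow> 4 \<Rightarrow> 4 \<Rightarrow> real" where
  "christoffel y q k i j = (1/2) * (\<Sum>l\<in>UNIV. matrix_inv (gram y q) $ k $ l *
     (pd i (\<lambda>r. gram y r $ j $ l) q + pd j (\<lambda>r. gram y r $ i $ l) q - pd l (\<lambda>r. gram y r $ i $ j) q))"

definition grad :: "(real^4 \<Rightarrow> real^5) \<Rightarrow> (real^4 \<Rightarrow> real) \<Rightarrow> real^4 \<Rightarrow> real^4" where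
  "grad y f q = matrix_inv (gram y q) *v (\<chi> i. pd i f q)"

text \<open>The Laplace operator as the metric trace of the covariant Hessian. The opposite sign
  convention gives the same bi-Laplacian.\<close>

definition laplacian :: "(real^4 \<Rightarrow> real^5) \<Rightarrow> (real^4 \<Rightarrow> real) \<Rightarrow> real^4 \<Rightarrow> real" where
  "laplacian y f q = (\<Sum>i\<in>UNIV. \<Sum>j\<in>UNIV. matrix_inv (gram y q) $ i $ j *
     (pd i (pd j f) q - (\<Sum>k\<in>UNIV. christoffel y q k i j * pd k f q)))"

definition vec_laplacian :: "(real^4 \<Rightarrow> real^5) \<Rightarrow> (real^4 \<Rightarrow> real^5) \<Rightarrow> real^4 \<Rightarrow> real^5" where
  "vec_laplacian y f q = (\<chi> m. laplacian y (\<lambda>r. f r $ m) q)"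

text \<open>The shape operator sends the tangent vector \<open>a\<close> to the tangent vector whose image under the
  differential of \<open>y\<close> is minus the ambient derivative of \<open>n\<close> in direction \<open>a\<close>.\<close>

definition shape_op :: "(real^4 \<Rightarrow> real^5) \<Rightarrow> (real^4 \<Rightarrow> real^5) \<Rightarrow> real^4 \<Rightarrow> real^4 \<Rightarrow> real^4" where
  "shape_op y n q a = (THE b. frechet_derivative y (at q) b = - frechet_derivative n (at q) a)"

definition mean_curv :: "(real^4 \<Rightarrow> real^5) \<Rightarrow> (real^4 \<Rightarrow> real^5) \<Rightarrow> real^4 \<Rightarrow> real" where
  "mean_curv y n q = trace (matrix (shape_op y n q)) / 4"

abbreviation grad_H :: "(real^4 \<Rightarrow> real^5) \<Rightarrow> (real^4 \<Rightarrow> real^5) \<Rightarrow> real^4 \<Rightarrow> real^4" where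
  "grad_H y n q \<equiv> grad y (mean_curv y n) q"

definition tangential_part :: "(real^4 \<Rightarrow> real^5) \<Rightarrow> real^4 \<Rightarrow> real^5 \<Rightarrow> real^5" where
  "tangential_part n q X = X - ip52 X (n q) *\<^sub>R n q"

definition biconservative_on :: "(real^4) set \<Rightarrow> (real^4 \<Rightarrow> real^5) \<Rightarrow> (real^4 \<Rightarrow> real^5) \<Rightarrow> bool" where
  "biconservative_on U y n \<longleftrightarrow>
     (\<forall>q\<in>U. tangential_part n q (vec_laplacian y (vec_laplacian y y) q) = 0)"

definition grad_H_proper_on :: "(real^4) set \<Rightarrow> (real^4 \<Rightarrow> real^5) \<Rightarrow> (real^4 \<Rightarrow> real^5) \<Rightarrow> bool" where
  "grad_H_proper_on U y n \<longleftrightarrow>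
     (\<forall>q\<in>U. grad_H y n q \<noteq> 0 \<and> metric y q (grad_H y n q) (grad_H y n q) \<noteq> 0)"

definition principal_frame ::
  "(real^4) set \<Rightarrow> (real^4 \<Rightarrow> real^5) \<Rightarrow> (real^4 \<Rightarrow> real^5) \<Rightarrow> (4 \<Rightarrow> real^4 \<Rightarrow> real^4) \<Rightarrow>
     (4 \<Rightarrow> real^4 \<Rightarrow> real) \<Rightarrow> bool" where
  "principal_frame U y n e k \<longleftrightarrow>
     (\<forall>i. smooth_on U (e i)) \<and>
     (\<forall>q\<in>U.
        e 1 q = (1 / sqrt \<bar>metric y q (grad_H y n q) (grad_H y n q)\<bar>) *\<^sub>R grad_H y n q \<and>
        (\<forall>i j. i \<noteq> j \<longrightarrow> metric y q (e i q) (e j q) = 0) \<and>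
        (\<forall>i. \<bar>metric y q (e i q) (e i q)\<bar> = 1) \<and>
        (\<forall>i. shape_op y n q (e i q) = k i q *\<^sub>R e i q))"

text \<open>The shape operator has the form \<open>diag(k1, k2, k2, 0)\<close>, with \<open>k2 \<noteq> 0\<close> and \<open>k1\<close> different from
  the other principal curvatures, with respect to a frame field; as usual, frame fields are only
  required to exist locally.\<close>

definition diag_shape_on :: "(real^4) set \<Rightarrow> (real^4 \<Rightarrow> real^5) \<Rightarrow> (real^4 \<Rightarrow> real^5) \<Rightarrow> bool" where
  "diag_shape_on U y n \<longleftrightarrow>
     (\<forall>q\<in>U. \<exists>U' e k. open U' \<and> q \<in> U' \<and> U' \<subseteq> U \<and> principal_frame U' y n e k \<and>
        (\<forall>r\<in>U'. k 3 r = k 2 r \<and> k 4 r = 0 \<and> k 2 r \<noteq> 0 \<and> k 1 r \<noteq> k 2 r \<and> k 1 r \<noteq> k 4 r))"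


section \<open>Hypersurfaces\<close>

text \<open>A smooth 4-manifold \<open>M\<close> is an open subset of a Hausdorff second countable space together with
  a (not necessarily maximal) smooth atlas; a chart is a pair of its domain and its coordinate map,
  whose values outside the domain are irrelevant.\<close>

type_synonym 'm atlas4 = "('m set \<times> ('m \<Rightarrow> real^4)) set"

definition smooth_manifold4 :: "'m::topological_space set \<Rightarrow> 'm atlas4 \<Rightarrow> bool" where
  "smooth_manifold4 M A \<longleftrightarrow>
     M = (\<Union>(D,c)\<in>A. D) \<and>
     (\<forall>(D,c)\<in>A. open D \<and> open (c ` D) \<and> homeomorphism D (c ` D) c (inv_into D c)) \<and>
     (\<forall>(D,c)\<in>A. \<forall>(D',c')\<in>A. smooth_on (c ` (D \<inter> D')) (c' \<circ> inv_into D c))"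

text \<open>\<open>x\<close> is an immersion of index 2; the orientation is given by the global unit normal
  field \<open>N\<close>.\<close>

definition oriented_hypersurface_index2 ::
  "'m::topological_space set \<Rightarrow> 'm atlas4 \<Rightarrow> ('m \<Rightarrow> real^5) \<Rightarrow> ('m \<Rightarrow> real^5) \<Rightarrow> bool" where
  "oriented_hypersurface_index2 M A x N \<longleftrightarrow>
     smooth_manifold4 M A \<and> connected M \<and>
     (\<forall>(D,c)\<in>A. immersion_index2 (c ` D) (x \<circ> inv_into D c) \<and>
        unit_normal (c ` D) (x \<circ> inv_into D c) (N \<circ> inv_into D c))"

definition biconservative :: "'m atlas4 \<Rightarrow> ('m \<Rightarrow> real^5) \<Rightarrow> ('m \<Rightarrow> real^5) \<Rightarrow> bool" where
  "biconservative A x N \<longleftrightarrow>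
     (\<forall>(D,c)\<in>A. biconservative_on (c ` D) (x \<circ> inv_into D c) (N \<circ> inv_into D c))"

definition grad_H_proper :: "'m atlas4 \<Rightarrow> ('m \<Rightarrow> real^5) \<Rightarrow> ('m \<Rightarrow> real^5) \<Rightarrow> bool" where
  "grad_H_proper A x N \<longleftrightarrow>
     (\<forall>(D,c)\<in>A. grad_H_proper_on (c ` D) (x \<circ> inv_into D c) (N \<circ> inv_into D c))"

definition diag_shape :: "'m atlas4 \<Rightarrow> ('m \<Rightarrow> real^5) \<Rightarrow> ('m \<Rightarrow> real^5) \<Rightarrow> bool" where
  "diag_shape A x N \<longleftrightarrow>
     (\<forall>(D,c)\<in>A. diag_shape_on (c ` D) (x \<circ> inv_into D c) (N \<circ> inv_into D c))"

definition diffeo_onto_open ::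
  "'m::topological_space atlas4 \<Rightarrow> (real^4) set \<Rightarrow> 'm set \<Rightarrow> (real^4 \<Rightarrow> 'm) \<Rightarrow> bool" where
  "diffeo_onto_open A W V h \<longleftrightarrow>
     (\<exists>h'. homeomorphism W V h h' \<and>
        (\<forall>(D,c)\<in>A. smooth_on {w \<in> W. h w \<in> D} (c \<circ> h) \<and>
                     smooth_on (c ` (V \<inter> D)) (h' \<circ> inv_into D c)))"

text \<open>Some neighbourhood of \<open>p\<close> is, up to an isometry of the ambient space, parametrized by \<open>L\<close> on
  an open set of parameters \<open>(s,t,u,v)\<close> with \<open>s\<close> in \<open>I\<close>.\<close>

definition locally_congruent ::
  "'m::topological_space set \<Rightarrow> 'm atlas4 \<Rightarrow> ('m \<Rightarrow> real^5) \<Rightarrow> 'm \<Rightarrow> real set \<Rightarrow>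
     (real \<Rightarrow> real \<Rightarrow> real \<Rightarrow> real \<Rightarrow> real^5) \<Rightarrow> bool" where
  "locally_congruent M A x p I L \<longleftrightarrow>
     (\<exists>V W F h. open V \<and> p \<in> V \<and> V \<subseteq> M \<and> open W \<and> (\<forall>w\<in>W. w$1 \<in> I) \<and>
        isometry52 F \<and> diffeo_onto_open A W V h \<and>
        (\<forall>w\<in>W. x (h w) = F (L (w$1) (w$2) (w$3) (w$4))))"


section \<open>The eight cylinders\<close>

type_synonym cylinder =
  "(real \<Rightarrow> real) \<Rightarrow> (real \<Rightarrow> real) \<Rightarrow> real \<Rightarrow> real \<Rightarrow> real \<Rightarrow> real \<Rightarrow> real^5"

definition cyl1 :: cylinder where
  "cyl1 \<phi> \<psi> s t u v =
     vector [v, \<phi> s * cosh t, \<phi> s * sinh t * cos u, \<phi> s * sinh t * sin u, \<psi> s]"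

definition cyl2 :: cylinder where
  "cyl2 \<phi> \<psi> s t u v =
     vector [v, \<psi> s, \<phi> s * cos t, \<phi> s * sin t * cos u, \<phi> s * sin t * sin u]"

definition cyl3 :: cylinder where
  "cyl3 \<phi> \<psi> s t u v =
     vector [\<phi> s * cosh t * sin u, \<phi> s * cosh t * cos u, \<phi> s * sinh t, \<psi> s, v]"

definition cyl4 :: cylinder where
  "cyl4 \<phi> \<psi> s t u v =
     vector [\<psi> s, \<phi> s * sinh t, \<phi> s * cosh t * cos u, \<phi> s * cosh t * sin u, v]"

definition cyl5 :: cylinder where
  "cyl5 \<phi> \<psi> s t u v =
     vector [v, \<phi> s * sinh t, \<phi> s * cosh t * cos u, \<phi> s * cosh t * sin u, \<psi> s]"

definition cyl6 :: cylinder where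
  "cyl6 \<phi> \<psi> s t u v =
     vector [\<phi> s * sinh t * cos u, \<phi> s * sinh t * sin u, \<phi> s * cosh t, \<psi> s, v]"

definition cyl7 :: "(real \<Rightarrow> real) \<Rightarrow> real \<Rightarrow> real \<Rightarrow> real \<Rightarrow> real \<Rightarrow> real^5" where
  "cyl7 \<psi> s t u v =
     vector [s * (t^2 + u^2) / 2 + \<psi> s, v, s * t, s * u, s * (t^2 + u^2) / 2 + \<psi> s - s]"

definition cyl8 :: "(real \<Rightarrow> real) \<Rightarrow> real \<Rightarrow> real \<Rightarrow> real \<Rightarrow> real \<Rightarrow> real^5" where
  "cyl8 \<psi> s t u v =
     vector [s * (t^2 - u^2) / 2 + \<psi> s, s * t, s * u, v, s * (t^2 - u^2) / 2 + \<psi> s + s]"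

end

theory Submission
  imports Defs
begin

text \<open>
  In an orthonormal frame \<open>E\<^sub>1, \<dots>, E\<^sub>4\<close> of principal directions, pairing the bilaplacian of the
  position vector with \<open>E\<^sub>1\<close> gives \<open>k\<^sub>1 = -2H\<close>, hence \<open>k\<^sub>1 = -(2/3) k\<^sub>2\<close>. The Codazzi equations, together
  with the fact that brackets of \<open>E\<^sub>2, E\<^sub>3, E\<^sub>4\<close> annihilate \<open>H\<close>, determine the connection: \<open>E\<^sub>4\<close> is
  constant in the ambient space, \<open>D\<^sub>aE\<^sub>1 = \<mu> E\<^sub>a\<close> for \<open>a = 2, 3\<close>, and \<open>E\<^sub>1\<close> has planar integral curves.
  With \<open>r = k\<^sub>2 powr (-3/5)\<close> the vector \<open>Z = r (k\<^sub>2 E\<^sub>1 + \<mu> N)\<close> is constant: it is the axis of rotation, and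
  the sign of \<open>\<langle>Z, Z\<rangle>\<close> separates the cases. If \<open>Z\<close> is not null, the position vector is
  \<open>C + v E\<^sub>4 + \<Psi>(r) Z + (r / \<langle>Z, Z\<rangle>) P\<close> with \<open>P = r (\<mu> E\<^sub>1 - \<epsilon>\<^sub>1 k\<^sub>2 N)\<close> of constant square and
  orthogonal to \<open>Z\<close> and \<open>E\<^sub>4\<close>; if \<open>Z\<close> is null, it is \<open>C + v E\<^sub>4 + (3/14) r powr (7/3) Z + T\<close> with
  \<open>T = (E\<^sub>1 - N) / (2 \<mu>)\<close> null. These formulas are verified by differentiating them along the frame, so
  neither integral curves nor the Frobenius theorem are needed, and they read off the parameters
  \<open>(s, t, u, v)\<close> as smooth functions on the chart. Since the position vector is an immersion that factors
  through them, they form a local diffeomorphism.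
\<close>

section \<open>Smooth maps\<close>

text \<open>Along \<open>E 2\<close> and \<open>E 3\<close> the derivatives of \<open>E 1\<close>
  and \<open>n\<close> are \<open>\<mu>\<close> and \<open>- k 2\<close> times the same vector, so
  the weights \<open>k 2\<close> and \<open>\<mu>\<close> cancel there for any factor r; only the
  direction \<open>E 1\<close> fixes r, by r' = \<mu> r. Codazzi gives k2' = -(5/3) \<mu> k2, whence
  the exponent -3/5. When the axis is not null, r is a constant multiple of the radius of rotation.
  The square of \<open>Z\<close> then acts as a first integral: with k2 r = r^(-2/3) it makes r' a
  function of r alone, so that only quadratures remain for the profile curve. For the three
  connection coefficients that mix \<open>E 1\<close>, \<open>E 4\<close> and one of
  \<open>E 2\<close>, \<open>E 3\<close>, Codazzi gives only two relations; the brackets that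
  annihilate \<open>H\<close> supply the third. The null case needs its own formula because there
  \<open>P\<close> coincides with \<open>Z\<close> and can no longer serve as a radius
  vector.\<close>

lemma frechet_derivative_cong_open:
  assumes "open S" "q \<in> S" "\<And>r. r \<in> S \<Longrightarrow> f r = g r"
  shows "frechet_derivative f (at q) = frechet_derivative g (at q)"
proof -
  have "(f has_derivative f') (at q) \<longleftrightarrow> (g has_derivative f') (at q)" for f'
    using assms has_derivative_transform_within_open[of f f' q UNIV S g]
      has_derivative_transform_within_open[of g f' q UNIV S f] by auto
  \<comment> \<open>\<open>frechet_derivative\<close> chooses among all derivatives at
    \<open>q\<close>; both functions have the same ones, so the values agree even where none
    exists.\<close>
  then show ?thesis
    unfolding frechet_derivative_def by presburger
qed

lemma Ck_on_cong:
  assumes "open S" "\<And>q. q \<in> S \<Longrightarrow> f q = g q" "Ck_on k S f"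
  shows "Ck_on k S g"
  using assms(2,3)
proof (induction k arbitrary: f g)
  case 0
  then show ?case by (simp cong: continuous_on_cong)
next
  case (Suc k)
  have "g differentiable at x within S" if x: "x \<in> S" for x
  proof -
    obtain f' where "(f has_derivative f') (at x within S)"
      using Suc.prems(2) x by (auto simp: differentiable_on_def differentiable_def)
    then have "(g has_derivative f') (at x within S)"
      using has_derivative_transform[of x S g f f'] x Suc.prems(1) by simp
    then show ?thesis by (rule differentiableI)
  qed
  then have "g differentiable_on S"
    by (simp add: differentiable_on_def)
  moreover have "Ck_on k S (\<lambda>q. frechet_derivative g (at q) v)" for v
  proof (rule Suc.IH)
    show "frechet_derivative f (at q) v = frechet_derivative g (at q) v" if "q \<in> S" for q
      using frechet_derivative_cong_open[OF assms(1) that] Suc.prems(1) by metis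
    show "Ck_on k S (\<lambda>q. frechet_derivative f (at q) v)"
      using Suc.prems(2) by simp
  qed
  ultimately show ?case by simp
qed

lemma Ck_on_subset: "Ck_on k S f \<Longrightarrow> T \<subseteq> S \<Longrightarrow> Ck_on k T f"
  by (induction k arbitrary: f) (auto intro: continuous_on_subset differentiable_on_subset)

lemma Ck_on_Suc_imp: "Ck_on (Suc k) S f \<Longrightarrow> Ck_on k S f"
  by (induction k arbitrary: f) (auto intro: differentiable_imp_continuous_on)

lemma Ck_on_has_derivative:
  assumes "open S" "Ck_on (Suc k) S f" "q \<in> S"
  shows "(f has_derivative frechet_derivative f (at q)) (at q)"
  using assms differentiable_on_eq_differentiable_at[of S f] frechet_derivative_works by auto

text \<open>Any formula \<open>f'\<close> for the derivative may be supplied, so the inductions on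
  \<open>k\<close> below can use the ordinary differentiation rules instead of the choice operator
  behind \<open>frechet_derivative\<close>.\<close>

lemma Ck_on_SucI:
  assumes "open S" "\<And>q. q \<in> S \<Longrightarrow> (f has_derivative f' q) (at q)"
    and "\<And>v. Ck_on k S (\<lambda>q. f' q v)"
  shows "Ck_on (Suc k) S f"
proof -
  have eq: "frechet_derivative f (at q) = f' q" if "q \<in> S" for q
    using frechet_derivative_at assms(2) that by metis
  have "f differentiable_on S"
    using assms(1,2) by (meson differentiableI differentiable_at_imp_differentiable_on)
  moreover have "Ck_on k S (\<lambda>q. frechet_derivative f (at q) v)" for v
    by (rule Ck_on_cong[OF assms(1) _ assms(3)[of v]]) (simp add: eq)
  ultimately show ?thesis by simp
qed

lemma Ck_on_const: "open S \<Longrightarrow> Ck_on k S (\<lambda>q. c)"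
proof (induction k arbitrary: c)
  case (Suc k)
  show ?case by (rule Ck_on_SucI[where f' = "\<lambda>q v. 0"]) (use Suc in auto)
qed simp

lemma Ck_on_add:
  assumes "open S" "Ck_on k S f" "Ck_on k S g"
  shows "Ck_on k S (\<lambda>q. f q + g q)"
  using assms(2,3)
proof (induction k arbitrary: f g)
  case 0
  then show ?case by (simp add: continuous_on_add)
next
  case (Suc k)
  show ?case
  proof (rule Ck_on_SucI[OF assms(1)])
    show "((\<lambda>q. f q + g q) has_derivative
        (\<lambda>v. frechet_derivative f (at q) v + frechet_derivative g (at q) v)) (at q)" if "q \<in> S" for q
      using that Suc.prems by (intro has_derivative_add Ck_on_has_derivative[OF assms(1)])
  qed (use Suc in auto)
qed

lemma Ck_on_bilinear:
  assumes "bounded_bilinear pr" "open S" "Ck_on k S f" "Ck_on k S g"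
  shows "Ck_on k S (\<lambda>q. pr (f q) (g q))"
  using assms(3,4)
proof (induction k arbitrary: f g)
  case 0
  then show ?case by (simp add: bounded_bilinear.continuous_on[OF assms(1)])
next
  case (Suc k)
  show ?case
  proof (rule Ck_on_SucI[OF assms(2)])
    show "((\<lambda>q. pr (f q) (g q)) has_derivative
        (\<lambda>v. pr (f q) (frechet_derivative g (at q) v) + pr (frechet_derivative f (at q) v) (g q))) (at q)"
      if "q \<in> S" for q
      using that Suc.prems
      by (intro bounded_bilinear.FDERIV[OF assms(1)] Ck_on_has_derivative[OF assms(2)])
    show "Ck_on k S (\<lambda>q. pr (f q) (frechet_derivative g (at q) v) + pr (frechet_derivative f (at q) v) (g q))" for v
      \<comment> \<open>In each summand of the product rule the undifferentiated factor is used with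
        one order of regularity less.\<close>
      using Suc.prems Suc.prems[THEN Ck_on_Suc_imp] by (intro Ck_on_add assms(2) Suc.IH) auto
  qed
qed

lemma Ck_on_linear:
  assumes "bounded_linear h" "open S" "Ck_on k S f"
  shows "Ck_on k S (\<lambda>q. h (f q))"
  using assms(3)
proof (induction k arbitrary: f)
  case 0
  then show ?case by (simp add: bounded_linear.continuous_on[OF assms(1)])
next
  case (Suc k)
  show ?case
  proof (rule Ck_on_SucI[OF assms(2)])
    show "((\<lambda>q. h (f q)) has_derivative (\<lambda>v. h (frechet_derivative f (at q) v))) (at q)"
      if "q \<in> S" for q
      using that Suc.prems
      by (intro bounded_linear.has_derivative[OF assms(1)] Ck_on_has_derivative[OF assms(2)])
  qed (use Suc in auto)
qed

lemma Ck_on_sum: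
  assumes "open S" "\<And>i. i \<in> I \<Longrightarrow> Ck_on k S (f i)"
  shows "Ck_on k S (\<lambda>q. \<Sum>i\<in>I. f i q)"
  using assms(2)
proof (induction I rule: infinite_finite_induct)
  case (insert x F)
  then show ?case by (simp add: Ck_on_add assms(1))
qed (auto intro: Ck_on_const assms)

lemma linear_basis_expansion:
  fixes h :: "'a::euclidean_space \<Rightarrow> 'b::real_vector"
  assumes "linear h"
  shows "h v = (\<Sum>b\<in>Basis. (v \<bullet> b) *\<^sub>R h b)"
proof -
  have "h v = h (\<Sum>b\<in>Basis. (v \<bullet> b) *\<^sub>R b)"
    by (simp add: euclidean_representation)
  also have "\<dots> = (\<Sum>b\<in>Basis. (v \<bullet> b) *\<^sub>R h b)"
    by (simp add: linear_sum[OF assms] linear_cmul[OF assms])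
  finally show ?thesis .
qed

text \<open>\<open>Ck_on\<close> controls derivatives in fixed directions, whereas the chain rule
  applies the derivative of \<open>f\<close> to a vector that moves with the point. Expanding this
  vector in \<open>Basis\<close> leaves products to which the bilinear rule and the induction
  hypothesis apply.\<close>

lemma Ck_on_compose:
  fixes f :: "'b::euclidean_space \<Rightarrow> 'c::real_normed_vector"
  assumes "open S" "open T" "Ck_on k T f" "Ck_on k S g" "g ` S \<subseteq> T"
  shows "Ck_on k S (\<lambda>q. f (g q))"
  using assms(3,4)
proof (induction k arbitrary: f)
  case 0
  then show ?case using assms(5) by (auto intro: continuous_on_compose2)
next
  case (Suc k)
  show ?case
  proof (rule Ck_on_SucI[OF assms(1)])
    have f: "(f has_derivative frechet_derivative f (at (g q))) (at (g q))" if "q \<in> S" for q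
      using that Suc.prems assms(5) by (intro Ck_on_has_derivative[OF assms(2)]) auto
    show "((\<lambda>q. f (g q)) has_derivative (\<lambda>v. \<Sum>b\<in>Basis.
        (frechet_derivative g (at q) v \<bullet> b) *\<^sub>R frechet_derivative f (at (g q)) b)) (at q)" if "q \<in> S" for q
    proof -
      have "((\<lambda>q. f (g q)) has_derivative (\<lambda>v. frechet_derivative f (at (g q)) (frechet_derivative g (at q) v))) (at q)"
        by (rule has_derivative_compose[OF Ck_on_has_derivative[OF assms(1) Suc.prems(2) that] f[OF that]])
      moreover have "linear (frechet_derivative f (at (g q)))"
        using f[OF that] has_derivative_linear by blast
      ultimately show ?thesis
        by (subst linear_basis_expansion[of "frechet_derivative f (at (g q))", symmetric])
    qed
    show "Ck_on k S (\<lambda>q. \<Sum>b\<in>Basis.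
        (frechet_derivative g (at q) v \<bullet> b) *\<^sub>R frechet_derivative f (at (g q)) b)" for v
    proof (intro Ck_on_sum Ck_on_bilinear[OF bounded_bilinear_scaleR] assms(1))
      fix b :: 'b
      show "Ck_on k S (\<lambda>q. frechet_derivative g (at q) v \<bullet> b)"
        using Suc.prems by (intro Ck_on_linear[OF bounded_linear_inner_left] assms(1)) auto
      show "Ck_on k S (\<lambda>q. frechet_derivative f (at (g q)) b)"
      proof (rule Suc.IH)
        show "Ck_on k T (\<lambda>q. frechet_derivative f (at q) b)"
          using Suc.prems(1) by simp
        show "Ck_on k S g"
          using Suc.prems(2) by (rule Ck_on_Suc_imp)
      qed
    qed
  qed
qed

lemma Ck_on_id: "open S \<Longrightarrow> Ck_on k S (\<lambda>q. q)"
  by (cases k) (auto intro!: Ck_on_SucI[where f' = "\<lambda>q v. v"] Ck_on_const simp: continuous_on_id simp del: Ck_on.simps(2))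

lemma smooth_on_iff:
  "smooth_on S f \<longleftrightarrow> f differentiable_on S \<and> (\<forall>v. smooth_on S (\<lambda>q. frechet_derivative f (at q) v))"
proof
  assume "smooth_on S f"
  then show "f differentiable_on S \<and> (\<forall>v. smooth_on S (\<lambda>q. frechet_derivative f (at q) v))"
    unfolding smooth_on_def by (metis Ck_on.simps(2))
next
  assume r: "f differentiable_on S \<and> (\<forall>v. smooth_on S (\<lambda>q. frechet_derivative f (at q) v))"
  have "Ck_on (Suc k) S f" for k
    using r by (simp add: smooth_on_def)
  then show "smooth_on S f"
    unfolding smooth_on_def using Ck_on_Suc_imp by blast
qed

lemma smooth_on_cong:
  "open S \<Longrightarrow> (\<And>q. q \<in> S \<Longrightarrow> f q = g q) \<Longrightarrow> smooth_on S f \<Longrightarrow> smooth_on S g"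
  unfolding smooth_on_def using Ck_on_cong by metis

lemma smooth_on_subset: "smooth_on S f \<Longrightarrow> T \<subseteq> S \<Longrightarrow> smooth_on T f"
  unfolding smooth_on_def using Ck_on_subset by metis

lemma smooth_on_continuous: "smooth_on S f \<Longrightarrow> continuous_on S f"
  unfolding smooth_on_def by (metis Ck_on.simps(1))

lemma smooth_on_has_derivative:
  "smooth_on S f \<Longrightarrow> open S \<Longrightarrow> q \<in> S \<Longrightarrow> (f has_derivative frechet_derivative f (at q)) (at q)"
  unfolding smooth_on_def using Ck_on_has_derivative by metis

lemma smooth_on_differentiable:
  "smooth_on S f \<Longrightarrow> open S \<Longrightarrow> q \<in> S \<Longrightarrow> f differentiable at q"
  using smooth_on_has_derivative differentiableI by blast

lemma smooth_on_derivative: "smooth_on S f \<Longrightarrow> smooth_on S (\<lambda>q. frechet_derivative f (at q) v)"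
  using smooth_on_iff by blast

named_theorems smooth_intros

lemma smooth_on_const [smooth_intros]: "open S \<Longrightarrow> smooth_on S (\<lambda>q. c)"
  by (simp add: smooth_on_def Ck_on_const)

lemma smooth_on_ident [smooth_intros]: "open S \<Longrightarrow> smooth_on S (\<lambda>q. q)"
  by (simp add: smooth_on_def Ck_on_id)

lemma smooth_on_add [smooth_intros]:
  "open S \<Longrightarrow> smooth_on S f \<Longrightarrow> smooth_on S g \<Longrightarrow> smooth_on S (\<lambda>q. f q + g q)"
  by (simp add: smooth_on_def Ck_on_add)

lemma smooth_on_sum [smooth_intros]:
  "open S \<Longrightarrow> (\<And>i. i \<in> I \<Longrightarrow> smooth_on S (f i)) \<Longrightarrow> smooth_on S (\<lambda>q. \<Sum>i\<in>I. f i q)"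
  by (simp add: smooth_on_def Ck_on_sum)

lemma smooth_on_bilinear:
  "bounded_bilinear pr \<Longrightarrow> open S \<Longrightarrow> smooth_on S f \<Longrightarrow> smooth_on S g \<Longrightarrow> smooth_on S (\<lambda>q. pr (f q) (g q))"
  by (simp add: smooth_on_def Ck_on_bilinear)

lemma smooth_on_linear:
  "bounded_linear h \<Longrightarrow> open S \<Longrightarrow> smooth_on S f \<Longrightarrow> smooth_on S (\<lambda>q. h (f q))"
  by (simp add: smooth_on_def Ck_on_linear)

lemmas smooth_on_scaleR [smooth_intros] = smooth_on_bilinear[OF bounded_bilinear_scaleR]
lemma smooth_on_mult [smooth_intros]:
  fixes f g :: "'a::real_normed_vector \<Rightarrow> real"
  shows "open S \<Longrightarrow> smooth_on S f \<Longrightarrow> smooth_on S g \<Longrightarrow> smooth_on S (\<lambda>q. f q * g q)"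
  by (rule smooth_on_bilinear[OF bounded_bilinear_mult])
lemmas smooth_on_minus [smooth_intros] = smooth_on_linear[OF bounded_linear_minus[OF bounded_linear_ident]]
lemmas smooth_on_nth [smooth_intros] = smooth_on_linear[OF bounded_linear_vec_nth]
lemmas smooth_on_inner_const = smooth_on_linear[OF bounded_linear_inner_left]

lemma smooth_on_diff [smooth_intros]:
  "open S \<Longrightarrow> smooth_on S f \<Longrightarrow> smooth_on S g \<Longrightarrow> smooth_on S (\<lambda>q. f q - g q)"
  using smooth_on_add[of S f "\<lambda>q. - g q"] smooth_on_minus[of S g] by simp

lemma smooth_on_prod [smooth_intros]:
  fixes f :: "'i \<Rightarrow> 'a::real_normed_vector \<Rightarrow> real"
  assumes "open S" "\<And>i. i \<in> I \<Longrightarrow> smooth_on S (f i)"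
  shows "smooth_on S (\<lambda>q. \<Prod>i\<in>I. f i q)"
  using assms(2) by (induction I rule: infinite_finite_induct) (auto intro!: smooth_intros assms(1))

lemma smooth_on_power [smooth_intros]:
  fixes f :: "'a::real_normed_vector \<Rightarrow> real"
  shows "open S \<Longrightarrow> smooth_on S f \<Longrightarrow> smooth_on S (\<lambda>q. f q ^ m)"
  by (induction m) (auto intro!: smooth_intros)

lemma smooth_on_compose:
  fixes f :: "'b::euclidean_space \<Rightarrow> 'c::real_normed_vector"
  shows "open S \<Longrightarrow> open T \<Longrightarrow> smooth_on T f \<Longrightarrow> smooth_on S g \<Longrightarrow> g ` S \<subseteq> T \<Longrightarrow> smooth_on S (\<lambda>q. f (g q))"
  unfolding smooth_on_def using Ck_on_compose by metis

lemma smooth_on_vec_lambda [smooth_intros]: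
  fixes f :: "'i::finite \<Rightarrow> 'a::real_normed_vector \<Rightarrow> real"
  assumes "open S" "\<And>i. smooth_on S (f i)"
  shows "smooth_on S (\<lambda>q. \<chi> i. f i q)"
proof (rule smooth_on_cong[OF assms(1)])
  show "smooth_on S (\<lambda>q. \<Sum>i\<in>UNIV. f i q *\<^sub>R axis i (1::real))"
    by (intro smooth_intros assms)
qed (simp add: vec_eq_iff axis_def if_distrib cong: if_cong)

lemma smooth_on_frechet_field [smooth_intros]:
  fixes f :: "'a::euclidean_space \<Rightarrow> 'b::real_normed_vector"
  assumes "open S" "smooth_on S f" "smooth_on S X"
  shows "smooth_on S (\<lambda>q. frechet_derivative f (at q) (X q))"
proof (rule smooth_on_cong[OF assms(1)])
  show "smooth_on S (\<lambda>q. \<Sum>b\<in>Basis. (X q \<bullet> b) *\<^sub>R frechet_derivative f (at q) b)"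
    by (intro smooth_intros assms smooth_on_inner_const smooth_on_derivative)
  show "(\<Sum>b\<in>Basis. (X q \<bullet> b) *\<^sub>R frechet_derivative f (at q) b) = frechet_derivative f (at q) (X q)" if "q \<in> S" for q
    using linear_basis_expansion[of "frechet_derivative f (at q)" "X q"]
      has_derivative_linear[OF smooth_on_has_derivative[OF assms(2,1) that]] by simp
qed

section \<open>Smoothness of elementary real functions\<close>

lemma Ck_on_real_derivI:
  fixes f :: "real \<Rightarrow> real"
  assumes "open S" "\<And>s. s \<in> S \<Longrightarrow> (f has_real_derivative f' s) (at s)" "Ck_on k S f'"
  shows "Ck_on (Suc k) S f"
proof (rule Ck_on_SucI[where f' = "\<lambda>s v. v * f' s"])
  show "(f has_derivative (\<lambda>v. v * f' q)) (at q)" if "q \<in> S" for q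
    using assms(2)[OF that] by (simp add: has_field_derivative_def mult.commute[of _ "f' q"])
  show "Ck_on k S (\<lambda>s. v * f' s)" for v
    by (intro Ck_on_linear[OF bounded_linear_mult_right] assms)
qed fact

lemma smooth_on_real_derivI:
  fixes f :: "real \<Rightarrow> real"
  assumes "open S" "\<And>s. s \<in> S \<Longrightarrow> (f has_real_derivative f' s) (at s)" "smooth_on S f'"
  shows "smooth_on S f"
proof -
  have "Ck_on (Suc k) S f" for k
    using assms by (intro Ck_on_real_derivI) (auto simp: smooth_on_def)
  then show ?thesis
    unfolding smooth_on_def using Ck_on_Suc_imp by blast
qed

lemma smooth_on_powr_real: "smooth_on {0<..} (\<lambda>x::real. x powr a)"
proof -
  have "Ck_on k {0<..} (\<lambda>x::real. x powr a)" for k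
  proof (induction k arbitrary: a)
    case 0
    show ?case by (auto intro!: continuous_intros)
  next
    case (Suc k)
    show ?case
    proof (rule Ck_on_real_derivI)
      show "((\<lambda>x. x powr a) has_real_derivative a * x powr (a - 1)) (at x)" if "x \<in> {0<..}" for x
        using that by (auto intro!: derivative_eq_intros)
      show "Ck_on k {0<..} (\<lambda>x. a * x powr (a - 1))"
        by (intro Ck_on_linear[OF bounded_linear_mult_right] Suc) simp
    qed simp
  qed
  then show ?thesis by (simp add: smooth_on_def)
qed

lemma smooth_on_powr [smooth_intros]:
  fixes f :: "'a::real_normed_vector \<Rightarrow> real"
  assumes "open S" "smooth_on S f" "\<And>q. q \<in> S \<Longrightarrow> f q > 0"
  shows "smooth_on S (\<lambda>q. f q powr a)"
  by (rule smooth_on_compose[OF assms(1) _ smooth_on_powr_real assms(2)]) (use assms(3) in auto)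

lemma smooth_on_sqrt [smooth_intros]:
  fixes f :: "'a::real_normed_vector \<Rightarrow> real"
  assumes "open S" "smooth_on S f" "\<And>q. q \<in> S \<Longrightarrow> f q > 0"
  shows "smooth_on S (\<lambda>q. sqrt (f q))"
  by (rule smooth_on_cong[OF assms(1) _ smooth_on_powr[OF assms, of "1/2"]])
    (use assms(3) in \<open>auto simp: powr_half_sqrt less_imp_le\<close>)

lemma smooth_on_inverse [smooth_intros]:
  fixes f :: "'a::real_normed_vector \<Rightarrow> real"
  assumes "open S" "smooth_on S f" "\<And>q. q \<in> S \<Longrightarrow> f q \<noteq> 0"
  shows "smooth_on S (\<lambda>q. inverse (f q))"
proof -
  have o: "open (- {0::real})"
    by (simp add: open_Compl)
  have "Ck_on k (- {0}) (inverse :: real \<Rightarrow> real)" for k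
  proof (induction k)
    case 0
    show ?case by (auto intro!: continuous_intros)
  next
    case (Suc k)
    show ?case
    proof (rule Ck_on_real_derivI[OF o])
      show "(inverse has_real_derivative - (inverse x * inverse x)) (at x)" if "x \<in> - {0}" for x :: real
        using that DERIV_inverse[of x UNIV] by (simp add: power2_eq_square)
      show "Ck_on k (- {0}) (\<lambda>x::real. - (inverse x * inverse x))"
        by (intro Ck_on_linear[OF bounded_linear_minus[OF bounded_linear_ident]] o
            Ck_on_bilinear[OF bounded_bilinear_mult] Suc)
    qed
  qed
  then have "smooth_on (- {0}) (inverse :: real \<Rightarrow> real)"
    by (simp add: smooth_on_def)
  then show ?thesis
    by (intro smooth_on_compose[OF assms(1) o _ assms(2)]) (use assms(3) in auto)
qed

lemma smooth_on_divide [smooth_intros]: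
  fixes f g :: "'a::real_normed_vector \<Rightarrow> real"
  assumes "open S" "smooth_on S f" "smooth_on S g" "\<And>q. q \<in> S \<Longrightarrow> g q \<noteq> 0"
  shows "smooth_on S (\<lambda>q. f q / g q)"
  using assms by (simp add: divide_inverse smooth_intros)

lemma smooth_on_arctan [smooth_intros]:
  fixes f :: "'a::real_normed_vector \<Rightarrow> real"
  assumes "open S" "smooth_on S f"
  shows "smooth_on S (\<lambda>q. arctan (f q))"
proof (rule smooth_on_compose[OF assms(1) open_UNIV _ assms(2)])
  show "smooth_on UNIV (arctan :: real \<Rightarrow> real)"
  proof (rule smooth_on_real_derivI[OF open_UNIV])
    show "smooth_on UNIV (\<lambda>x::real. inverse (1 + x\<^sup>2))"
      by (intro smooth_intros) (auto simp: add_nonneg_eq_0_iff)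
  qed (rule DERIV_arctan)
qed simp

lemma smooth_on_arsinh [smooth_intros]:
  fixes f :: "'a::real_normed_vector \<Rightarrow> real"
  assumes "open S" "smooth_on S f"
  shows "smooth_on S (\<lambda>q. arsinh (f q))"
proof (rule smooth_on_compose[OF assms(1) open_UNIV _ assms(2)])
  have pos: "0 < x\<^sup>2 + 1" for x :: real
    by (simp add: add_nonneg_pos)
  show "smooth_on UNIV (arsinh :: real \<Rightarrow> real)"
  proof (rule smooth_on_real_derivI[OF open_UNIV])
    show "smooth_on UNIV (\<lambda>x::real. 1 / sqrt (x\<^sup>2 + 1))"
      by (intro smooth_intros) (use pos in \<open>auto simp: less_imp_neq[symmetric]\<close>)
  qed (rule arsinh_real_has_field_derivative)
qed simp

section \<open>Second derivatives and local inverses\<close>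

text \<open>The second difference is symmetric in \<open>u\<close> and \<open>v\<close>, the mixed
  derivative on the right is not; comparing the two orders will give the symmetry of second
  derivatives.\<close>

lemma second_difference_mean_value:
  fixes f :: "'a::real_normed_vector \<Rightarrow> real"
  assumes S: "open S" "smooth_on S f" and h: "h > 0"
    and sub: "\<And>a b. 0 \<le> a \<Longrightarrow> a \<le> h \<Longrightarrow> 0 \<le> b \<Longrightarrow> b \<le> h \<Longrightarrow> x + a *\<^sub>R u + b *\<^sub>R v \<in> S"
  shows "\<exists>a b. 0 < a \<and> a < h \<and> 0 < b \<and> b < h \<and>
    f (x + h *\<^sub>R u + h *\<^sub>R v) - f (x + h *\<^sub>R u) - f (x + h *\<^sub>R v) + f x =
    h * h * frechet_derivative (\<lambda>q. frechet_derivative f (at q) u) (at (x + a *\<^sub>R u + b *\<^sub>R v)) v"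
proof -
  define F where "F = (\<lambda>q. frechet_derivative f (at q) u)"
  have sF: "smooth_on S F"
    unfolding F_def by (rule smooth_on_derivative[OF S(2)])
  have line: "((\<lambda>a. g (p + a *\<^sub>R w)) has_real_derivative frechet_derivative g (at (p + a *\<^sub>R w)) w) (at a)"
    if "smooth_on S g" "p + a *\<^sub>R w \<in> S" for g :: "'a \<Rightarrow> real" and p w a
  proof -
    have D: "(g has_derivative frechet_derivative g (at (p + a *\<^sub>R w))) (at (p + a *\<^sub>R w))"
      by (rule smooth_on_has_derivative[OF that(1) S(1) that(2)])
    have "((\<lambda>a. p + a *\<^sub>R w) has_derivative (\<lambda>c. c *\<^sub>R w)) (at a)"
      by (auto intro!: derivative_eq_intros)
    from has_derivative_compose[OF this D]
    have "((\<lambda>a. g (p + a *\<^sub>R w)) has_derivative (\<lambda>c. frechet_derivative g (at (p + a *\<^sub>R w)) (c *\<^sub>R w))) (at a)" .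
    moreover have "frechet_derivative g (at (p + a *\<^sub>R w)) (c *\<^sub>R w) = frechet_derivative g (at (p + a *\<^sub>R w)) w * c" for c
      using linear_cmul[OF has_derivative_linear[OF D], of c w] by simp
    ultimately show ?thesis
      by (simp add: has_field_derivative_def)
  qed
  \<comment> \<open>First mean value along \<open>u\<close>, for the difference of \<open>f\<close>
    between the two sides of the parallelogram parallel to \<open>u\<close>; the second one below
    runs along \<open>v\<close>.\<close>
  have "\<exists>a>0. a < h \<and> (f ((x + h *\<^sub>R v) + h *\<^sub>R u) - f (x + h *\<^sub>R u)) - (f ((x + h *\<^sub>R v) + 0 *\<^sub>R u) - f (x + 0 *\<^sub>R u))
      = (h - 0) * (F ((x + h *\<^sub>R v) + a *\<^sub>R u) - F (x + a *\<^sub>R u))"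
  proof (rule MVT2[OF h])
    fix a :: real assume a: "0 \<le> a" "a \<le> h"
    have "x + a *\<^sub>R u + h *\<^sub>R v \<in> S" "x + a *\<^sub>R u + 0 *\<^sub>R v \<in> S"
      using a h by (auto intro!: sub simp del: scaleR_zero_left)
    then have 1: "(x + h *\<^sub>R v) + a *\<^sub>R u \<in> S" "x + a *\<^sub>R u \<in> S"
      by (simp_all add: add.commute add.left_commute)
    show "((\<lambda>a. f ((x + h *\<^sub>R v) + a *\<^sub>R u) - f (x + a *\<^sub>R u)) has_real_derivative
      F ((x + h *\<^sub>R v) + a *\<^sub>R u) - F (x + a *\<^sub>R u)) (at a)"
      unfolding F_def by (intro DERIV_diff line[OF S(2)] 1)
  qed
  then obtain a where a: "0 < a" "a < h" and
    eq1: "f ((x + h *\<^sub>R v) + h *\<^sub>R u) - f (x + h *\<^sub>R u) - f (x + h *\<^sub>R v) + f x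
      = h * (F ((x + h *\<^sub>R v) + a *\<^sub>R u) - F (x + a *\<^sub>R u))"
    by auto
  have "\<exists>b>0. b < h \<and> F ((x + a *\<^sub>R u) + h *\<^sub>R v) - F ((x + a *\<^sub>R u) + 0 *\<^sub>R v)
      = (h - 0) * frechet_derivative F (at (x + a *\<^sub>R u + b *\<^sub>R v)) v"
  proof (rule MVT2[OF h])
    fix b :: real assume b: "0 \<le> b" "b \<le> h"
    show "((\<lambda>b. F ((x + a *\<^sub>R u) + b *\<^sub>R v)) has_real_derivative
      frechet_derivative F (at (x + a *\<^sub>R u + b *\<^sub>R v)) v) (at b)"
      using a b by (intro line[OF sF] sub) auto
  qed
  then obtain b where b: "0 < b" "b < h" and
    eq2: "F ((x + a *\<^sub>R u) + h *\<^sub>R v) - F (x + a *\<^sub>R u) = h * frechet_derivative F (at (x + a *\<^sub>R u + b *\<^sub>R v)) v"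
    by auto
  have "(x + h *\<^sub>R v) + a *\<^sub>R u = (x + a *\<^sub>R u) + h *\<^sub>R v"
    "x + h *\<^sub>R u + h *\<^sub>R v = (x + h *\<^sub>R v) + h *\<^sub>R u"
    by (simp_all add: algebra_simps)
  then have "f (x + h *\<^sub>R u + h *\<^sub>R v) - f (x + h *\<^sub>R u) - f (x + h *\<^sub>R v) + f x
      = h * (h * frechet_derivative F (at (x + a *\<^sub>R u + b *\<^sub>R v)) v)"
    using eq1 eq2 by metis
  then have "f (x + h *\<^sub>R u + h *\<^sub>R v) - f (x + h *\<^sub>R u) - f (x + h *\<^sub>R v) + f x
      = h * h * frechet_derivative F (at (x + a *\<^sub>R u + b *\<^sub>R v)) v"
    by simp
  then show ?thesis
    using a b unfolding F_def by blast
qed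

text \<open>If the two mixed derivatives differed at \<open>x\<close>, continuity would keep them
  apart near \<open>x\<close>; but a small parallelogram contains two points at which they take a
  common value.\<close>

lemma second_derivative_symmetric_real:
  fixes f :: "'a::real_normed_vector \<Rightarrow> real"
  assumes S: "open S" "smooth_on S f" "x \<in> S"
  shows "frechet_derivative (\<lambda>q. frechet_derivative f (at q) u) (at x) v
       = frechet_derivative (\<lambda>q. frechet_derivative f (at q) v) (at x) u"
proof (rule ccontr)
  define A where "A u v q = frechet_derivative (\<lambda>q. frechet_derivative f (at q) u) (at q) v" for u v q
  assume "\<not> ?thesis"
  then have ne: "A u v x \<noteq> A v u x" by (simp add: A_def)
  \<comment> \<open>Half the gap, so that no number lies within \<open>e\<close> of both
    values.\<close>
  define e where "e = \<bar>A u v x - A v u x\<bar> / 2"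
  have e: "e > 0" using ne by (simp add: e_def)
  have cont: "continuous_on S (A u v)" for u v
    unfolding A_def by (intro smooth_on_continuous smooth_on_derivative S)
  have near: "\<exists>d>0. \<forall>q\<in>S. dist q x < d \<longrightarrow> dist (A u v q) (A u v x) < e" for u v
    using cont[of u v] S(3) e unfolding continuous_on_iff by blast
  obtain d1 where d1: "d1 > 0" "\<And>q. q \<in> S \<Longrightarrow> dist q x < d1 \<Longrightarrow> dist (A u v q) (A u v x) < e"
    using near by blast
  obtain d2 where d2: "d2 > 0" "\<And>q. q \<in> S \<Longrightarrow> dist q x < d2 \<Longrightarrow> dist (A v u q) (A v u x) < e"
    using near by blast
  obtain d3 where d3: "d3 > 0" "ball x d3 \<subseteq> S"
    using S openE by blast
  define d where "d = min d1 (min d2 d3)"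
  have d: "d > 0" "d \<le> d1" "d \<le> d2" "d \<le> d3" using d1 d2 d3 by (auto simp: d_def)
  \<comment> \<open>The factor 2 makes the bound \<open>hb\<close> strict; the summand 1 avoids a
    zero denominator when \<open>u\<close> and \<open>v\<close> vanish.\<close>
  define h where "h = d / (2 * (norm u + norm v + 1))"
  have nn: "norm u + norm v + 1 > 0" by (simp add: add_nonneg_pos)
  have h: "h > 0" using d nn by (simp add: h_def)
  have hb: "h * (norm u + norm v) < d"
  proof -
    have "h * (norm u + norm v) \<le> h * (norm u + norm v + 1)"
      using h by (simp add: mult_left_mono)
    also have "\<dots> = d / 2"
      using nn by (simp add: h_def divide_simps)
    finally show ?thesis using d by simp
  qed
  have close: "dist (x + a *\<^sub>R u' + b *\<^sub>R v') x < d"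
    if "0 \<le> a" "a \<le> h" "0 \<le> b" "b \<le> h" "norm u' + norm v' = norm u + norm v" for a b u' v'
  proof -
    have "dist (x + a *\<^sub>R u' + b *\<^sub>R v') x = norm (a *\<^sub>R u' + b *\<^sub>R v')"
      by (simp add: dist_norm add.assoc)
    also have "\<dots> \<le> a * norm u' + b * norm v'"
      using norm_triangle_ineq[of "a *\<^sub>R u'" "b *\<^sub>R v'"] that by simp
    also have "\<dots> \<le> h * norm u' + h * norm v'"
      using that by (intro add_mono mult_right_mono) auto
    also have "\<dots> = h * (norm u + norm v)"
      using that(5) by (metis distrib_left)
    finally show ?thesis using hb by simp
  qed
  have inS: "x + a *\<^sub>R u' + b *\<^sub>R v' \<in> S"
    if "0 \<le> a" "a \<le> h" "0 \<le> b" "b \<le> h" "norm u' + norm v' = norm u + norm v" for a b u' v'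
    using close[OF that] d d3 by (auto simp: dist_commute)
  obtain a b where ab: "0 < a" "a < h" "0 < b" "b < h" and
    1: "f (x + h *\<^sub>R u + h *\<^sub>R v) - f (x + h *\<^sub>R u) - f (x + h *\<^sub>R v) + f x = h * h * A u v (x + a *\<^sub>R u + b *\<^sub>R v)"
    using second_difference_mean_value[OF S(1,2) h, of x u v] inS[of _ _ u v] unfolding A_def by blast
  obtain a' b' where ab': "0 < a'" "a' < h" "0 < b'" "b' < h" and
    2: "f (x + h *\<^sub>R v + h *\<^sub>R u) - f (x + h *\<^sub>R v) - f (x + h *\<^sub>R u) + f x = h * h * A v u (x + a' *\<^sub>R v + b' *\<^sub>R u)"
    using second_difference_mean_value[OF S(1,2) h, of x v u] inS[of _ _ v u] unfolding A_def by (auto simp: add.commute)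
  have swap: "x + h *\<^sub>R v + h *\<^sub>R u = x + h *\<^sub>R u + h *\<^sub>R v" by (simp add: algebra_simps)
  have "h * h * A u v (x + a *\<^sub>R u + b *\<^sub>R v) = h * h * A v u (x + a' *\<^sub>R v + b' *\<^sub>R u)"
    using 1 2[unfolded swap] by linarith
  then have eq: "A u v (x + a *\<^sub>R u + b *\<^sub>R v) = A v u (x + a' *\<^sub>R v + b' *\<^sub>R u)"
    using h by simp
  have "dist (A u v (x + a *\<^sub>R u + b *\<^sub>R v)) (A u v x) < e"
    using ab d close[of a b u v] by (intro d1 inS) auto
  moreover have "dist (A v u (x + a' *\<^sub>R v + b' *\<^sub>R u)) (A v u x) < e"
    using ab' d close[of a' b' v u] by (intro d2 inS) (auto simp: add.commute)
  ultimately show False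
    unfolding eq dist_real_def e_def by argo
qed

lemma frechet_derivative_linear_image:
  assumes "bounded_linear h" "f differentiable at q"
  shows "frechet_derivative (\<lambda>r. h (f r)) (at q) v = h (frechet_derivative f (at q) v)"
  using frechet_derivative_at[OF bounded_linear.has_derivative[OF assms(1) frechet_derivative_works[THEN iffD1, OF assms(2)]]]
  by metis

lemma second_derivative_symmetric:
  fixes f :: "'a::real_normed_vector \<Rightarrow> 'b::euclidean_space"
  assumes S: "open S" "smooth_on S f" "x \<in> S"
  shows "frechet_derivative (\<lambda>q. frechet_derivative f (at q) u) (at x) v
       = frechet_derivative (\<lambda>q. frechet_derivative f (at q) v) (at x) u"
proof (rule euclidean_eqI)
  fix b :: 'b assume "b \<in> Basis"
  have 1: "frechet_derivative (\<lambda>q. f q \<bullet> b) (at r) u = frechet_derivative f (at r) u \<bullet> b" if "r \<in> S" for r u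
    by (rule frechet_derivative_linear_image[OF bounded_linear_inner_left smooth_on_differentiable[OF S(2,1) that]])
  have 2: "frechet_derivative (\<lambda>q. frechet_derivative (\<lambda>q. f q \<bullet> b) (at q) u) (at x) v
      = frechet_derivative (\<lambda>q. frechet_derivative f (at q) u) (at x) v \<bullet> b" for u v
  proof -
    have "frechet_derivative (\<lambda>q. frechet_derivative (\<lambda>q. f q \<bullet> b) (at q) u) (at x) v
      = frechet_derivative (\<lambda>q. frechet_derivative f (at q) u \<bullet> b) (at x) v"
      by (rule fun_cong[OF frechet_derivative_cong_open[OF S(1,3)]]) (rule 1)
    also have "\<dots> = frechet_derivative (\<lambda>q. frechet_derivative f (at q) u) (at x) v \<bullet> b"
      by (rule frechet_derivative_linear_image[OF bounded_linear_inner_left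
            smooth_on_differentiable[OF smooth_on_derivative[OF S(2)] S(1,3)]])
    finally show ?thesis .
  qed
  show "frechet_derivative (\<lambda>q. frechet_derivative f (at q) u) (at x) v \<bullet> b
       = frechet_derivative (\<lambda>q. frechet_derivative f (at q) v) (at x) u \<bullet> b"
    using second_derivative_symmetric_real[OF S(1) smooth_on_inner_const[OF S(1,2)] S(3), of b u v]
    by (simp only: 2)
qed

lemma frechet_derivative_field:
  fixes f :: "'a::euclidean_space \<Rightarrow> 'b::real_normed_vector"
  assumes S: "open S" "smooth_on S f" "smooth_on S X" "x \<in> S"
  shows "frechet_derivative (\<lambda>q. frechet_derivative f (at q) (X q)) (at x) v =
    frechet_derivative (\<lambda>q. frechet_derivative f (at q) (X x)) (at x) v
    + frechet_derivative f (at x) (frechet_derivative X (at x) v)"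
proof -
  define c where "c X q = (\<Sum>b\<in>Basis. (X q \<bullet> b) *\<^sub>R frechet_derivative f (at q) b)" for X :: "'a \<Rightarrow> 'a" and q
  have expand: "frechet_derivative f (at q) w = (\<Sum>b\<in>Basis. (w \<bullet> b) *\<^sub>R frechet_derivative f (at q) b)"
    if "q \<in> S" for q w
    by (rule linear_basis_expansion[OF has_derivative_linear[OF smooth_on_has_derivative[OF S(2,1) that]]])
  have Dc: "frechet_derivative (\<lambda>q. frechet_derivative f (at q) (X q)) (at x) v =
    (\<Sum>b\<in>Basis. (X x \<bullet> b) *\<^sub>R frechet_derivative (\<lambda>q. frechet_derivative f (at q) b) (at x) v
      + (frechet_derivative X (at x) v \<bullet> b) *\<^sub>R frechet_derivative f (at x) b)"
    if "smooth_on S X" for X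
  proof -
    have D: "((c X) has_derivative (\<lambda>v. (\<Sum>b\<in>Basis. (X x \<bullet> b) *\<^sub>R frechet_derivative (\<lambda>q. frechet_derivative f (at q) b) (at x) v
      + (frechet_derivative X (at x) v \<bullet> b) *\<^sub>R frechet_derivative f (at x) b))) (at x)"
      unfolding c_def
      by (intro has_derivative_sum has_derivative_scaleR has_derivative_inner_left
          smooth_on_has_derivative[OF that S(1,4)] smooth_on_has_derivative[OF smooth_on_derivative[OF S(2)] S(1,4)])
    moreover have "frechet_derivative (\<lambda>q. frechet_derivative f (at q) (X q)) (at x) = frechet_derivative (c X) (at x)"
      by (rule frechet_derivative_cong_open[OF S(1,4)], unfold c_def) (rule expand)
    ultimately show ?thesis
      by (simp only: frechet_derivative_at[OF D, symmetric])
  qed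
  have "frechet_derivative f (at x) (frechet_derivative X (at x) v) =
    (\<Sum>b\<in>Basis. (frechet_derivative X (at x) v \<bullet> b) *\<^sub>R frechet_derivative f (at x) b)"
    by (rule expand[OF S(4)])
  then show ?thesis
    \<comment> \<open>The constant field \<open>X x\<close> has zero derivative, so the same
      expansion applied to it yields exactly the first term of the claim.\<close>
    unfolding Dc[OF S(3)] Dc[OF smooth_on_const[OF S(1), of "X x"]]
    by (simp add: sum.distrib)
qed

text \<open>The second-order terms cancel by symmetry; the derivative along the Lie bracket of
  \<open>X\<close> and \<open>Y\<close> is what remains.\<close>

lemma commutator_derivative:
  fixes f :: "'a::euclidean_space \<Rightarrow> 'b::euclidean_space"
  assumes S: "open S" "smooth_on S f" "smooth_on S X" "smooth_on S Y" "x \<in> S"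
  shows "frechet_derivative (\<lambda>q. frechet_derivative f (at q) (Y q)) (at x) (X x)
       - frechet_derivative (\<lambda>q. frechet_derivative f (at q) (X q)) (at x) (Y x)
       = frechet_derivative f (at x) (frechet_derivative Y (at x) (X x) - frechet_derivative X (at x) (Y x))"
proof -
  have lin: "linear (frechet_derivative f (at x))"
    by (rule has_derivative_linear[OF smooth_on_has_derivative[OF S(2,1,5)]])
  show ?thesis
    unfolding frechet_derivative_field[OF S(1,2,4,5)] frechet_derivative_field[OF S(1,2,3,5)]
    using second_derivative_symmetric[OF S(1,2,5), of "Y x" "X x"]
    by (simp add: linear_diff[OF lin])
qed

section \<open>Smoothness of inverse maps\<close>

lemma smooth_on_det:
  fixes A :: "'a::real_normed_vector \<Rightarrow> real^'n^'n"
  assumes "open S" "\<And>i j. smooth_on S (\<lambda>q. A q $ i $ j)"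
  shows "smooth_on S (\<lambda>q. det (A q))"
  unfolding det_def by (intro smooth_intros assms)

text \<open>The derivative of \<open>g\<close> at a point is the inverse of the derivative of
  \<open>f\<close> at its image under \<open>g\<close>, and Cramer's rule makes this inverse a
  smooth function of the image. So if \<open>g\<close> is of class \<open>k\<close>, its derivative
  is too, and the regularity climbs by one at each step.\<close>

lemma smooth_on_inverse_map:
  fixes f :: "real^'n \<Rightarrow> real^'n"
  assumes U: "open U" "smooth_on U f" and V: "open V" and hom: "homeomorphism U V f g"
    and inj: "\<And>q. q \<in> U \<Longrightarrow> inj (frechet_derivative f (at q))"
  shows "smooth_on V g"
proof -
  define J where "J q = matrix (frechet_derivative f (at q))" for q
  \<comment> \<open>Cramer's solution \<open>w\<close> of the linear system with matrix
    \<open>J q\<close> and right-hand side \<open>v\<close>.\<close>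
  define B where "B q v = (\<chi> k. det (\<chi> i j. if j = k then v $ i else J q $ i $ j) / det (J q))" for q and v :: "real^'n"
  have gU: "g y \<in> U" if "y \<in> V" for y
    using hom that by (auto simp: homeomorphism_def)
  have lin: "linear (frechet_derivative f (at q))" if "q \<in> U" for q
    by (rule has_derivative_linear[OF smooth_on_has_derivative[OF U(2,1) that]])
  have J: "J q *v v = frechet_derivative f (at q) v" if "q \<in> U" for q v
    unfolding J_def using lin[OF that] by (simp add: matrix_works)
  have det: "det (J q) \<noteq> 0" if "q \<in> U" for q
  proof -
    have "inj ((*v) (J q))"
      using inj[OF that] by (simp add: J[OF that] inj_def)
    then show ?thesis
      using det_nz_iff_inj[OF lin[OF that]] inj[OF that] by (simp add: J_def)
  qed
  have B: "frechet_derivative f (at q) w = v \<longleftrightarrow> w = B q v" if "q \<in> U" for q v w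
    using cramer[OF det[OF that], of w v] J[OF that, of w] by (simp add: B_def)
  have Dg: "(g has_derivative B (g y)) (at y)" if "y \<in> V" for y
  proof (rule has_derivative_inverse_basic)
    show "(f has_derivative frechet_derivative f (at (g y))) (at (g y))"
      by (rule smooth_on_has_derivative[OF U(2,1) gU[OF that]])
    have q: "g y \<in> U" by (rule gU[OF that])
    have BI: "B (g y) (frechet_derivative f (at (g y)) w) = w" for w
      using B[OF q] by metis
    then show "B (g y) \<circ> frechet_derivative f (at (g y)) = id" by auto
    have "surj (frechet_derivative f (at (g y)))"
      using inj[OF q] lin[OF q] linear_injective_imp_surjective by blast
    then have "linear (B (g y))"
      using lin[OF q] BI by (metis inj_eq[OF inj[OF q]] left_inverse_linear o_def eq_id_iff surj_iff)
    then show "bounded_linear (B (g y))"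
      by (simp add: linear_conv_bounded_linear)
    show "continuous (at y) g"
      using hom that V by (auto simp: homeomorphism_def continuous_on_eq_continuous_at)
    show "f (g z) = z" if "z \<in> V" for z
      using hom that by (simp add: homeomorphism_def)
  qed (use V that in auto)
  have sB: "smooth_on U (\<lambda>q. B q v)" for v
  proof -
    have sJ: "smooth_on U (\<lambda>q. J q $ i $ j)" for i j
    proof -
      have "smooth_on U (\<lambda>q. frechet_derivative f (at q) (axis j 1) $ i)"
        by (intro smooth_intros U smooth_on_derivative)
      then show ?thesis by (simp add: J_def matrix_def)
    qed
    have "smooth_on U (\<lambda>q. (\<chi> i j. if j = k then v $ i else J q $ i $ j) $ i $ j)" for i j k
      using sJ[of i j] smooth_on_const[OF U(1)] by (cases "j = k") auto
    then show ?thesis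
      unfolding B_def by (intro smooth_on_vec_lambda smooth_on_divide smooth_on_det U(1) sJ det)
  qed
  have "Ck_on k V g" for k
  proof (induction k)
    case 0
    show ?case using hom by (simp add: homeomorphism_def)
  next
    case (Suc k)
    show ?case
    proof (rule Ck_on_SucI[OF V Dg])
      show "Ck_on k V (\<lambda>y. B (g y) v)" for v
        using sB[of v] gU by (intro Ck_on_compose[OF V U(1) _ Suc]) (auto simp: smooth_on_def)
    qed
  qed
  then show ?thesis by (simp add: smooth_on_def)
qed

text \<open>The inverse function theorem asks for a derivative that is continuous as an
  operator-valued map; in finite dimension this follows from continuity in each fixed
  direction.\<close>

lemma smooth_local_inverse:
  fixes f :: "real^'n \<Rightarrow> real^'n"
  assumes U: "open U" "smooth_on U f" "x0 \<in> U"
    and inj: "\<And>q. q \<in> U \<Longrightarrow> inj (frechet_derivative f (at q))"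
  obtains U' V g where "open U'" "U' \<subseteq> U" "x0 \<in> U'" "open V" "homeomorphism U' V f g" "smooth_on V g"
proof -
  define f' where "f' q = Blinfun (frechet_derivative f (at q))" for q
  have D: "(f has_derivative frechet_derivative f (at q)) (at q)" if "q \<in> U" for q
    by (rule smooth_on_has_derivative[OF U(2,1) that])
  have f': "blinfun_apply (f' q) = frechet_derivative f (at q)" if "q \<in> U" for q
    unfolding f'_def by (rule bounded_linear_Blinfun_apply[OF has_derivative_bounded_linear[OF D[OF that]]])
  have "continuous_on U f'"
  proof (rule continuous_on_blinfun_componentwise)
    fix i :: "real^'n"
    have "continuous_on U (\<lambda>q. frechet_derivative f (at q) i)"
      by (intro smooth_on_continuous smooth_on_derivative U)
    then show "continuous_on U (\<lambda>q. blinfun_apply (f' q) i)"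
      by (rule continuous_on_eq) (simp add: f')
  qed
  moreover obtain h where h: "linear h" "h \<circ> frechet_derivative f (at x0) = id"
    using linear_injective_left_inverse[OF has_derivative_linear[OF D[OF U(3)]] inj[OF U(3)]] by blast
  have "Blinfun h o\<^sub>L f' x0 = id_blinfun"
  proof (rule blinfun_eqI)
    fix v
    have "blinfun_apply (Blinfun h) = h"
      by (rule bounded_linear_Blinfun_apply) (use h(1) in \<open>simp add: linear_conv_bounded_linear\<close>)
    then show "blinfun_apply (Blinfun h o\<^sub>L f' x0) v = blinfun_apply id_blinfun v"
      using fun_cong[OF h(2), of v] f'[OF U(3)] by simp
  qed
  moreover have "(f has_derivative blinfun_apply (f' q)) (at q)" if "q \<in> U" for q
    using D f' that by simp
  ultimately obtain U' V g g' where *: "open U'" "U' \<subseteq> U" "x0 \<in> U'" "open V" "homeomorphism U' V f g"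
    using inverse_function_theorem[OF U(1) _ _ U(3)] by metis
  moreover have "smooth_on V g"
    using * inj by (intro smooth_on_inverse_map[OF *(1) smooth_on_subset[OF U(2) *(2)] *(4,5)]) auto
  ultimately show thesis using that by blast
qed

section \<open>Frame calculus on a chart\<close>

lemma exhaust_5:
  fixes x :: 5
  shows "x = 1 \<or> x = 2 \<or> x = 3 \<or> x = 4 \<or> x = 5"
proof (induct x)
  case (of_int z)
  then have "z = 0 \<or> z = 1 \<or> z = 2 \<or> z = 3 \<or> z = 4" by fastforce
  then show ?case by auto
qed

lemma forall_5: "(\<forall>i::5. P i) \<longleftrightarrow> P 1 \<and> P 2 \<and> P 3 \<and> P 4 \<and> P 5"
  by (metis exhaust_5)

lemma UNIV_5: "UNIV = {1, 2, 3, 4, 5::5}"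
  using exhaust_5 by auto

lemma sum_5: "sum f (UNIV::5 set) = f 1 + f 2 + f 3 + f 4 + f 5"
  unfolding UNIV_5 by (simp add: ac_simps)

lemma vector_5 [simp]:
  "(vector [a, b, c, d, e] :: 'a::zero^5) $ 1 = a"
  "(vector [a, b, c, d, e] :: 'a^5) $ 2 = b"
  "(vector [a, b, c, d, e] :: 'a^5) $ 3 = c"
  "(vector [a, b, c, d, e] :: 'a^5) $ 4 = d"
  "(vector [a, b, c, d, e] :: 'a^5) $ 5 = e"
  unfolding vector_def by simp_all

section \<open>The indefinite product and rules for derivatives\<close>

lemma ip52_commute: "ip52 a b = ip52 b a"
  by (simp add: ip52_def mult.commute)

lemma bounded_bilinear_ip52: "bounded_bilinear ip52"
proof -
  have "bilinear ip52"
    by (auto simp: bilinear_def ip52_def linear_iff algebra_simps)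
  then show ?thesis
    by (simp add: bilinear_conv_bounded_bilinear)
qed

lemmas ip52_simps =
  bounded_bilinear.add_left[OF bounded_bilinear_ip52] bounded_bilinear.add_right[OF bounded_bilinear_ip52]
  bounded_bilinear.diff_left[OF bounded_bilinear_ip52] bounded_bilinear.diff_right[OF bounded_bilinear_ip52]
  bounded_bilinear.minus_left[OF bounded_bilinear_ip52] bounded_bilinear.minus_right[OF bounded_bilinear_ip52]
  bounded_bilinear.zero_left[OF bounded_bilinear_ip52] bounded_bilinear.zero_right[OF bounded_bilinear_ip52]
  bounded_bilinear.scaleR_left[OF bounded_bilinear_ip52] bounded_bilinear.scaleR_right[OF bounded_bilinear_ip52]
lemmas ip52_sum_left = bounded_bilinear.sum_left[OF bounded_bilinear_ip52]
lemmas ip52_sum_right = bounded_bilinear.sum_right[OF bounded_bilinear_ip52]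
lemmas smooth_on_ip52 [smooth_intros] = smooth_on_bilinear[OF bounded_bilinear_ip52]

text \<open>Pairing with \<open>f j\<close> recovers the \<open>j\<close>-th coefficient up to the
  nonzero factor \<open>\<eta> j\<close>. Hence the five vectors are independent, and by dimension
  they span.\<close>

lemma ip52_orthogonal_expansion:
  fixes f :: "5 \<Rightarrow> real^5" and \<eta> :: "5 \<Rightarrow> real"
  assumes orth: "\<And>i j. ip52 (f i) (f j) = (if i = j then \<eta> i else 0)" and nz: "\<And>i. \<eta> i \<noteq> 0"
  shows "X = (\<Sum>i\<in>UNIV. (ip52 X (f i) / \<eta> i) *\<^sub>R f i)"
proof -
  define T :: "real^5 \<Rightarrow> real^5" where "T c = (\<Sum>i\<in>UNIV. c $ i *\<^sub>R f i)" for c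
  have lin: "linear T"
    unfolding T_def by (intro linearI) (simp_all add: scaleR_add_left sum.distrib scaleR_sum_right)
  have ipT: "ip52 (T c) (f j) = c $ j * \<eta> j" for c j
    by (simp add: T_def ip52_sum_left ip52_simps orth if_distrib cong: if_cong)
  have "inj T"
    using nz by (intro injI) (metis ipT mult_right_cancel vec_eq_iff)
  then obtain c where c: "X = T c"
    using linear_injective_imp_surjective[OF lin] by (metis surjD)
  have "ip52 X (f i) / \<eta> i = c $ i" for i
    using nz[of i] by (simp add: c ipT)
  then show ?thesis
    using c by (simp add: T_def)
qed

lemma frechet_derivative_rules:
  assumes "open S" "q \<in> S" "smooth_on S f" "smooth_on S g"
  shows "frechet_derivative (\<lambda>r. f r + g r) (at q) v = frechet_derivative f (at q) v + frechet_derivative g (at q) v"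
    and "frechet_derivative (\<lambda>r. f r - g r) (at q) v = frechet_derivative f (at q) v - frechet_derivative g (at q) v"
  using frechet_derivative_at[OF has_derivative_add[OF smooth_on_has_derivative[OF assms(3,1,2)] smooth_on_has_derivative[OF assms(4,1,2)]]]
    frechet_derivative_at[OF has_derivative_diff[OF smooth_on_has_derivative[OF assms(3,1,2)] smooth_on_has_derivative[OF assms(4,1,2)]]]
  by metis+

lemma frechet_derivative_bilinear:
  assumes "bounded_bilinear pr" "open S" "q \<in> S" "smooth_on S f" "smooth_on S g"
  shows "frechet_derivative (\<lambda>r. pr (f r) (g r)) (at q) v =
    pr (f q) (frechet_derivative g (at q) v) + pr (frechet_derivative f (at q) v) (g q)"
  using frechet_derivative_at[OF bounded_bilinear.FDERIV[OF assms(1)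
        smooth_on_has_derivative[OF assms(4,2,3)] smooth_on_has_derivative[OF assms(5,2,3)]]]
  by metis

lemmas frechet_derivative_ip52 = frechet_derivative_bilinear[OF bounded_bilinear_ip52]
lemmas frechet_derivative_scaleR = frechet_derivative_bilinear[OF bounded_bilinear_scaleR]
lemmas frechet_derivative_mult =
  frechet_derivative_bilinear[OF bounded_bilinear_mult[where 'a = real]]

lemma frechet_derivative_scaleR_const:
  assumes "open S" "q \<in> S" "smooth_on S f"
  shows "frechet_derivative (\<lambda>r. c *\<^sub>R f r) (at q) v = c *\<^sub>R frechet_derivative f (at q) v"
  by (rule frechet_derivative_linear_image[OF bounded_linear_scaleR_right smooth_on_differentiable[OF assms(3,1,2)]])

lemma frechet_derivative_pd:
  assumes "linear (frechet_derivative f (at q))"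
  shows "frechet_derivative f (at q) v = (\<Sum>i\<in>UNIV. v $ i *\<^sub>R pd i f q)"
proof -
  have "frechet_derivative f (at q) v = frechet_derivative f (at q) (\<Sum>i\<in>UNIV. v $ i *\<^sub>R axis i 1)"
    using basis_expansion[of v] by (simp add: scalar_mult_eq_scaleR)
  also have "\<dots> = (\<Sum>i\<in>UNIV. v $ i *\<^sub>R pd i f q)"
    by (simp add: linear_sum[OF assms] linear_cmul[OF assms] pd_def)
  finally show ?thesis .
qed

lemma second_derivative_pd:
  fixes f :: "real^4 \<Rightarrow> 'b::euclidean_space"
  assumes "open S" "q \<in> S" "smooth_on S f"
  shows "frechet_derivative (\<lambda>r. frechet_derivative f (at r) v) (at q) w =
    (\<Sum>i\<in>UNIV. \<Sum>j\<in>UNIV. (w $ i * v $ j) *\<^sub>R pd i (pd j f) q)"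
proof -
  have lin: "linear (frechet_derivative g (at r))" if "smooth_on S g" "r \<in> S" for g :: "real^4 \<Rightarrow> 'b" and r
    by (rule has_derivative_linear[OF smooth_on_has_derivative[OF that(1) assms(1) that(2)]])
  have s: "smooth_on S (\<lambda>r. v $ j *\<^sub>R pd j f r)" for j
    unfolding pd_def by (intro smooth_intros smooth_on_derivative assms)
  have s': "smooth_on S (pd j f)" for j
    unfolding pd_def by (intro smooth_on_derivative assms)
  have "frechet_derivative (\<lambda>r. frechet_derivative f (at r) v) (at q) w
      = frechet_derivative (\<lambda>r. \<Sum>j\<in>UNIV. v $ j *\<^sub>R pd j f r) (at q) w"
    by (rule fun_cong[OF frechet_derivative_cong_open[OF assms(1,2)]])
      (rule frechet_derivative_pd[OF lin[OF assms(3)]])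
  also have "\<dots> = (\<Sum>j\<in>UNIV. v $ j *\<^sub>R frechet_derivative (pd j f) (at q) w)"
  proof -
    have D: "((\<lambda>r. \<Sum>j\<in>UNIV. v $ j *\<^sub>R pd j f r) has_derivative
        (\<lambda>w. \<Sum>j\<in>UNIV. v $ j *\<^sub>R frechet_derivative (pd j f) (at q) w)) (at q)"
      by (intro has_derivative_sum has_derivative_scaleR_right smooth_on_has_derivative[OF s' assms(1,2)])
    show ?thesis by (simp only: frechet_derivative_at[OF D, symmetric])
  qed
  also have "\<dots> = (\<Sum>j\<in>UNIV. \<Sum>i\<in>UNIV. (w $ i * v $ j) *\<^sub>R pd i (pd j f) q)"
    by (simp add: frechet_derivative_pd[OF lin[OF s' assms(2)]] scaleR_sum_right mult.commute)
  also have "\<dots> = (\<Sum>i\<in>UNIV. \<Sum>j\<in>UNIV. (w $ i * v $ j) *\<^sub>R pd i (pd j f) q)"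
    by (rule sum.swap)
  finally show ?thesis .
qed

lemma matrix_inv_eqI:
  fixes A B :: "real^'n^'n"
  assumes "A ** B = mat 1"
  shows "matrix_inv A = B"
proof -
  have BA: "B ** A = mat 1"
    using assms matrix_left_right_inverse by blast
  have "A ** matrix_inv A = mat 1 \<and> matrix_inv A ** A = mat 1"
    unfolding matrix_inv_def using assms BA by (rule_tac someI[of _ B]) simp
  then show ?thesis
    by (metis BA matrix_mul_assoc matrix_mul_lid matrix_mul_rid)
qed

text \<open>The signs \<open>\<epsilon>\<close> are constants here; \<open>chart_classified\<close>
  achieves this by shrinking the neighbourhood, since a continuous square with values 1 and -1 is
  locally constant.\<close>

locale frame_chart =
  fixes U :: "(real^4) set" and y n :: "real^4 \<Rightarrow> real^5"
    and e :: "4 \<Rightarrow> real^4 \<Rightarrow> real^4" and \<epsilon> :: "4 \<Rightarrow> real"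
  assumes U: "open U" and y: "smooth_on U y" and n: "smooth_on U n" and e: "\<And>i. smooth_on U (e i)"
    and inj_y: "\<And>q. q \<in> U \<Longrightarrow> inj (frechet_derivative y (at q))"
    and nn: "\<And>q. q \<in> U \<Longrightarrow> ip52 (n q) (n q) = 1"
    and nt: "\<And>q v. q \<in> U \<Longrightarrow> ip52 (n q) (frechet_derivative y (at q) v) = 0"
    and orth: "\<And>q i j. q \<in> U \<Longrightarrow>
      ip52 (frechet_derivative y (at q) (e i q)) (frechet_derivative y (at q) (e j q)) = (if i = j then \<epsilon> i else 0)"
    and eps: "\<And>i. \<epsilon> i * \<epsilon> i = 1"
begin

abbreviation dd :: "(real^4 \<Rightarrow> 'b::real_normed_vector) \<Rightarrow> 4 \<Rightarrow> real^4 \<Rightarrow> 'b" where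
  "dd f a \<equiv> \<lambda>q. frechet_derivative f (at q) (e a q)"

definition E :: "4 \<Rightarrow> real^4 \<Rightarrow> real^5" where "E a = dd y a"

text \<open>Connection coefficients. Pairing with a tangent vector discards the normal part, so the
  flat derivative stands for the Levi-Civita connection. The factor \<open>\<epsilon> c\<close> is
  added wherever a component along \<open>E c\<close> is meant.\<close>

definition G :: "4 \<Rightarrow> 4 \<Rightarrow> 4 \<Rightarrow> real^4 \<Rightarrow> real" where
  "G a b c q = ip52 (dd (E b) a q) (E c q)"

lemma smooth_E: "smooth_on U (E a)"
  unfolding E_def by (intro smooth_intros U y e)

lemma smooth_dd: "smooth_on U f \<Longrightarrow> smooth_on U (dd f a)"
  by (intro smooth_intros U e)

lemma lin: "q \<in> U \<Longrightarrow> smooth_on U f \<Longrightarrow> linear (frechet_derivative f (at q))"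
  by (rule has_derivative_linear[OF smooth_on_has_derivative[OF _ U]])

lemma dd_cong: "q \<in> U \<Longrightarrow> (\<And>r. r \<in> U \<Longrightarrow> f r = g r) \<Longrightarrow> dd f a q = dd g a q"
  by (rule fun_cong[OF frechet_derivative_cong_open[OF U]])

lemma eps_nz: "\<epsilon> i \<noteq> 0"
  using eps[of i] by auto

lemma ipE: "q \<in> U \<Longrightarrow> ip52 (E i q) (E j q) = (if i = j then \<epsilon> i else 0)"
  by (simp add: E_def orth)

lemma ipnE: "q \<in> U \<Longrightarrow> ip52 (n q) (E j q) = 0"
  by (simp add: E_def nt)

lemma ipEn: "q \<in> U \<Longrightarrow> ip52 (E j q) (n q) = 0"
  by (simp add: ipnE ip52_commute)

lemma ambient_expansion:
  assumes q: "q \<in> U"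
  shows "X = (\<Sum>a\<in>UNIV. (\<epsilon> a * ip52 X (E a q)) *\<^sub>R E a q) + ip52 X (n q) *\<^sub>R n q"
proof -
  define f :: "5 \<Rightarrow> real^5" where "f i = (if i = 1 then E 1 q else if i = 2 then E 2 q else
    if i = 3 then E 3 q else if i = 4 then E 4 q else n q)" for i
  define \<eta> :: "5 \<Rightarrow> real" where "\<eta> i = (if i = 1 then \<epsilon> 1 else if i = 2 then \<epsilon> 2 else
    if i = 3 then \<epsilon> 3 else if i = 4 then \<epsilon> 4 else 1)" for i
  have "\<forall>i j. ip52 (f i) (f j) = (if i = j then \<eta> i else 0)"
    unfolding forall_5 f_def \<eta>_def by (simp add: ipE[OF q] ipnE[OF q] ipEn[OF q] nn[OF q])
  moreover have "\<forall>i. \<eta> i \<noteq> 0"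
    unfolding forall_5 \<eta>_def by (simp add: eps_nz)
  ultimately have "X = (\<Sum>i\<in>UNIV. (ip52 X (f i) / \<eta> i) *\<^sub>R f i)"
    by (intro ip52_orthogonal_expansion) auto
  moreover have "x / \<epsilon> a = \<epsilon> a * x" for x a
    using eps[of a] by (simp add: field_simps eps_nz)
  ultimately show ?thesis
    by (simp add: sum_5 sum_4 f_def \<eta>_def)
qed

lemma tangent_expansion:
  assumes q: "q \<in> U"
  shows "v = (\<Sum>a\<in>UNIV. (\<epsilon> a * ip52 (frechet_derivative y (at q) v) (E a q)) *\<^sub>R e a q)"
proof -
  let ?D = "frechet_derivative y (at q)"
  have l: "linear ?D" by (rule lin[OF q y])
  have "?D v = (\<Sum>a\<in>UNIV. (\<epsilon> a * ip52 (?D v) (E a q)) *\<^sub>R E a q) + ip52 (?D v) (n q) *\<^sub>R n q"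
    by (rule ambient_expansion[OF q])
  also have "\<dots> = ?D (\<Sum>a\<in>UNIV. (\<epsilon> a * ip52 (?D v) (E a q)) *\<^sub>R e a q)"
    using nt[OF q, of v] by (simp add: linear_sum[OF l] linear_cmul[OF l] E_def ip52_commute)
  finally show ?thesis
    using inj_y[OF q] by (simp only: inj_eq)
qed

lemma derivative_expansion:
  assumes q: "q \<in> U" and f: "smooth_on U f"
  shows "frechet_derivative f (at q) v = (\<Sum>a\<in>UNIV. (\<epsilon> a * ip52 (frechet_derivative y (at q) v) (E a q)) *\<^sub>R dd f a q)"
proof -
  have "frechet_derivative f (at q) v = frechet_derivative f (at q)
    (\<Sum>a\<in>UNIV. (\<epsilon> a * ip52 (frechet_derivative y (at q) v) (E a q)) *\<^sub>R e a q)"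
    using tangent_expansion[OF q] by metis
  also have "\<dots> = (\<Sum>a\<in>UNIV. (\<epsilon> a * ip52 (frechet_derivative y (at q) v) (E a q)) *\<^sub>R dd f a q)"
    by (simp add: linear_sum[OF lin[OF q f]] linear_cmul[OF lin[OF q f]])
  finally show ?thesis .
qed

lemma normal_derivative_tangent:
  assumes q: "q \<in> U"
  shows "ip52 (frechet_derivative n (at q) v) (n q) = 0"
proof -
  have "frechet_derivative (\<lambda>r. ip52 (n r) (n r)) (at q) v = frechet_derivative (\<lambda>r. 1) (at q) v"
    by (rule fun_cong[OF frechet_derivative_cong_open[OF U q]]) (rule nn)
  then show ?thesis
    by (simp add: frechet_derivative_ip52[OF U q n n] ip52_commute)
qed

text \<open>This justifies the \<open>THE\<close> in \<open>shape_op\<close>: the derivative of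
  \<open>n\<close> is tangent because \<open>n\<close> has constant square, and injectivity of the
  differential makes the preimage unique.\<close>

lemma shape_op_eq:
  assumes q: "q \<in> U"
  shows "frechet_derivative y (at q) (shape_op y n q v) = - frechet_derivative n (at q) v"
proof -
  let ?D = "frechet_derivative y (at q)" and ?X = "- frechet_derivative n (at q) v"
  have l: "linear ?D" by (rule lin[OF q y])
  have "?X = (\<Sum>a\<in>UNIV. (\<epsilon> a * ip52 ?X (E a q)) *\<^sub>R E a q) + ip52 ?X (n q) *\<^sub>R n q"
    by (rule ambient_expansion[OF q])
  also have "\<dots> = ?D (\<Sum>a\<in>UNIV. (\<epsilon> a * ip52 ?X (E a q)) *\<^sub>R e a q)"
    using normal_derivative_tangent[OF q, of v]
    by (simp add: linear_sum[OF l] linear_cmul[OF l] linear_neg[OF l] E_def ip52_simps)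
  finally have Z: "?X = ?D (\<Sum>a\<in>UNIV. (\<epsilon> a * ip52 ?X (E a q)) *\<^sub>R e a q)" .
  show ?thesis
    unfolding shape_op_def by (rule theI[of "\<lambda>b. ?D b = ?X", OF Z[symmetric]])
      (rule injD[OF inj_y[OF q]], simp only: Z[symmetric])
qed

text \<open>Vanishing torsion: the differential of \<open>y\<close> sends the bracket of
  \<open>e a\<close> and \<open>e b\<close> to the difference of two derivatives of
  \<open>E\<close>, whose components are differences of \<open>G\<close>. It will be applied to
  \<open>n\<close> (Codazzi), to \<open>k 2\<close> (integrability) and to \<open>E 1\<close>
  (Gauss).\<close>

lemma bracket_formula:
  fixes f :: "real^4 \<Rightarrow> 'b::euclidean_space"
  assumes q: "q \<in> U" and f: "smooth_on U f"
  shows "dd (dd f b) a q - dd (dd f a) b q = (\<Sum>c\<in>UNIV. (\<epsilon> c * (G a b c q - G b a c q)) *\<^sub>R dd f c q)"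
proof -
  let ?w = "dd (e b) a q - dd (e a) b q"
  have "frechet_derivative y (at q) ?w = dd (E b) a q - dd (E a) b q"
    unfolding E_def using commutator_derivative[OF U y e e q, of b a] by simp
  then have "ip52 (frechet_derivative y (at q) ?w) (E c q) = G a b c q - G b a c q" for c
    by (simp add: G_def ip52_simps)
  then show ?thesis
    using commutator_derivative[OF U f e e q, of b a] derivative_expansion[OF q f, of ?w] by simp
qed

lemma G_antisym: "q \<in> U \<Longrightarrow> G a b c q = - G a c b q"
proof -
  assume q: "q \<in> U"
  have "dd (\<lambda>r. ip52 (E b r) (E c r)) a q = dd (\<lambda>r. if b = c then \<epsilon> b else 0) a q"
    by (rule dd_cong[OF q]) (rule ipE)
  then show ?thesis
    by (simp add: frechet_derivative_ip52[OF U q smooth_E smooth_E] G_def ip52_commute)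
qed

section \<open>Gradient and Laplacian in terms of the frame\<close>

lemma pd_frame: "q \<in> U \<Longrightarrow> smooth_on U f \<Longrightarrow> (\<Sum>i\<in>UNIV. e a q $ i *\<^sub>R pd i f q) = dd f a q"
  by (rule frechet_derivative_pd[OF lin, symmetric])

text \<open>Multiplying the Gram matrix by the frame sum gives, row by row, the
  \<open>tangent_expansion\<close> of a coordinate vector.\<close>

lemma matrix_inv_gram:
  assumes q: "q \<in> U"
  shows "matrix_inv (gram y q) = (\<chi> i j. \<Sum>a\<in>UNIV. \<epsilon> a * e a q $ i * e a q $ j)"
proof (rule matrix_inv_eqI)
  have *: "(\<Sum>l\<in>UNIV. ip52 (pd i y q) (pd l y q) * (\<Sum>a\<in>UNIV. \<epsilon> a * e a q $ l * e a q $ j)) = (if i = j then 1 else 0)" for i j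
  proof -
    have "(\<Sum>l\<in>UNIV. ip52 (pd i y q) (pd l y q) * (\<Sum>a\<in>UNIV. \<epsilon> a * e a q $ l * e a q $ j))
      = (\<Sum>l\<in>UNIV. \<Sum>a\<in>UNIV. \<epsilon> a * e a q $ j * ip52 (pd i y q) (e a q $ l *\<^sub>R pd l y q))"
      by (simp add: sum_distrib_left ip52_simps mult_ac)
    also have "\<dots> = (\<Sum>a\<in>UNIV. \<epsilon> a * e a q $ j * ip52 (pd i y q) (\<Sum>l\<in>UNIV. e a q $ l *\<^sub>R pd l y q))"
      by (subst sum.swap) (simp add: sum_distrib_left ip52_sum_right)
    also have "\<dots> = (\<Sum>a\<in>UNIV. (\<epsilon> a * ip52 (frechet_derivative y (at q) (axis i 1)) (E a q)) *\<^sub>R e a q) $ j"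
      unfolding pd_frame[OF q y] by (simp add: E_def pd_def mult_ac)
    also have "\<dots> = axis i 1 $ j"
      by (simp only: tangent_expansion[OF q, symmetric])
    finally show ?thesis by (simp add: axis_def eq_commute)
  qed
  show "gram y q ** (\<chi> i j. \<Sum>a\<in>UNIV. \<epsilon> a * e a q $ i * e a q $ j) = mat 1"
    by (simp add: vec_eq_iff matrix_matrix_mult_def gram_def mat_def *)
qed

lemma grad_eq:
  assumes q: "q \<in> U" and f: "smooth_on U f"
  shows "grad y f q = (\<Sum>a\<in>UNIV. (\<epsilon> a * dd f a q) *\<^sub>R e a q)"
proof -
  have "grad y f q $ i = (\<Sum>a\<in>UNIV. (\<epsilon> a * dd f a q) *\<^sub>R e a q) $ i" for i
  proof -
    have "grad y f q $ i = (\<Sum>j\<in>UNIV. \<Sum>a\<in>UNIV. \<epsilon> a * e a q $ i * (e a q $ j *\<^sub>R pd j f q))"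
      by (simp add: grad_def matrix_inv_gram[OF q] matrix_vector_mult_def sum_distrib_left sum_distrib_right mult_ac)
    also have "\<dots> = (\<Sum>a\<in>UNIV. \<epsilon> a * e a q $ i * (\<Sum>j\<in>UNIV. e a q $ j *\<^sub>R pd j f q))"
      by (subst sum.swap) (simp add: sum_distrib_left)
    also have "\<dots> = (\<Sum>a\<in>UNIV. (\<epsilon> a * dd f a q) *\<^sub>R e a q) $ i"
      unfolding pd_frame[OF q f] by (simp add: mult_ac)
    finally show ?thesis .
  qed
  then show ?thesis by (simp add: vec_eq_iff)
qed

text \<open>For a metric induced from flat space the derivatives of the Gram matrix split into
  products with second partial derivatives of \<open>y\<close>. By symmetry of the latter, four of
  the six products cancel, and the Christoffel symbols are the tangential components of these second
  derivatives.\<close>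

lemma christoffel_eq:
  assumes q: "q \<in> U"
  shows "christoffel y q k i j = (\<Sum>a\<in>UNIV. \<epsilon> a * ip52 (pd i (pd j y) q) (E a q) * e a q $ k)"
proof -
  have s: "smooth_on U (pd j y)" for j
    unfolding pd_def by (intro smooth_on_derivative y)
  have sym: "pd i (pd j y) q = pd j (pd i y) q" for i j
    unfolding pd_def by (rule second_derivative_symmetric[OF U y q])
  have dg: "pd i (\<lambda>r. gram y r $ j $ l) q = ip52 (pd i (pd j y) q) (pd l y q) + ip52 (pd j y q) (pd i (pd l y) q)" for i j l
  proof -
    have "pd i (\<lambda>r. gram y r $ j $ l) q = pd i (\<lambda>r. ip52 (pd j y r) (pd l y r)) q"
      by (simp add: gram_def)
    also have "\<dots> = ip52 (pd j y q) (pd i (pd l y) q) + ip52 (pd i (pd j y) q) (pd l y q)"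
      using frechet_derivative_ip52[OF U q s[of j] s[of l], of "axis i 1"] by (simp add: pd_def)
    finally show ?thesis by simp
  qed
  have "pd i (\<lambda>r. gram y r $ j $ l) q + pd j (\<lambda>r. gram y r $ i $ l) q - pd l (\<lambda>r. gram y r $ i $ j) q
      = 2 * ip52 (pd i (pd j y) q) (pd l y q)" for l
    unfolding dg sym[of j i] sym[of l i] sym[of l j] by (simp add: ip52_commute)
  then have "christoffel y q k i j = (\<Sum>l\<in>UNIV. (\<Sum>a\<in>UNIV. \<epsilon> a * e a q $ k * e a q $ l) * ip52 (pd i (pd j y) q) (pd l y q))"
    by (simp add: christoffel_def matrix_inv_gram[OF q] sum_distrib_left)
  also have "\<dots> = (\<Sum>l\<in>UNIV. \<Sum>a\<in>UNIV. \<epsilon> a * e a q $ k * ip52 (pd i (pd j y) q) (e a q $ l *\<^sub>R pd l y q))"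
    by (simp add: sum_distrib_left sum_distrib_right ip52_simps mult_ac)
  also have "\<dots> = (\<Sum>a\<in>UNIV. \<epsilon> a * e a q $ k * ip52 (pd i (pd j y) q) (\<Sum>l\<in>UNIV. e a q $ l *\<^sub>R pd l y q))"
    by (subst sum.swap) (simp add: sum_distrib_left ip52_sum_right)
  also have "\<dots> = (\<Sum>a\<in>UNIV. \<epsilon> a * ip52 (pd i (pd j y) q) (E a q) * e a q $ k)"
    unfolding pd_frame[OF q y] by (simp add: E_def mult_ac)
  finally show ?thesis .
qed

lemma second_derivative_frame:
  fixes f :: "real^4 \<Rightarrow> 'b::euclidean_space"
  assumes q: "q \<in> U" and f: "smooth_on U f"
  shows "(\<Sum>i\<in>UNIV. \<Sum>j\<in>UNIV. (e b q $ i * e b q $ j) *\<^sub>R pd i (pd j f) q)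
    = dd (dd f b) b q - frechet_derivative f (at q) (dd (e b) b q)"
  using second_derivative_pd[OF U q f, of "e b q" "e b q"] frechet_derivative_field[OF U f e q, of b "e b q"]
  by simp

text \<open>The trace of the covariant Hessian \<open>h\<close> is evaluated in the frame. The
  coordinate derivative \<open>?w b\<close> of the frame field enters twice, through the second
  derivative of \<open>f\<close> and through that of \<open>y\<close>, and the two contributions
  cancel.\<close>

lemma laplacian_eq:
  assumes q: "q \<in> U" and f: "smooth_on U f"
  shows "laplacian y f q = (\<Sum>b\<in>UNIV. \<epsilon> b * (dd (dd f b) b q - (\<Sum>a\<in>UNIV. \<epsilon> a * G b b a q * dd f a q)))"
proof -
  let ?w = "\<lambda>b. dd (e b) b q"
  have chr: "(\<Sum>k\<in>UNIV. christoffel y q k i j * pd k f q) = (\<Sum>a\<in>UNIV. \<epsilon> a * ip52 (pd i (pd j y) q) (E a q) * dd f a q)" for i j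
  proof -
    have "(\<Sum>k\<in>UNIV. christoffel y q k i j * pd k f q)
      = (\<Sum>k\<in>UNIV. \<Sum>a\<in>UNIV. \<epsilon> a * ip52 (pd i (pd j y) q) (E a q) * (e a q $ k *\<^sub>R pd k f q))"
      by (simp add: christoffel_eq[OF q] sum_distrib_left sum_distrib_right mult_ac)
    also have "\<dots> = (\<Sum>a\<in>UNIV. \<epsilon> a * ip52 (pd i (pd j y) q) (E a q) * (\<Sum>k\<in>UNIV. e a q $ k *\<^sub>R pd k f q))"
      by (subst sum.swap) (simp add: sum_distrib_left)
    finally show ?thesis
      by (simp only: pd_frame[OF q f])
  qed
  define h where "h i j = pd i (pd j f) q - (\<Sum>a\<in>UNIV. \<epsilon> a * ip52 (pd i (pd j y) q) (E a q) * dd f a q)" for i j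
  have "laplacian y f q = (\<Sum>i\<in>UNIV. \<Sum>j\<in>UNIV. \<Sum>b\<in>UNIV. \<epsilon> b * ((e b q $ i * e b q $ j) * h i j))"
    by (simp add: laplacian_def chr h_def matrix_inv_gram[OF q] sum_distrib_right mult.assoc)
  also have "\<dots> = (\<Sum>b\<in>UNIV. \<epsilon> b * (\<Sum>i\<in>UNIV. \<Sum>j\<in>UNIV. (e b q $ i * e b q $ j) * h i j))"
  proof -
    have "(\<Sum>i\<in>UNIV. \<Sum>j\<in>UNIV. \<Sum>b\<in>UNIV. \<epsilon> b * ((e b q $ i * e b q $ j) * h i j))
      = (\<Sum>i\<in>UNIV. \<Sum>b\<in>UNIV. \<Sum>j\<in>UNIV. \<epsilon> b * ((e b q $ i * e b q $ j) * h i j))"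
      by (intro sum.cong refl sum.swap)
    also have "\<dots> = (\<Sum>b\<in>UNIV. \<Sum>i\<in>UNIV. \<Sum>j\<in>UNIV. \<epsilon> b * ((e b q $ i * e b q $ j) * h i j))"
      by (rule sum.swap)
    finally show ?thesis by (simp add: sum_distrib_left)
  qed
  finally have lap: "laplacian y f q =
    (\<Sum>b\<in>UNIV. \<epsilon> b * (\<Sum>i\<in>UNIV. \<Sum>j\<in>UNIV. (e b q $ i * e b q $ j) * h i j))" .
  have "(\<Sum>i\<in>UNIV. \<Sum>j\<in>UNIV. (e b q $ i * e b q $ j) * h i j)
      = dd (dd f b) b q - (\<Sum>a\<in>UNIV. \<epsilon> a * G b b a q * dd f a q)" for b
  proof -
    have fE: "(\<Sum>i\<in>UNIV. \<Sum>j\<in>UNIV. (e b q $ i * e b q $ j) * pd i (pd j f) q)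
      = dd (dd f b) b q - frechet_derivative f (at q) (?w b)"
      using second_derivative_frame[OF q f, of b] by simp
    have yE: "ip52 (\<Sum>i\<in>UNIV. \<Sum>j\<in>UNIV. (e b q $ i * e b q $ j) *\<^sub>R pd i (pd j y) q) (E a q)
      = G b b a q - ip52 (frechet_derivative y (at q) (?w b)) (E a q)" for a
      using second_derivative_frame[OF q y, of b] by (simp add: G_def E_def ip52_simps)
    have "(\<Sum>i\<in>UNIV. \<Sum>j\<in>UNIV. (e b q $ i * e b q $ j) *
          (\<Sum>a\<in>UNIV. \<epsilon> a * ip52 (pd i (pd j y) q) (E a q) * dd f a q))
      = (\<Sum>i\<in>UNIV. \<Sum>j\<in>UNIV. \<Sum>a\<in>UNIV. \<epsilon> a * dd f a q * ((e b q $ i * e b q $ j) * ip52 (pd i (pd j y) q) (E a q)))"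
      by (simp add: sum_distrib_left mult_ac)
    also have "\<dots> = (\<Sum>i\<in>UNIV. \<Sum>a\<in>UNIV. \<Sum>j\<in>UNIV. \<epsilon> a * dd f a q * ((e b q $ i * e b q $ j) * ip52 (pd i (pd j y) q) (E a q)))"
      by (intro sum.cong refl sum.swap)
    also have "\<dots> = (\<Sum>a\<in>UNIV. \<Sum>i\<in>UNIV. \<Sum>j\<in>UNIV. \<epsilon> a * dd f a q * ((e b q $ i * e b q $ j) * ip52 (pd i (pd j y) q) (E a q)))"
      by (rule sum.swap)
    also have "\<dots> = (\<Sum>a\<in>UNIV. \<epsilon> a * dd f a q *
        ip52 (\<Sum>i\<in>UNIV. \<Sum>j\<in>UNIV. (e b q $ i * e b q $ j) *\<^sub>R pd i (pd j y) q) (E a q))"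
      by (simp add: sum_distrib_left ip52_sum_left ip52_simps)
    also have "\<dots> = (\<Sum>a\<in>UNIV. \<epsilon> a * G b b a q * dd f a q) - frechet_derivative f (at q) (?w b)"
      unfolding yE derivative_expansion[OF q f, of "?w b"]
      by (simp add: algebra_simps sum_subtractf)
    finally show ?thesis
      by (simp add: h_def right_diff_distrib sum_subtractf fE)
  qed
  then show ?thesis by (simp only: lap)
qed

lemma vec_laplacian_eq:
  assumes q: "q \<in> U" and f: "smooth_on U f"
  shows "vec_laplacian y f q = (\<Sum>b\<in>UNIV. \<epsilon> b *\<^sub>R (dd (dd f b) b q - (\<Sum>a\<in>UNIV. (\<epsilon> a * G b b a q) *\<^sub>R dd f a q)))"
proof -
  have 1: "dd (\<lambda>r. g r $ m) a r = dd g a r $ m" if "r \<in> U" "smooth_on U g" for g :: "real^4 \<Rightarrow> real^5" and m a r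
    by (rule frechet_derivative_linear_image[OF bounded_linear_vec_nth smooth_on_differentiable[OF that(2) U that(1)]])
  have 2: "dd (dd (\<lambda>r. f r $ m) b) b q = dd (dd f b) b q $ m" for m b
  proof -
    have "dd (dd (\<lambda>r. f r $ m) b) b q = dd (\<lambda>r. dd f b r $ m) b q"
      by (rule dd_cong[OF q]) (rule 1[OF _ f])
    also have "\<dots> = dd (dd f b) b q $ m"
      by (rule 1[OF q smooth_dd[OF f]])
    finally show ?thesis .
  qed
  have "laplacian y (\<lambda>r. f r $ m) q = (\<Sum>b\<in>UNIV. \<epsilon> b *\<^sub>R (dd (dd f b) b q - (\<Sum>a\<in>UNIV. (\<epsilon> a * G b b a q) *\<^sub>R dd f a q))) $ m" for m
    by (simp add: laplacian_eq[OF q smooth_on_nth[OF U f]] 1[OF q f] 2)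
  then show ?thesis
    by (simp add: vec_laplacian_def vec_eq_iff)
qed

end

section \<open>Codazzi equation and the bilaplacian\<close>

locale principal_chart = frame_chart +
  fixes k :: "4 \<Rightarrow> real^4 \<Rightarrow> real"
  assumes shape: "\<And>q a. q \<in> U \<Longrightarrow>
    frechet_derivative n (at q) (e a q) = - (k a q *\<^sub>R frechet_derivative y (at q) (e a q))"
begin

lemma weingarten: "q \<in> U \<Longrightarrow> dd n a q = - (k a q *\<^sub>R E a q)"
  by (simp add: shape E_def)

text \<open>The frame data provide smoothness of \<open>n\<close> and \<open>e\<close>; pairing the
  Weingarten equation with \<open>E a\<close> transfers it to the principal curvatures.\<close>

lemma smooth_k: "smooth_on U (k a)"
proof (rule smooth_on_cong[OF U])
  show "smooth_on U (\<lambda>q. - \<epsilon> a * ip52 (dd n a q) (E a q))"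
    by (intro smooth_intros U smooth_dd n smooth_E)
  show "- \<epsilon> a * ip52 (dd n a q) (E a q) = k a q" if "q \<in> U" for q
    using eps[of a] by (simp add: weingarten[OF that] ip52_simps ipE[OF that])
qed

lemma second_fundamental_form:
  assumes q: "q \<in> U"
  shows "ip52 (dd (E b) a q) (n q) = (if a = b then \<epsilon> a * k a q else 0)"
proof -
  have "dd (\<lambda>r. ip52 (E b r) (n r)) a q = dd (\<lambda>r. 0) a q"
    by (rule dd_cong[OF q]) (rule ipEn)
  then show ?thesis
    by (simp add: frechet_derivative_ip52[OF U q smooth_E n] weingarten[OF q] ip52_simps ipE[OF q]
        split: if_splits)
qed

lemma gauss_formula:
  assumes q: "q \<in> U"
  shows "dd (E b) a q = (\<Sum>c\<in>UNIV. (\<epsilon> c * G a b c q) *\<^sub>R E c q) + (if a = b then \<epsilon> a * k a q else 0) *\<^sub>R n q"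
  using ambient_expansion[OF q, of "dd (E b) a q"] by (simp only: G_def second_fundamental_form[OF q])

lemma dd_uminus_scaleR_E:
  assumes q: "q \<in> U" and f: "smooth_on U f"
  shows "dd (\<lambda>r. - (f r *\<^sub>R E b r)) a q = - (f q *\<^sub>R dd (E b) a q) - dd f a q *\<^sub>R E b q"
proof -
  have s: "smooth_on U (\<lambda>r. f r *\<^sub>R E b r)"
    by (intro smooth_intros U f smooth_E)
  have "dd (\<lambda>r. - (f r *\<^sub>R E b r)) a q = - dd (\<lambda>r. f r *\<^sub>R E b r) a q"
    by (rule frechet_derivative_linear_image[OF bounded_linear_minus[OF bounded_linear_ident]
          smooth_on_differentiable[OF s U q]])
  then show ?thesis
    by (simp add: frechet_derivative_scaleR[OF U q f smooth_E])
qed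

text \<open>Computing the two second derivatives of \<open>n\<close> along \<open>E a\<close> and
  \<open>E b\<close> from the Weingarten equation and comparing their difference with
  \<open>bracket_formula\<close> gives the equation; here it is its component along
  \<open>E c\<close>.\<close>

lemma codazzi:
  assumes q: "q \<in> U"
  shows "- (if b = c then dd (k b) a q * \<epsilon> b else 0) + (if a = c then dd (k a) b q * \<epsilon> a else 0)
    + (k c q - k b q) * G a b c q + (k a q - k c q) * G b a c q = 0"
proof -
  have *: "dd (dd n b) a q = - (k b q *\<^sub>R dd (E b) a q) - dd (k b) a q *\<^sub>R E b q" for a b
  proof -
    have "dd (dd n b) a q = dd (\<lambda>r. - (k b r *\<^sub>R E b r)) a q"
      by (rule dd_cong[OF q]) (rule weingarten)
    then show ?thesis by (simp only: dd_uminus_scaleR_E[OF q smooth_k])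
  qed
  have "ip52 (dd (dd n b) a q - dd (dd n a) b q) (E c q)
      = ip52 (\<Sum>c\<in>UNIV. (\<epsilon> c * (G a b c q - G b a c q)) *\<^sub>R dd n c q) (E c q)"
    by (simp only: bracket_formula[OF q n])
  also have "\<dots> = - (\<epsilon> c * \<epsilon> c * (G a b c q - G b a c q) * k c q)"
    by (simp add: ip52_sum_left ip52_simps weingarten[OF q] ipE[OF q] if_distrib sum.delta cong: if_cong)
  finally have "ip52 (dd (dd n b) a q - dd (dd n a) b q) (E c q) = - ((G a b c q - G b a c q) * k c q)"
    by (simp add: eps)
  then show ?thesis
    unfolding * by (auto simp add: ip52_simps G_def[symmetric] ipE[OF q] algebra_simps split: if_splits)
qed

text \<open>The trace is defined in the coordinate basis. After expanding the shape operator in the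
  frame, the sum over coordinates is carried out first and leaves the eigenvalues.\<close>

lemma mean_curv_eq:
  assumes q: "q \<in> U"
  shows "mean_curv y n q = (\<Sum>c\<in>UNIV. k c q) / 4"
proof -
  let ?D = "frechet_derivative y (at q)"
  have l: "linear ?D" by (rule lin[OF q y])
  have S: "shape_op y n q v = (\<Sum>c\<in>UNIV. (k c q * \<epsilon> c * ip52 (?D v) (E c q)) *\<^sub>R e c q)" for v
  proof (rule injD[OF inj_y[OF q]])
    have "?D (shape_op y n q v) = - (\<Sum>c\<in>UNIV. (\<epsilon> c * ip52 (?D v) (E c q)) *\<^sub>R dd n c q)"
      using shape_op_eq[OF q] derivative_expansion[OF q n] by metis
    also have "\<dots> = ?D (\<Sum>c\<in>UNIV. (k c q * \<epsilon> c * ip52 (?D v) (E c q)) *\<^sub>R e c q)"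
      by (simp add: linear_sum[OF l] linear_cmul[OF l] weingarten[OF q] sum_negf E_def mult_ac)
    finally show "?D (shape_op y n q v) = ?D (\<Sum>c\<in>UNIV. (k c q * \<epsilon> c * ip52 (?D v) (E c q)) *\<^sub>R e c q)" .
  qed
  have "trace (matrix (shape_op y n q)) = (\<Sum>i\<in>UNIV. \<Sum>c\<in>UNIV. k c q * \<epsilon> c * ip52 (e c q $ i *\<^sub>R pd i y q) (E c q))"
    by (simp add: trace_def matrix_def S pd_def ip52_simps mult_ac)
  also have "\<dots> = (\<Sum>c\<in>UNIV. k c q * \<epsilon> c * ip52 (\<Sum>i\<in>UNIV. e c q $ i *\<^sub>R pd i y q) (E c q))"
    by (subst sum.swap) (simp add: sum_distrib_left ip52_sum_left)
  also have "\<dots> = (\<Sum>c\<in>UNIV. k c q * (\<epsilon> c * \<epsilon> c))"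
    unfolding pd_frame[OF q y] using ipE[OF q] by (simp add: E_def mult.assoc)
  finally show ?thesis by (simp add: mean_curv_def eps)
qed

abbreviation trS :: "real^4 \<Rightarrow> real" where "trS \<equiv> \<lambda>q. \<Sum>c\<in>UNIV. k c q"

lemma smooth_trS: "smooth_on U trS"
  by (intro smooth_intros U smooth_k)

lemma smooth_mean_curv: "smooth_on U (mean_curv y n)"
proof (rule smooth_on_cong[OF U])
  show "smooth_on U (\<lambda>q. trS q / 4)"
    by (intro smooth_intros U smooth_k) auto
qed (simp add: mean_curv_eq)

lemma dd_mean_curv: "q \<in> U \<Longrightarrow> dd (mean_curv y n) a q = dd trS a q / 4"
proof -
  assume q: "q \<in> U"
  have "dd (mean_curv y n) a q = dd (\<lambda>r. trS r / 4) a q"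
    by (rule dd_cong[OF q]) (rule mean_curv_eq)
  also have "\<dots> = dd trS a q / 4"
    by (rule frechet_derivative_linear_image[OF bounded_linear_divide smooth_on_differentiable[OF smooth_trS U q]])
  finally show ?thesis .
qed

lemma dd_sum_k: "q \<in> U \<Longrightarrow> dd trS a q = (\<Sum>c\<in>UNIV. dd (k c) a q)"
proof -
  assume q: "q \<in> U"
  have "(trS has_derivative (\<lambda>v. \<Sum>c\<in>UNIV. frechet_derivative (k c) (at q) v)) (at q)"
    by (intro has_derivative_sum smooth_on_has_derivative[OF smooth_k U q])
  from frechet_derivative_at[OF this, symmetric] show ?thesis by simp
qed

text \<open>Beltrami's formula, with \<open>trS\<close> equal to 4H: the tangential part of each
  second derivative of \<open>y\<close> is exactly what the Laplacian subtracts.\<close>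

lemma vec_laplacian_position:
  assumes q: "q \<in> U"
  shows "vec_laplacian y y q = trS q *\<^sub>R n q"
proof -
  have "vec_laplacian y y q = (\<Sum>b\<in>UNIV. \<epsilon> b *\<^sub>R (dd (E b) b q - (\<Sum>a\<in>UNIV. (\<epsilon> a * G b b a q) *\<^sub>R E a q)))"
    by (simp add: vec_laplacian_eq[OF q y] E_def)
  also have "\<dots> = (\<Sum>b\<in>UNIV. \<epsilon> b *\<^sub>R ((\<epsilon> b * k b q) *\<^sub>R n q))"
    unfolding gauss_formula[OF q] by simp
  also have "\<dots> = trS q *\<^sub>R n q"
    by (simp add: mult.assoc[symmetric] eps scaleR_sum_left)
  finally show ?thesis .
qed

text \<open>This is the Laplacian of \<open>trS\<close> times \<open>n\<close>. The cross term
  contributes -2 S(grad trS). The Laplacian of \<open>n\<close> has tangential part -div S, which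
  the contracted Codazzi equation turns into -grad trS.\<close>

lemma bilaplacian_tangential:
  assumes q: "q \<in> U"
  shows "ip52 (vec_laplacian y (vec_laplacian y y) q) (E c q) = - (2 * k c q + trS q) * dd trS c q"
proof -
  define s where "s = trS"
  have s: "smooth_on U s" unfolding s_def by (rule smooth_trS)
  define F where "F = vec_laplacian y y"
  have Fs: "F r = s r *\<^sub>R n r" if "r \<in> U" for r
    unfolding F_def s_def by (rule vec_laplacian_position[OF that])
  have smF: "smooth_on U F"
    by (rule smooth_on_cong[OF U, of "\<lambda>r. s r *\<^sub>R n r"]) (auto simp: Fs intro!: smooth_intros U s n)
  have d1: "dd F b r = dd s b r *\<^sub>R n r - (s r * k b r) *\<^sub>R E b r" if r: "r \<in> U" for b r
  proof -
    have "dd F b r = dd (\<lambda>r. s r *\<^sub>R n r) b r"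
      by (rule dd_cong[OF r]) (rule Fs)
    then show ?thesis
      by (simp add: frechet_derivative_scaleR[OF U r s n] weingarten[OF r])
  qed
  have sk: "smooth_on U (\<lambda>r. s r * k b r)" for b
    by (intro smooth_intros U s smooth_k)
  have d2: "dd (dd F b) b q = dd (dd s b) b q *\<^sub>R n q - (dd s b q * k b q) *\<^sub>R E b q
      - (dd s b q * k b q + s q * dd (k b) b q) *\<^sub>R E b q - (s q * k b q) *\<^sub>R dd (E b) b q" for b
  proof -
    have "dd (dd F b) b q = dd (\<lambda>r. dd s b r *\<^sub>R n r - (s r * k b r) *\<^sub>R E b r) b q"
      by (rule dd_cong[OF q]) (rule d1)
    also have "\<dots> = dd (\<lambda>r. dd s b r *\<^sub>R n r) b q - dd (\<lambda>r. (s r * k b r) *\<^sub>R E b r) b q"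
      by (rule frechet_derivative_rules(2)[OF U q]) (intro smooth_intros U s n smooth_k smooth_dd smooth_E e)+
    finally show ?thesis
      by (simp add: frechet_derivative_scaleR[OF U q smooth_dd[OF s] n] frechet_derivative_scaleR[OF U q sk smooth_E]
          frechet_derivative_mult[OF U q s smooth_k] weingarten[OF q] algebra_simps)
  qed
  have "ip52 (vec_laplacian y F q) (E c q) =
    (\<Sum>b\<in>UNIV. \<epsilon> b * (ip52 (dd (dd F b) b q) (E c q) - (\<Sum>a\<in>UNIV. \<epsilon> a * G b b a q * ip52 (dd F a q) (E c q))))"
    by (simp add: vec_laplacian_eq[OF q smF] ip52_sum_left ip52_simps)
  also have "\<dots> = (\<Sum>b\<in>UNIV. \<epsilon> b * ((if b = c then - \<epsilon> b * (2 * dd s b q * k b q + s q * dd (k b) b q) else 0)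
      + s q * (k c q - k b q) * G b b c q))"
  proof (intro sum.cong refl arg_cong[where f = "\<lambda>x. \<epsilon> _ * x"])
    fix b
    have "(\<Sum>a\<in>UNIV. \<epsilon> a * G b b a q * ip52 (dd F a q) (E c q)) = - (\<epsilon> c * \<epsilon> c * G b b c q * (s q * k c q))"
      by (simp add: d1[OF q] ip52_simps ipE[OF q] ipnE[OF q] if_distrib sum.delta cong: if_cong)
    moreover have "ip52 (dd (dd F b) b q) (E c q)
      = (if b = c then - \<epsilon> b * (2 * dd s b q * k b q + s q * dd (k b) b q) else 0) - s q * k b q * G b b c q"
      unfolding d2 ip52_simps ipE[OF q] ipnE[OF q] G_def[symmetric] by (simp add: algebra_simps)
    ultimately show "ip52 (dd (dd F b) b q) (E c q) - (\<Sum>a\<in>UNIV. \<epsilon> a * G b b a q * ip52 (dd F a q) (E c q))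
      = (if b = c then - \<epsilon> b * (2 * dd s b q * k b q + s q * dd (k b) b q) else 0) + s q * (k c q - k b q) * G b b c q"
      by (simp add: eps algebra_simps)
  qed
  also have "\<dots> = (\<Sum>b\<in>UNIV. (if b = c then - (2 * dd s c q * k c q) else 0) - s q * dd (k b) c q)"
  proof (intro sum.cong refl)
    fix b
    show "\<epsilon> b * ((if b = c then - \<epsilon> b * (2 * dd s b q * k b q + s q * dd (k b) b q) else 0)
      + s q * (k c q - k b q) * G b b c q) = (if b = c then - (2 * dd s c q * k c q) else 0) - s q * dd (k b) c q"
    proof (cases "b = c")
      case True
      have ee: "\<epsilon> c * (\<epsilon> c * x) = x" for x
        by (simp add: mult.assoc[symmetric] eps)
      show ?thesis by (simp add: True ee)
    next
      case False
      \<comment> \<open>For \<open>b\<close> different from \<open>c\<close>, Codazzi trades the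
        connection coefficient for the derivative of \<open>k b\<close> along \<open>E c\<close>;
        summed over \<open>b\<close>, these derivatives form that of the trace.\<close>
      have "dd (k b) c q * \<epsilon> b + (k b q - k c q) * G b c b q = 0"
        using codazzi[OF q, of c b b] G_antisym[OF q, of c b b] False by simp
      then have "(k c q - k b q) * G b b c q = - (\<epsilon> b * dd (k b) c q)"
        unfolding G_antisym[OF q, of b c b] by (simp add: algebra_simps)
      then have "\<epsilon> b * ((k c q - k b q) * G b b c q) = - (\<epsilon> b * \<epsilon> b * dd (k b) c q)"
        by (simp only: mult_minus_right mult.assoc)
      then have "s q * (\<epsilon> b * ((k c q - k b q) * G b b c q)) = s q * - dd (k b) c q"
        by (simp only: eps mult_1_left)
      then show ?thesis using False by (simp add: mult.assoc mult.left_commute[of "\<epsilon> b" "s q"])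
    qed
  qed
  also have "\<dots> = - (2 * k c q + s q) * dd s c q"
    by (simp add: sum_subtractf sum_distrib_left[symmetric] dd_sum_k[OF q, symmetric] s_def algebra_simps)
  finally show ?thesis by (simp add: F_def s_def)
qed

end

section \<open>Structure equations of a biconservative chart\<close>

context principal_chart
begin

text \<open>Pairing the gradient with \<open>E a\<close> isolates the derivative of \<open>H\<close>
  along \<open>e a\<close>; as the gradient is a multiple of \<open>e 1\<close>, only the first one
  survives, and it is nonzero because \<open>E 1\<close> is a unit vector.\<close>

lemma gradient_direction:
  assumes q: "q \<in> U" and c: "e 1 q = c *\<^sub>R grad_H y n q" "c \<noteq> 0"
  shows "dd trS 1 q \<noteq> 0" and "a \<noteq> 1 \<Longrightarrow> dd trS a q = 0"
proof -
  let ?D = "frechet_derivative y (at q)"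
  have l: "linear ?D" by (rule lin[OF q y])
  have "ip52 (?D (grad_H y n q)) (E a q) = (\<epsilon> a * \<epsilon> a) * dd (mean_curv y n) a q" for a
    unfolding grad_eq[OF q smooth_mean_curv]
    by (simp add: linear_sum[OF l] linear_cmul[OF l] ip52_sum_left ip52_simps E_def orth[OF q] mult_ac
        if_distrib if_distribR sum.delta cong: if_cong)
  then have "ip52 (E 1 q) (E a q) = c * dd (mean_curv y n) a q" for a
    using c(1) by (simp add: E_def linear_cmul[OF l] ip52_simps eps)
  then have "4 * ip52 (E 1 q) (E a q) = c * dd trS a q" for a
    by (simp add: dd_mean_curv[OF q] mult.commute)
  then have *: "4 * (if 1 = a then \<epsilon> 1 else 0) = c * dd trS a q" for a
    by (simp only: ipE[OF q])
  from *[of 1] show "dd trS 1 q \<noteq> 0"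
    using eps_nz[of 1] by auto
  from *[of a] show "dd trS a q = 0" if "a \<noteq> 1"
    using that c(2) by simp
qed

lemma biconservative_principal_curvature:
  assumes q: "q \<in> U" and bc: "biconservative_on U y n" and nz: "dd trS c q \<noteq> 0"
  shows "2 * k c q = - trS q"
proof -
  let ?X = "vec_laplacian y (vec_laplacian y y) q"
  have "ip52 (tangential_part n q ?X) (E c q) = 0"
    using bc q by (simp add: biconservative_on_def ip52_simps)
  then have "ip52 ?X (E c q) = 0"
    by (simp add: tangential_part_def ip52_simps ipnE[OF q])
  then show ?thesis
    using bilaplacian_tangential[OF q, of c] nz by simp
qed

text \<open>Used to arrange \<open>k 2 > 0\<close> and \<open>\<mu> > 0\<close>.\<close>

lemma principal_chart_flip:
  assumes "\<sigma> * \<sigma> = 1" "\<tau> * \<tau> = 1"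
  shows "principal_chart U y (\<lambda>q. \<tau> *\<^sub>R n q) (\<lambda>i q. (if i = 1 then \<sigma> else 1) *\<^sub>R e i q) \<epsilon> (\<lambda>i q. \<tau> * k i q)"
proof
  fix q i j v assume q: "q \<in> U"
  let ?e = "\<lambda>i q. (if i = 1 then \<sigma> else 1) *\<^sub>R e i q"
  have De: "frechet_derivative f (at q) (?e i q) = (if i = 1 then \<sigma> else 1) *\<^sub>R dd f i q"
    if "smooth_on U f" for f :: "real^4 \<Rightarrow> real^5" and i
    by (rule linear_cmul[OF lin[OF q that]])
  show "ip52 (\<tau> *\<^sub>R n q) (\<tau> *\<^sub>R n q) = 1"
    using assms nn[OF q] by (simp add: ip52_simps)
  show "ip52 (\<tau> *\<^sub>R n q) (frechet_derivative y (at q) v) = 0"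
    by (simp add: ip52_simps nt[OF q])
  show "ip52 (frechet_derivative y (at q) (?e i q)) (frechet_derivative y (at q) (?e j q)) = (if i = j then \<epsilon> i else 0)"
    using assms orth[OF q, of i j] by (simp add: De[OF y] ip52_simps)
  show "frechet_derivative (\<lambda>q. \<tau> *\<^sub>R n q) (at q) (?e i q) = - ((\<tau> * k i q) *\<^sub>R frechet_derivative y (at q) (?e i q))"
    unfolding frechet_derivative_scaleR_const[OF U q n] De[OF y] De[OF n] weingarten[OF q]
    by (simp add: E_def)
qed (auto intro!: smooth_intros U y n e simp: inj_y eps)

end

text \<open>The normalized situation. The factor -2/3 results from 2 \<open>k 1\<close> =
  -\<open>trS\<close> with trace \<open>k 1\<close> + 2 \<open>k 2\<close>. Convexity lets vanishing
  derivatives give constants, and the sign conditions on \<open>k 2\<close> and its derivative are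
  arranged by reversing \<open>n\<close> and \<open>e 1\<close>.\<close>

locale biconservative_chart = principal_chart +
  assumes convex: "convex U"
    and k1: "\<And>q. q \<in> U \<Longrightarrow> k 1 q = - (2/3) * k 2 q"
    and k2: "\<And>q. q \<in> U \<Longrightarrow> k 2 q > 0"
    and k3: "\<And>q. q \<in> U \<Longrightarrow> k 3 q = k 2 q"
    and k4: "\<And>q. q \<in> U \<Longrightarrow> k 4 q = 0"
    and dk1: "\<And>q. q \<in> U \<Longrightarrow> frechet_derivative (k 2) (at q) (e 1 q) < 0"
    and dk: "\<And>q a. q \<in> U \<Longrightarrow> a \<noteq> 1 \<Longrightarrow> frechet_derivative (k 2) (at q) (e a q) = 0"
begin

text \<open>For a = 2, 3 this is the factor that Codazzi forces on the derivative of
  \<open>E 1\<close> along \<open>E a\<close>; 5/3 is the ratio of \<open>k 2 - k 1\<close> to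
  \<open>k 2\<close>.\<close>

definition \<mu> :: "real^4 \<Rightarrow> real" where "\<mu> q = - (3/5) * dd (k 2) 1 q / k 2 q"

lemma mu_pos: "q \<in> U \<Longrightarrow> \<mu> q > 0"
  using k2 dk1 by (simp add: \<mu>_def divide_simps)

lemma smooth_mu: "smooth_on U \<mu>"
  unfolding \<mu>_def using k2 by (intro smooth_intros smooth_k smooth_dd U e) force+

lemma dd_k2: "q \<in> U \<Longrightarrow> dd (k 2) 1 q = - (5/3) * \<mu> q * k 2 q"
  using k2[of q] by (simp add: \<mu>_def)

lemma dd_k1: "q \<in> U \<Longrightarrow> dd (k 1) a q = - (2/3) * dd (k 2) a q"
proof -
  assume q: "q \<in> U"
  have "dd (k 1) a q = dd (\<lambda>r. - (2/3) * k 2 r) a q"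
    by (rule dd_cong[OF q]) (rule k1)
  then show ?thesis
    using frechet_derivative_linear_image[OF bounded_linear_mult_right smooth_on_differentiable[OF smooth_k U q],
        of "-(2/3)" 2 "e a q"] by simp
qed

lemma dd_k3: "q \<in> U \<Longrightarrow> dd (k 3) a q = dd (k 2) a q"
  by (rule dd_cong) (auto simp: k3)

lemma dd_k4: "q \<in> U \<Longrightarrow> dd (k 4) a q = 0"
  using dd_cong[of q "k 4" "\<lambda>r. 0" a] by (simp add: k4)

lemma constant_on_chart:
  assumes f: "smooth_on U f" and z: "\<And>a q. q \<in> U \<Longrightarrow> dd f a q = 0" and "p \<in> U" "q \<in> U"
  shows "f p = f q"
proof (rule has_derivative_zero_unique[OF convex _ assms(3,4)])
  fix x assume x: "x \<in> U"
  have "frechet_derivative f (at x) = (\<lambda>h. 0)"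
    using derivative_expansion[OF x f] z[OF x] by auto
  then show "(f has_derivative (\<lambda>h. 0)) (at x within U)"
    using smooth_on_has_derivative[OF f U x] has_derivative_at_withinI by metis
qed

text \<open>The fields \<open>e 2\<close>, \<open>e 3\<close>, \<open>e 4\<close> annihilate
  \<open>k 2\<close>, hence so do their brackets; as \<open>k 2\<close> has nonzero derivative along
  \<open>e 1\<close>, such a bracket has no component there.\<close>

lemma bracket_torsion:
  assumes q: "q \<in> U" and "a \<noteq> 1" "b \<noteq> 1"
  shows "G a b 1 q = G b a 1 q"
proof -
  have z: "dd (dd (k 2) b) a q = 0" if "b \<noteq> 1" for a b
  proof -
    have "dd (dd (k 2) b) a q = dd (\<lambda>r. 0) a q"
      by (rule dd_cong[OF q]) (rule dk[OF _ that])
    then show ?thesis by simp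
  qed
  have "(\<Sum>c\<in>UNIV. (\<epsilon> c * (G a b c q - G b a c q)) *\<^sub>R dd (k 2) c q) = 0"
    using bracket_formula[OF q smooth_k, of 2 b a] z[OF assms(3)] z[OF assms(2)] by simp
  then show ?thesis
    using dk[OF q] dk1[OF q] eps_nz[of 1] by (simp add: sum_4)
qed

text \<open>In geometric terms, \<open>E 4\<close> is parallel, \<open>E 1\<close> is geodesic, and
  the directions \<open>E 2\<close>, \<open>E 3\<close> are umbilic with respect to
  \<open>E 1\<close>. The coefficients \<open>G a 2 3\<close> stay undetermined, since equality of
  \<open>k 2\<close> and \<open>k 3\<close> lets the frame turn in that plane; the position formulas
  avoid them.\<close>

lemma connection:
  assumes q: "q \<in> U"
  shows "G a b 4 q = 0" and "G 1 1 b q = 0" and "G 4 1 b q = 0"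
    and "a = 2 \<or> a = 3 \<Longrightarrow> G a 1 b q = (if a = b then \<mu> q * \<epsilon> a else 0)"
proof -
  have k0: "k 2 q \<noteq> 0" "k 3 q = k 2 q" "k 1 q = - (2/3) * k 2 q" "k 4 q = 0"
    using k1[OF q] k2[OF q] k3[OF q] k4[OF q] by auto
  have dk0: "dd (k 4) a q = 0" "dd (k 3) a q = dd (k 2) a q" "dd (k 1) a q = -(2/3) * dd (k 2) a q"
    "a \<noteq> 1 \<Longrightarrow> dd (k 2) a q = 0" for a
    using dd_k1[OF q] dd_k3[OF q] dd_k4[OF q] dk[OF q] by auto
  note anti = G_antisym[OF q]
  have diag: "G a b b q = 0" for a b
    using anti[of a b b] by simp
  \<comment> \<open>The arguments given to \<open>codazzi\<close> stand for its variables
    \<open>b\<close>, \<open>c\<close>, \<open>a\<close>, in this order.\<close>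
  have a44: "G 4 a 4 q = 0" for a
    using codazzi[OF q, of 4 4 a] k0 dk0 diag[of 4 4] diag[of a 4] exhaust_4[of a] by auto
  have t: "G a b 4 q = 0" if "a = 2 \<or> a = 3" "b = 2 \<or> b = 3" for a b
    using codazzi[OF q, of 4 b a] anti[of a b 4] that k0 dk0 by auto
  have l14: "G 1 1 4 q = 0"
    using codazzi[OF q, of 4 1 1] anti[of 1 1 4] diag[of 4 1] k0 dk0 by auto
  \<comment> \<open>Codazzi relates three unknowns by two equations. \<open>bracket_torsion\<close>
    identifies two of the unknowns, after which the first equation reads
    \<open>k 2 * G a 4 1 q = 0\<close>.\<close>
  have m: "G a 1 4 q = 0 \<and> G 1 a 4 q = 0 \<and> G 4 1 a q = 0" if "a = 2 \<or> a = 3" for a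
  proof -
    have "(k 1 q) * G a 4 1 q + (k 2 q - k 1 q) * G 4 a 1 q = 0"
      using codazzi[OF q, of 4 1 a] that k0 dk0 by auto
    moreover have "G a 4 1 q = G 4 a 1 q"
      using bracket_torsion[OF q, of a 4] that by auto
    ultimately have 1: "G a 4 1 q = 0"
      using k0(1) by (simp add: algebra_simps)
    have "- k 2 q * G 1 a 4 q + k 1 q * G a 1 4 q = 0"
      using codazzi[OF q, of a 4 1] that k0 dk0 by auto
    then show ?thesis
      using 1 k0(1) anti[of a 1 4] anti[of 4 1 a] bracket_torsion[OF q, of a 4] that by auto
  qed
  have "\<forall>a b. G a b 4 q = 0"
    unfolding forall_4 using a44 t l14 m diag by blast
  then show g4: "G a b 4 q = 0" for a b by blast
  have l1: "G 1 1 a q = 0" if "a = 2 \<or> a = 3" for a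
    using codazzi[OF q, of a 1 1] anti[of 1 1 a] diag[of a 1] that k0 dk0 by auto
  have "\<forall>b. G 1 1 b q = 0"
    unfolding forall_4 using l1 l14 diag by blast
  then show "G 1 1 b q = 0" by blast
  have "\<forall>b. G 4 1 b q = 0"
    unfolding forall_4 using m g4 diag by blast
  then show "G 4 1 b q = 0" by blast
  have um: "G a 1 b q = (if a = b then \<mu> q * \<epsilon> a else 0)" if "a = 2 \<or> a = 3" "b = 2 \<or> b = 3" for a b
  proof -
    have "- (if a = b then dd (k 2) 1 q * \<epsilon> a else 0) + (k 1 q - k 2 q) * G a 1 b q = 0"
      using codazzi[OF q, of a b 1] that k0 dk0 by (auto split: if_splits)
    then have "k 2 q * G a 1 b q = k 2 q * (if a = b then \<mu> q * \<epsilon> a else 0)"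
      using k0 dd_k2[OF q] by (auto simp: mult.commute split: if_splits)
    then show ?thesis using k0(1) mult_left_cancel by blast
  qed
  show "G a 1 b q = (if a = b then \<mu> q * \<epsilon> a else 0)" if "a = 2 \<or> a = 3"
    using exhaust_4[of b] that um[OF that] g4 diag by auto
qed

lemma dd_E:
  assumes q: "q \<in> U"
  shows "dd (E 4) a q = 0" and "dd (E 1) 1 q = (- (2/3) * \<epsilon> 1 * k 2 q) *\<^sub>R n q" and "dd (E 1) 4 q = 0"
    and "a = 2 \<or> a = 3 \<Longrightarrow> dd (E 1) a q = \<mu> q *\<^sub>R E a q"
proof -
  have "G a 4 c q = 0" for a c
    using connection(1)[OF q, of a c] G_antisym[OF q, of a c 4] by simp
  then show "dd (E 4) a q = 0"
    using gauss_formula[OF q, of 4 a] k4[OF q] by simp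
  show "dd (E 1) 1 q = (- (2/3) * \<epsilon> 1 * k 2 q) *\<^sub>R n q"
    using gauss_formula[OF q, of 1 1] connection(2)[OF q] k1[OF q] by (simp add: mult.commute)
  show "dd (E 1) 4 q = 0"
    using gauss_formula[OF q, of 1 4] connection(3)[OF q] by simp
  assume a: "a = 2 \<or> a = 3"
  then have "dd (E 1) a q = (\<Sum>c\<in>UNIV. (\<epsilon> c * (if a = c then \<mu> q * \<epsilon> a else 0)) *\<^sub>R E c q)"
    using gauss_formula[OF q, of 1 a] connection(4)[OF q a] by auto
  also have "\<dots> = (\<mu> q * (\<epsilon> a * \<epsilon> a)) *\<^sub>R E a q"
    by (simp add: if_distrib if_distribR sum.delta mult_ac cong: if_cong)
  finally show "dd (E 1) a q = \<mu> q *\<^sub>R E a q"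
    by (simp add: eps)
qed

lemma dd_n:
  assumes q: "q \<in> U"
  shows "dd n 1 q = ((2/3) * k 2 q) *\<^sub>R E 1 q" and "dd n 2 q = - k 2 q *\<^sub>R E 2 q"
    and "dd n 3 q = - k 2 q *\<^sub>R E 3 q" and "dd n 4 q = 0"
  by (simp_all add: weingarten[OF q] k1[OF q] k3[OF q] k4[OF q])

text \<open>The first part compares both orders of differentiating \<open>k 2\<close> along
  \<open>e 1\<close> and \<open>e a\<close>; their bracket has no \<open>e 1\<close> component
  because \<open>E 1\<close> is geodesic. The second is the Gauss equation for the plane of
  \<open>E 1\<close> and \<open>E 2\<close>.\<close>

lemma dd_mu:
  assumes q: "q \<in> U"
  shows "a \<noteq> 1 \<Longrightarrow> dd \<mu> a q = 0" and "dd \<mu> 1 q = - ((\<mu> q)^2) + (2/3) * \<epsilon> 1 * (k 2 q)^2"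
proof -
  show "dd \<mu> a q = 0" if a: "a \<noteq> 1"
  proof -
    have "dd (dd (k 2) a) 1 q = dd (\<lambda>r. 0) 1 q"
      by (rule dd_cong[OF q]) (rule dk[OF _ a])
    moreover have "G a 1 1 q = 0" "G 1 a 1 q = 0"
      using G_antisym[OF q, of a 1 1] G_antisym[OF q, of 1 a 1] connection(2)[OF q, of a] by auto
    ultimately have z: "dd (dd (k 2) 1) a q = 0"
      using bracket_formula[OF q smooth_k, of 2 a 1] dk[OF q] by (simp add: sum_4)
    have "dd (dd (k 2) 1) a q = dd (\<lambda>r. - (5/3) * (\<mu> r * k 2 r)) a q"
      by (rule dd_cong[OF q]) (simp add: dd_k2)
    also have "\<dots> = - (5/3) * (\<mu> q * dd (k 2) a q + dd \<mu> a q * k 2 q)"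
      using frechet_derivative_linear_image[OF bounded_linear_mult_right
          smooth_on_differentiable[OF smooth_on_mult[OF U smooth_mu smooth_k] U q], of "- (5/3)" 2 "e a q"]
        frechet_derivative_mult[OF U q smooth_mu smooth_k, of 2 "e a q"] by simp
    finally show ?thesis
      using z dk[OF q a] k2[OF q] by simp
  qed
  \<comment> \<open>The Gauss equation is read off as the \<open>E 2\<close> component of
    \<open>bracket_formula\<close> applied to the vector field \<open>E 1\<close>.\<close>
  have "dd (dd (E 1) 2) 1 q = dd (\<lambda>r. \<mu> r *\<^sub>R E 2 r) 1 q"
    by (rule dd_cong[OF q]) (simp add: dd_E(4))
  also have "\<dots> = \<mu> q *\<^sub>R dd (E 2) 1 q + dd \<mu> 1 q *\<^sub>R E 2 q"
    by (rule frechet_derivative_scaleR[OF U q smooth_mu smooth_E])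
  finally have "ip52 (dd (dd (E 1) 2) 1 q) (E 2 q) = dd \<mu> 1 q * \<epsilon> 2"
    using G_antisym[OF q, of 1 2 2] by (simp add: ip52_simps ipE[OF q] G_def[symmetric])
  moreover have "dd (dd (E 1) 1) 2 q = dd (\<lambda>r. (- (2/3) * \<epsilon> 1 * k 2 r) *\<^sub>R n r) 2 q"
    by (rule dd_cong[OF q]) (rule dd_E(2))
  then have "dd (dd (E 1) 1) 2 q = (- (2/3) * \<epsilon> 1 * k 2 q) *\<^sub>R dd n 2 q
    + frechet_derivative (\<lambda>r. - (2/3) * \<epsilon> 1 * k 2 r) (at q) (e 2 q) *\<^sub>R n q"
    by (simp only: frechet_derivative_scaleR[OF U q smooth_on_linear[OF bounded_linear_mult_right U smooth_k] n])
  then have "ip52 (dd (dd (E 1) 1) 2 q) (E 2 q) = (2/3) * \<epsilon> 1 * (k 2 q)^2 * \<epsilon> 2"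
    by (simp add: ip52_simps ipE[OF q] ipnE[OF q] dd_n[OF q] power2_eq_square)
  moreover have "ip52 (\<Sum>c\<in>UNIV. (\<epsilon> c * (G 1 2 c q - G 2 1 c q)) *\<^sub>R dd (E 1) c q) (E 2 q) = - ((\<mu> q)^2) * (\<epsilon> 2 * \<epsilon> 2) * \<epsilon> 2"
    using dd_E[OF q] connection(4)[OF q, of 2] G_antisym[OF q, of 1 2 2]
    by (simp add: sum_4 ip52_simps ipE[OF q] ipnE[OF q] power2_eq_square)
  ultimately have "dd \<mu> 1 q * \<epsilon> 2 - (2/3) * \<epsilon> 1 * (k 2 q)^2 * \<epsilon> 2 = - ((\<mu> q)^2) * (\<epsilon> 2 * \<epsilon> 2) * \<epsilon> 2"
    by (simp only: bracket_formula[OF q smooth_E, symmetric] ip52_simps(3))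
  then have "(dd \<mu> 1 q - (2/3) * \<epsilon> 1 * (k 2 q)^2 + (\<mu> q)^2) * \<epsilon> 2 = 0"
    by (simp add: eps algebra_simps)
  then show "dd \<mu> 1 q = - ((\<mu> q)^2) + (2/3) * \<epsilon> 1 * (k 2 q)^2"
    using eps_nz[of 2] by simp
qed

end

section \<open>Explicit position vector\<close>

lemma frechet_derivative_real_compose:
  fixes f :: "'a::real_normed_vector \<Rightarrow> real" and g :: "real \<Rightarrow> real"
  assumes "(g has_real_derivative g') (at (f q))" "f differentiable at q"
  shows "frechet_derivative (\<lambda>r. g (f r)) (at q) v = g' * frechet_derivative f (at q) v"
proof -
  have D: "((\<lambda>r. g (f r)) has_derivative (\<lambda>v. g' * frechet_derivative f (at q) v)) (at q)"
    using has_derivative_compose[OF frechet_derivative_works[THEN iffD1, OF assms(2)],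
        of g "(*) g'"] assms(1) by (simp add: has_field_derivative_def)
  show ?thesis
    by (simp only: frechet_derivative_at[OF D, symmetric])
qed

context biconservative_chart
begin

definition rad :: "real^4 \<Rightarrow> real" where "rad q = k 2 q powr (-3/5)"
definition \<alpha> :: "real^4 \<Rightarrow> real" where "\<alpha> q = rad q * k 2 q"
definition \<beta> :: "real^4 \<Rightarrow> real" where "\<beta> q = rad q * \<mu> q"
definition Z :: "real^4 \<Rightarrow> real^5" where "Z q = \<alpha> q *\<^sub>R E 1 q + \<beta> q *\<^sub>R n q"
text \<open>The vector orthogonal to \<open>Z\<close> in the plane of \<open>E 1\<close> and
  \<open>n\<close>: the radial direction of the rotation about \<open>Z\<close>.\<close>

definition P :: "real^4 \<Rightarrow> real^5" where "P q = \<beta> q *\<^sub>R E 1 q + (- \<epsilon> 1 * \<alpha> q) *\<^sub>R n q"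

lemma rad_pos: "q \<in> U \<Longrightarrow> rad q > 0"
  using k2[of q] by (simp add: rad_def)

lemma smooth_rad: "smooth_on U rad"
  unfolding rad_def by (intro smooth_intros U smooth_k k2)

lemma smooth_alpha: "smooth_on U \<alpha>"
  unfolding \<alpha>_def by (intro smooth_intros U smooth_k smooth_rad)

lemma smooth_beta: "smooth_on U \<beta>"
  unfolding \<beta>_def by (intro smooth_intros U smooth_mu smooth_rad)

lemma smooth_Z: "smooth_on U Z"
  unfolding Z_def by (intro smooth_intros U smooth_alpha smooth_beta smooth_E n)

lemma smooth_P: "smooth_on U P"
  unfolding P_def by (intro smooth_intros U smooth_alpha smooth_beta smooth_E n)

lemma dd_rad:
  assumes q: "q \<in> U"
  shows "dd rad 1 q = \<beta> q" and "a \<noteq> 1 \<Longrightarrow> dd rad a q = 0"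
proof -
  have *: "dd rad a q = -3/5 * k 2 q powr (-3/5 - 1) * dd (k 2) a q" for a
    unfolding rad_def
    by (rule frechet_derivative_real_compose[OF has_real_derivative_powr[OF k2[OF q]]
          smooth_on_differentiable[OF smooth_k U q]])
  have "k 2 q powr (-3/5 - 1) * k 2 q = rad q"
    using k2[OF q] powr_add[of "k 2 q" "-3/5 - 1" 1] by (simp add: rad_def)
  then show "dd rad 1 q = \<beta> q"
    unfolding *[of 1] dd_k2[OF q] \<beta>_def by (simp add: algebra_simps)
  show "dd rad a q = 0" if "a \<noteq> 1"
    unfolding * using dk[OF q that] by simp
qed

lemma alpha_rad: "q \<in> U \<Longrightarrow> \<alpha> q = rad q powr (-2/3)"
proof -
  assume q: "q \<in> U"
  have "rad q powr (-2/3) = k 2 q powr (-3/5 + 1)"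
    by (simp add: rad_def powr_powr)
  also have "\<dots> = \<alpha> q"
    unfolding powr_add using k2[OF q] by (simp add: \<alpha>_def rad_def)
  finally show ?thesis by simp
qed

lemma alpha_pos: "q \<in> U \<Longrightarrow> \<alpha> q > 0" and beta_pos: "q \<in> U \<Longrightarrow> \<beta> q > 0"
  using rad_pos k2 mu_pos by (simp_all add: \<alpha>_def \<beta>_def)

lemma dd_alpha:
  assumes q: "q \<in> U"
  shows "dd \<alpha> 1 q = - (2/3) * \<mu> q * \<alpha> q" and "a \<noteq> 1 \<Longrightarrow> dd \<alpha> a q = 0"
proof -
  have *: "dd \<alpha> a q = rad q * dd (k 2) a q + dd rad a q * k 2 q" for a
    unfolding \<alpha>_def by (rule frechet_derivative_mult[OF U q smooth_rad smooth_k])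
  show "dd \<alpha> 1 q = - (2/3) * \<mu> q * \<alpha> q"
    unfolding * dd_rad[OF q] dd_k2[OF q] by (simp add: \<alpha>_def \<beta>_def algebra_simps)
  show "dd \<alpha> a q = 0" if "a \<noteq> 1"
    unfolding * using dd_rad(2)[OF q that] dk[OF q that] by simp
qed

lemma dd_beta:
  assumes q: "q \<in> U"
  shows "dd \<beta> 1 q = (2/3) * \<epsilon> 1 * k 2 q * \<alpha> q" and "a \<noteq> 1 \<Longrightarrow> dd \<beta> a q = 0"
proof -
  have *: "dd \<beta> a q = rad q * dd \<mu> a q + dd rad a q * \<mu> q" for a
    unfolding \<beta>_def by (rule frechet_derivative_mult[OF U q smooth_rad smooth_mu])
  show "dd \<beta> 1 q = (2/3) * \<epsilon> 1 * k 2 q * \<alpha> q"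
    unfolding * dd_rad[OF q] dd_mu(2)[OF q] by (simp add: \<alpha>_def \<beta>_def algebra_simps power2_eq_square)
  show "dd \<beta> a q = 0" if "a \<noteq> 1"
    unfolding * using dd_rad(2)[OF q that] dd_mu(1)[OF q that] by simp
qed

lemma dd_plane_field:
  assumes q: "q \<in> U" and f: "smooth_on U f" and g: "smooth_on U g"
  shows "dd (\<lambda>r. f r *\<^sub>R E 1 r + g r *\<^sub>R n r) a q =
    (f q *\<^sub>R dd (E 1) a q + dd f a q *\<^sub>R E 1 q) + (g q *\<^sub>R dd n a q + dd g a q *\<^sub>R n q)"
  using frechet_derivative_rules(1)[OF U q smooth_on_scaleR[OF U f smooth_E] smooth_on_scaleR[OF U g n]]
  by (simp only: frechet_derivative_scaleR[OF U q f smooth_E] frechet_derivative_scaleR[OF U q g n])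

lemma dd_Z:
  assumes q: "q \<in> U"
  shows "dd Z a q = 0"
proof -
  have *: "dd Z a q = (\<alpha> q *\<^sub>R dd (E 1) a q + dd \<alpha> a q *\<^sub>R E 1 q) + (\<beta> q *\<^sub>R dd n a q + dd \<beta> a q *\<^sub>R n q)" for a
    unfolding Z_def[abs_def] by (rule dd_plane_field[OF q smooth_alpha smooth_beta])
  \<comment> \<open>Both sides are \<open>rad q * \<mu> q * k 2 q\<close>; the derivatives of
    \<open>Z\<close> along \<open>E 1\<close>, \<open>E 2\<close> and \<open>E 3\<close> are
    multiples of their difference.\<close>
  have sw: "\<alpha> q * \<mu> q = \<beta> q * k 2 q"
    by (simp add: \<alpha>_def \<beta>_def)
  have 1: "dd Z 1 q = ((2/3) * (\<beta> q * k 2 q - \<alpha> q * \<mu> q)) *\<^sub>R E 1 q"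
    unfolding * dd_E[OF q] dd_n[OF q] dd_alpha[OF q] dd_beta[OF q] by (simp add: algebra_simps)
  have 23: "dd Z a q = (\<alpha> q * \<mu> q - \<beta> q * k 2 q) *\<^sub>R E a q" if "a = 2 \<or> a = 3" for a
    using that dd_E(4)[OF q that] dd_n[OF q] dd_alpha(2)[OF q, of a] dd_beta(2)[OF q, of a]
    unfolding * by (auto simp: algebra_simps)
  have 4: "dd Z 4 q = 0"
    using dd_alpha(2)[OF q, of 4] dd_beta(2)[OF q, of 4] unfolding * dd_E(3)[OF q] dd_n(4)[OF q] by simp
  show ?thesis
    using 1 23[of a] 4 sw exhaust_4[of a] by auto
qed

lemma ip_plane:
  "q \<in> U \<Longrightarrow> ip52 (a *\<^sub>R E 1 q + b *\<^sub>R n q) (c *\<^sub>R E 1 q + d *\<^sub>R n q) = \<epsilon> 1 * (a * c) + b * d"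
  by (simp add: ip52_simps ipE ipEn ipnE nn)

lemma Z_constant: "p \<in> U \<Longrightarrow> q \<in> U \<Longrightarrow> Z p = Z q"
  by (rule constant_on_chart[OF smooth_Z dd_Z])

lemma axis_constant: "p \<in> U \<Longrightarrow> q \<in> U \<Longrightarrow> E 4 p = E 4 q"
  by (rule constant_on_chart[OF smooth_E dd_E(1)])

lemma ip_ZZ: "q \<in> U \<Longrightarrow> ip52 (Z q) (Z q) = \<epsilon> 1 * (\<alpha> q)^2 + (\<beta> q)^2"
  unfolding Z_def by (simp add: ip_plane power2_eq_square)

lemma ip_PP: "q \<in> U \<Longrightarrow> ip52 (P q) (P q) = \<epsilon> 1 * ip52 (Z q) (Z q)"
proof -
  assume q: "q \<in> U"
  have "ip52 (P q) (P q) = \<epsilon> 1 * (\<beta> q * \<beta> q) + (\<epsilon> 1 * \<epsilon> 1) * (\<alpha> q * \<alpha> q)"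
    unfolding P_def ip_plane[OF q] by (simp add: algebra_simps)
  also have "\<dots> = \<epsilon> 1 * (\<beta> q * \<beta> q) + \<epsilon> 1 * (\<epsilon> 1 * (\<alpha> q * \<alpha> q))"
    by (simp only: mult.assoc)
  finally show ?thesis
    unfolding ip_ZZ[OF q] by (simp add: algebra_simps power2_eq_square)
qed

lemma ip_PZ: "q \<in> U \<Longrightarrow> ip52 (P q) (Z q) = 0"
  unfolding P_def Z_def ip_plane by simp

lemma ip_plane_E: "q \<in> U \<Longrightarrow> a \<noteq> 1 \<Longrightarrow> ip52 (f *\<^sub>R E 1 q + g *\<^sub>R n q) (E a q) = 0"
  by (simp add: ip52_simps ipE ipnE)

text \<open>Constancy of the square of \<open>Z\<close> is a first integral. It expresses the
  derivative \<open>\<beta>\<close> of \<open>rad\<close> through \<open>rad\<close> itself;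
  positivity of \<open>\<beta>\<close> selects the root.\<close>

lemma beta_eq: "q \<in> U \<Longrightarrow> p \<in> U \<Longrightarrow> \<beta> q = sqrt (ip52 (Z p) (Z p) - \<epsilon> 1 * rad q powr (-4/3))"
proof -
  assume q: "q \<in> U" and p: "p \<in> U"
  have "(\<alpha> q)^2 = rad q powr (-4/3)"
    using rad_pos[OF q] by (simp add: alpha_rad[OF q] power2_eq_square powr_add[symmetric])
  then have "(\<beta> q)^2 = ip52 (Z p) (Z p) - \<epsilon> 1 * rad q powr (-4/3)"
    using ip_ZZ[OF q] Z_constant[OF p q] by simp
  then show ?thesis
    using beta_pos[OF q] by (metis less_imp_le real_sqrt_unique)
qed

text \<open>\<open>P\<close> behaves like a radius vector: fixed along the profile curve and the
  rulings, while along \<open>E 2\<close> and \<open>E 3\<close> the vector \<open>rad\<close> times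
  \<open>P\<close>, divided by the square of \<open>Z\<close>, has derivative
  \<open>E a\<close>.\<close>

lemma dd_P:
  assumes q: "q \<in> U"
  shows "dd P 1 q = 0" and "dd P 4 q = 0"
    and "a = 2 \<or> a = 3 \<Longrightarrow> rad q *\<^sub>R dd P a q = ip52 (Z q) (Z q) *\<^sub>R E a q"
proof -
  have s: "smooth_on U (\<lambda>q. - \<epsilon> 1 * \<alpha> q)"
    by (intro smooth_intros U smooth_alpha)
  have "dd (\<lambda>q. - \<epsilon> 1 * \<alpha> q) a q = - \<epsilon> 1 * dd \<alpha> a q" for a
    by (rule frechet_derivative_linear_image[OF bounded_linear_mult_right smooth_on_differentiable[OF smooth_alpha U q]])
  then have *: "dd P a q = (\<beta> q *\<^sub>R dd (E 1) a q + dd \<beta> a q *\<^sub>R E 1 q)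
      + ((- \<epsilon> 1 * \<alpha> q) *\<^sub>R dd n a q + (- \<epsilon> 1 * dd \<alpha> a q) *\<^sub>R n q)" for a
    using dd_plane_field[OF q smooth_beta s, of a] unfolding P_def[abs_def] by simp
  have sw: "\<alpha> q * \<mu> q = \<beta> q * k 2 q"
    by (simp add: \<alpha>_def \<beta>_def)
  have "dd P 1 q = ((2/3) * \<epsilon> 1 * (\<alpha> q * \<mu> q - \<beta> q * k 2 q)) *\<^sub>R n q"
    unfolding * dd_E[OF q] dd_n[OF q] dd_alpha[OF q] dd_beta[OF q] by (simp add: algebra_simps)
  then show "dd P 1 q = 0" using sw by simp
  show "dd P 4 q = 0"
    using dd_alpha(2)[OF q, of 4] dd_beta(2)[OF q, of 4] unfolding * dd_E(3)[OF q] dd_n(4)[OF q] by simp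
  assume a: "a = 2 \<or> a = 3"
  have "dd P a q = (\<beta> q * \<mu> q + \<epsilon> 1 * \<alpha> q * k 2 q) *\<^sub>R E a q"
    using a dd_E(4)[OF q a] dd_n[OF q] dd_alpha(2)[OF q, of a] dd_beta(2)[OF q, of a]
    unfolding * by (auto simp: algebra_simps)
  moreover have "rad q * (\<beta> q * \<mu> q + \<epsilon> 1 * \<alpha> q * k 2 q) = ip52 (Z q) (Z q)"
    unfolding ip_ZZ[OF q] by (simp add: \<alpha>_def \<beta>_def power2_eq_square algebra_simps)
  ultimately show "rad q *\<^sub>R dd P a q = ip52 (Z q) (Z q) *\<^sub>R E a q"
    by simp
qed

definition height :: "real^4 \<Rightarrow> real^4 \<Rightarrow> real" where
  "height q0 q = \<epsilon> 4 * ip52 (y q) (E 4 q0)"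

lemma smooth_height: "smooth_on U (height q0)"
  unfolding height_def by (intro smooth_intros U y)

lemma dd_height:
  assumes q: "q \<in> U" and q0: "q0 \<in> U"
  shows "dd (height q0) a q = (if a = 4 then 1 else 0)"
proof -
  have "bounded_linear (\<lambda>X. \<epsilon> 4 * ip52 X (E 4 q0))"
    using bounded_linear_compose[OF bounded_linear_mult_right bounded_bilinear.bounded_linear_left[OF bounded_bilinear_ip52]] by simp
  from frechet_derivative_linear_image[OF this smooth_on_differentiable[OF y U q]]
  have "dd (height q0) a q = \<epsilon> 4 * ip52 (E a q) (E 4 q0)"
    unfolding height_def E_def by simp
  then show ?thesis
    by (simp add: axis_constant[OF q0 q] ipE[OF q] eps)
qed

text \<open>Shared verification of the two position formulas: the difference between
  \<open>y\<close> and the candidate has vanishing derivatives along the frame. \<open>T\<close>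
  must reproduce \<open>E 1\<close>, \<open>E 2\<close>, \<open>E 3\<close> up to a multiple of
  \<open>Z\<close> along \<open>E 1\<close>, which the term with \<open>\<Psi>\<close>
  supplies.\<close>

lemma position_constant:
  assumes q0: "q0 \<in> U" and J: "open J" "rad ` U \<subseteq> J" "smooth_on J \<Psi>" and T: "smooth_on U T"
    and \<Psi>: "\<And>q. q \<in> U \<Longrightarrow> (\<Psi> has_real_derivative \<Psi>' q) (at (rad q))"
    and dT: "\<And>a q. q \<in> U \<Longrightarrow> dd T a q = (if a = 4 then 0 else E a q) - (if a = 1 then (\<Psi>' q * \<beta> q) *\<^sub>R Z q else 0)"
  shows "\<exists>C. \<forall>q\<in>U. y q = C + height q0 q *\<^sub>R E 4 q0 + \<Psi> (rad q) *\<^sub>R Z q0 + T q"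
proof -
  define C where "C = (\<lambda>q. y q - height q0 q *\<^sub>R E 4 q0 - \<Psi> (rad q) *\<^sub>R Z q0 - T q)"
  have s\<Psi>: "smooth_on U (\<lambda>q. \<Psi> (rad q))"
    by (rule smooth_on_compose[OF U J(1,3) smooth_rad J(2)])
  have sh: "smooth_on U (\<lambda>q. height q0 q *\<^sub>R E 4 q0)"
    by (intro smooth_intros U smooth_height)
  have sZ: "smooth_on U (\<lambda>q. \<Psi> (rad q) *\<^sub>R Z q0)"
    by (intro smooth_intros U s\<Psi>)
  have sC: "smooth_on U C"
    unfolding C_def by (intro smooth_on_diff U y sh sZ T)
  have "dd C a q = 0" if q: "q \<in> U" for a q
  proof -
    have "dd C a q = dd y a q - dd (\<lambda>q. height q0 q *\<^sub>R E 4 q0) a q - dd (\<lambda>q. \<Psi> (rad q) *\<^sub>R Z q0) a q - dd T a q"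
      unfolding C_def
      by (simp only: frechet_derivative_rules(2)[OF U q smooth_on_diff[OF U smooth_on_diff[OF U y sh] sZ] T]
          frechet_derivative_rules(2)[OF U q smooth_on_diff[OF U y sh] sZ] frechet_derivative_rules(2)[OF U q y sh])
    also have "dd (\<lambda>q. height q0 q *\<^sub>R E 4 q0) a q = (if a = 4 then 1 else 0) *\<^sub>R E 4 q"
      by (simp add: frechet_derivative_scaleR[OF U q smooth_height smooth_on_const[OF U]]
          dd_height[OF q q0] axis_constant[OF q q0])
    also have "dd (\<lambda>q. \<Psi> (rad q) *\<^sub>R Z q0) a q = (\<Psi>' q * dd rad a q) *\<^sub>R Z q"
      by (simp add: frechet_derivative_scaleR[OF U q s\<Psi> smooth_on_const[OF U]]
          frechet_derivative_real_compose[OF \<Psi>[OF q] smooth_on_differentiable[OF smooth_rad U q]] Z_constant[OF q q0])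
    finally show ?thesis
      using dT[OF q, of a] dd_rad[OF q] by (auto simp: E_def)
  qed
  then have "C q = C q0" if "q \<in> U" for q
    using constant_on_chart[OF sC _ that q0] by blast
  then have "y q = C q0 + height q0 q *\<^sub>R E 4 q0 + \<Psi> (rad q) *\<^sub>R Z q0 + T q" if "q \<in> U" for q
    using that by (simp add: C_def algebra_simps)
  then show ?thesis by blast
qed

text \<open>\<open>E 1\<close> is split along the orthogonal vectors \<open>P\<close> and
  \<open>Z\<close>, with coefficients \<open>\<beta> q / c\<close> and
  \<open>\<epsilon> 1 * \<alpha> q / c\<close>. The first part is the derivative of the radial term.
  The second must equal the derivative of \<open>\<Psi> (rad q)\<close> times \<open>Z\<close>,
  which gives \<Psi>' = \<epsilon> \<alpha> / (c \<beta>), written as a function of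
  \<open>rad\<close>.\<close>

lemma position_nonnull:
  assumes q0: "q0 \<in> U" and c: "ip52 (Z q0) (Z q0) = c" "c \<noteq> 0"
    and J: "open J" "rad ` U \<subseteq> J" "smooth_on J \<Psi>"
    and \<Psi>: "\<And>x. x \<in> J \<Longrightarrow> (\<Psi> has_real_derivative \<epsilon> 1 * x powr (-2/3) / (c * sqrt (c - \<epsilon> 1 * x powr (-4/3)))) (at x)"
  shows "\<exists>C. \<forall>q\<in>U. y q = C + height q0 q *\<^sub>R E 4 q0 + \<Psi> (rad q) *\<^sub>R Z q0 + (rad q / c) *\<^sub>R P q"
proof (rule position_constant[OF q0 J])
  have sr: "smooth_on U (\<lambda>q. rad q / c)"
    using c by (intro smooth_intros U smooth_rad) auto
  show "smooth_on U (\<lambda>q. (rad q / c) *\<^sub>R P q)"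
    by (intro smooth_on_scaleR U sr smooth_P)
  show "(\<Psi> has_real_derivative \<epsilon> 1 * \<alpha> q / (c * \<beta> q)) (at (rad q))" if q: "q \<in> U" for q
    using \<Psi>[of "rad q"] J(2) q beta_eq[OF q q0] by (auto simp: alpha_rad c)
  fix a q assume q: "q \<in> U"
  have Zc: "ip52 (Z q) (Z q) = c" using Z_constant[OF q0 q] c by simp
  have "dd (\<lambda>q. rad q / c) a q = dd rad a q / c"
    by (rule frechet_derivative_linear_image[OF bounded_linear_divide smooth_on_differentiable[OF smooth_rad U q]])
  then have T: "dd (\<lambda>q. (rad q / c) *\<^sub>R P q) a q = (rad q / c) *\<^sub>R dd P a q + (dd rad a q / c) *\<^sub>R P q"
    using frechet_derivative_scaleR[OF U q sr smooth_P, of "e a q"] by simp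
  have 1: "(\<beta> q / c) *\<^sub>R P q = E 1 q - (\<epsilon> 1 * \<alpha> q / (c * \<beta> q) * \<beta> q) *\<^sub>R Z q"
  proof -
    have b0: "\<beta> q \<noteq> 0" using beta_pos[OF q] by simp
    have "(\<beta> q / c) *\<^sub>R P q + (\<epsilon> 1 * \<alpha> q / c) *\<^sub>R Z q = ((\<epsilon> 1 * (\<alpha> q)^2 + (\<beta> q)^2) / c) *\<^sub>R E 1 q"
      by (simp add: P_def Z_def algebra_simps add_divide_distrib power2_eq_square)
    also have "\<dots> = E 1 q"
      using c(2) Zc ip_ZZ[OF q] by simp
    finally show ?thesis
      using b0 by (simp add: algebra_simps)
  qed
  have 23: "(rad q / c) *\<^sub>R dd P a q = E a q" if "a = 2 \<or> a = 3"
  proof -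
    have "(rad q / c) *\<^sub>R dd P a q = (1 / c) *\<^sub>R (rad q *\<^sub>R dd P a q)"
      by simp
    also have "\<dots> = E a q"
      unfolding dd_P(3)[OF q that] using c(2) Zc by simp
    finally show ?thesis .
  qed
  show "dd (\<lambda>q. (rad q / c) *\<^sub>R P q) a q
    = (if a = 4 then 0 else E a q) - (if a = 1 then (\<epsilon> 1 * \<alpha> q / (c * \<beta> q) * \<beta> q) *\<^sub>R Z q else 0)"
    using exhaust_4[of a] 1 23 dd_P(1,2)[OF q] dd_rad[OF q] by (auto simp: T)
qed

text \<open>Replaces the radial term when \<open>Z\<close> is null. The factor makes
  \<open>E 1\<close> and \<open>- n\<close> contribute half of \<open>E a\<close> each to the
  derivative along \<open>E a\<close>, since then \<open>\<mu>\<close> equals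
  \<open>k 2\<close>.\<close>

definition T :: "real^4 \<Rightarrow> real^5" where
  "T q = (1 / (2 * \<mu> q)) *\<^sub>R E 1 q + (- 1 / (2 * \<mu> q)) *\<^sub>R n q"

lemma null_relations:
  assumes q: "q \<in> U" and c: "ip52 (Z q) (Z q) = 0"
  shows "\<epsilon> 1 = -1" and "\<mu> q = k 2 q" and "\<beta> q = \<alpha> q"
proof -
  have "\<epsilon> 1 = 1 \<or> \<epsilon> 1 = -1"
    using eps[of 1] square_eq_1_iff by (simp add: square_eq_1_iff)
  moreover have "\<epsilon> 1 * (\<alpha> q)^2 + (\<beta> q)^2 = 0" "(\<alpha> q)^2 > 0" "(\<beta> q)^2 > 0"
    using ip_ZZ[OF q] c alpha_pos[OF q] beta_pos[OF q] by auto
  ultimately show e1: "\<epsilon> 1 = -1" and "\<beta> q = \<alpha> q"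
    using alpha_pos[OF q] beta_pos[OF q] by (auto simp: power2_eq_iff)
  then show "\<mu> q = k 2 q"
    using rad_pos[OF q] by (simp add: \<alpha>_def \<beta>_def)
qed

lemma smooth_T: "smooth_on U T"
proof -
  have "2 * \<mu> q \<noteq> 0" if "q \<in> U" for q using mu_pos[OF that] by simp
  then show ?thesis
    unfolding T_def by (intro smooth_on_add smooth_on_scaleR smooth_on_divide smooth_on_mult smooth_on_const smooth_E n smooth_mu U)
qed

text \<open>Along \<open>E 1\<close> the derivative of \<open>T\<close> is half of
  \<open>E 1 - n\<close>, so half of \<open>E 1 + n\<close> has to come from \<Psi>' \<beta>
  \<open>Z\<close>, where \<open>Z\<close> is \<alpha> times \<open>E 1 + n\<close>. With \<alpha> =
  \<beta> = r^(-2/3) this means \<Psi>' = r^(4/3) / 2, and integration gives 3/14 and the exponent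
  7/3.\<close>

lemma position_null:
  assumes q0: "q0 \<in> U" and c: "ip52 (Z q0) (Z q0) = 0"
  shows "\<exists>C. \<forall>q\<in>U. y q = C + height q0 q *\<^sub>R E 4 q0 + ((3/14) * rad q powr (7/3)) *\<^sub>R Z q0 + T q"
proof (rule position_constant[OF q0, where J = "{0<..}" and \<Psi> = "\<lambda>x. (3/14) * x powr (7/3)"])
  show "rad ` U \<subseteq> {0<..}" using rad_pos by auto
  show "smooth_on {0<..} (\<lambda>x::real. (3/14) * x powr (7/3))"
    by (intro smooth_intros) auto
  show "((\<lambda>x. (3/14) * x powr (7/3)) has_real_derivative (1/2) * rad q powr (4/3)) (at (rad q))" if "q \<in> U" for q
    using rad_pos[OF that] by (auto intro!: derivative_eq_intros)
  fix a q assume q: "q \<in> U"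
  note nr = null_relations[OF q c[unfolded Z_constant[OF q0 q]]]
  have mu0: "\<mu> q \<noteq> 0" using mu_pos[OF q] by simp
  have sm: "smooth_on U (\<lambda>q. d / (2 * \<mu> q))" for d
    using mu_pos by (intro smooth_intros U smooth_mu) force
  have dm: "dd (\<lambda>q. d / (2 * \<mu> q)) a q = - d / (2 * (\<mu> q)^2) * dd \<mu> a q" for a d
    by (rule frechet_derivative_real_compose[where g = "\<lambda>x. d / (2 * x)", OF _ smooth_on_differentiable[OF smooth_mu U q]])
      (use mu0 in \<open>auto intro!: derivative_eq_intros simp: power2_eq_square\<close>)
  have dT: "dd T a q = ((1 / (2 * \<mu> q)) *\<^sub>R dd (E 1) a q + (- 1 / (2 * (\<mu> q)^2) * dd \<mu> a q) *\<^sub>R E 1 q)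
      + ((- 1 / (2 * \<mu> q)) *\<^sub>R dd n a q + (1 / (2 * (\<mu> q)^2) * dd \<mu> a q) *\<^sub>R n q)" for a
    using dd_plane_field[OF q sm sm, of 1 "-1" a] unfolding dm T_def[abs_def] by (simp only: minus_minus)
  have m1: "dd \<mu> 1 q = - (5/3) * (\<mu> q)^2"
    using dd_mu(2)[OF q] nr by simp
  have "(1/2) * rad q powr (4/3) * \<beta> q * \<alpha> q = 1/2"
    using rad_pos[OF q] nr(3) by (simp add: alpha_rad[OF q] powr_add[symmetric])
  then have Zq: "((1/2) * rad q powr (4/3) * \<beta> q) *\<^sub>R Z q = (1/2) *\<^sub>R E 1 q + (1/2) *\<^sub>R n q"
    unfolding Z_def nr(3) by (simp add: scaleR_add_right)
  have 1: "dd T 1 q = (1/2) *\<^sub>R E 1 q - (1/2) *\<^sub>R n q"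
  proof -
    have "dd T 1 q = ((5/6) *\<^sub>R E 1 q - (1/3) *\<^sub>R E 1 q) + ((1/3) *\<^sub>R n q - (5/6) *\<^sub>R n q)"
      unfolding dT m1 dd_E(2)[OF q] dd_n(1)[OF q] nr(1) nr(2)[symmetric]
      using mu0 by (simp add: algebra_simps power2_eq_square)
    also have "\<dots> = (5/6 - 1/3) *\<^sub>R E 1 q + (1/3 - 5/6) *\<^sub>R n q"
      by (simp only: scaleR_diff_left)
    finally show ?thesis by simp
  qed
  have 23: "dd T a q = E a q" if "a = 2 \<or> a = 3" for a
  proof -
    have "dd T a q = (1/2) *\<^sub>R E a q + (1/2) *\<^sub>R E a q"
      using that dd_E(4)[OF q that] dd_n[OF q] dd_mu(1)[OF q, of a] nr(2)[symmetric] mu0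
      unfolding dT by auto
    then show ?thesis by (simp add: scaleR_add_left[symmetric])
  qed
  have 4: "dd T 4 q = 0"
    using dd_mu(1)[OF q, of 4] unfolding dT dd_E(3)[OF q] dd_n(4)[OF q] by simp
  have "E 1 q - (1/2) *\<^sub>R E 1 q = (1/2) *\<^sub>R E 1 q"
    using scaleR_left_diff_distrib[of 1 "1/2" "E 1 q"] by simp
  then have half: "dd T 1 q = E 1 q - ((1/2) *\<^sub>R E 1 q + (1/2) *\<^sub>R n q)"
    unfolding 1 by (simp only: diff_diff_eq[symmetric])
  show "dd T a q = (if a = 4 then 0 else E a q) - (if a = 1 then ((1/2) * rad q powr (4/3) * \<beta> q) *\<^sub>R Z q else 0)"
    using exhaust_4[of a] 23 4 half unfolding Zq by auto
qed (use smooth_T in auto)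

text \<open>Together with orthogonality to the ruling, these two equations leave two free components
  of \<open>T\<close>; divided by \<open>rad\<close>, they become the parameters \<open>t\<close>
  and \<open>u\<close>, up to sign.\<close>

lemma null_field:
  assumes q: "q \<in> U" and c: "ip52 (Z q) (Z q) = 0"
  shows "ip52 (T q) (T q) = 0" and "ip52 (T q) (Z q) = - rad q"
proof -
  note nr = null_relations[OF q c]
  have mu0: "\<mu> q \<noteq> 0" using mu_pos[OF q] by simp
  show "ip52 (T q) (T q) = 0"
    unfolding T_def ip_plane[OF q] nr(1) by simp
  show "ip52 (T q) (Z q) = - rad q"
    unfolding T_def Z_def ip_plane[OF q] nr(1,3) \<alpha>_def nr(2)[symmetric] using mu0 by simp
qed

end

section \<open>Congruence and angular coordinates\<close>

definition signature52 :: "5 \<Rightarrow> real" where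
  "signature52 i = (if i = 1 \<or> i = 2 then -1 else 1)"

definition orthonormal52 :: "(5 \<Rightarrow> real^5) \<Rightarrow> bool" where
  "orthonormal52 f \<longleftrightarrow> (\<forall>i j. ip52 (f i) (f j) = (if i = j then signature52 i else 0))"

definition frame_combination :: "(5 \<Rightarrow> real^5) \<Rightarrow> real^5 \<Rightarrow> real^5" where
  "frame_combination f x = (\<Sum>i\<in>UNIV. x $ i *\<^sub>R f i)"

lemma ip52_signature: "ip52 a b = (\<Sum>i\<in>UNIV. signature52 i * (a $ i * b $ i))"
  by (simp add: ip52_def sum_5 signature52_def)

lemma linear_frame_combination: "linear (frame_combination f)"
  unfolding frame_combination_def
  by (intro linearI) (simp_all add: scaleR_add_left sum.distrib scaleR_sum_right)

lemma isometry52_frame_combination: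
  assumes f: "orthonormal52 f"
  shows "isometry52 (\<lambda>x. C + frame_combination f x)"
proof -
  let ?T = "frame_combination f"
  have lin: "linear ?T" by (rule linear_frame_combination)
  have fo: "ip52 (f i) (f j) = (if i = j then signature52 i else 0)" for i j
    using f by (simp add: orthonormal52_def)
  have ipf: "ip52 (?T x) (f j) = signature52 j * x $ j" for x j
    by (simp add: frame_combination_def ip52_sum_left ip52_simps fo if_distrib sum.delta mult.commute cong: if_cong)
  have ip: "ip52 (?T x) (?T z) = ip52 x z" for x z
  proof -
    have "ip52 (?T x) (?T z) = (\<Sum>j\<in>UNIV. z $ j * ip52 (?T x) (f j))"
      unfolding frame_combination_def[of f z] by (simp add: ip52_sum_right ip52_simps)
    then show ?thesis unfolding ipf ip52_signature[of x z] by (simp add: mult_ac)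
  qed
  have sn: "signature52 j \<noteq> 0" for j by (simp add: signature52_def)
  have inj: "inj ?T"
  proof (rule injI)
    fix x z assume "?T x = ?T z"
    then have "signature52 j * x $ j = signature52 j * z $ j" for j
      by (simp only: ipf[symmetric])
    then show "x = z" using sn by (simp add: vec_eq_iff)
  qed
  have surj: "surj ?T"
    using lin inj linear_injective_imp_surjective by blast
  have bl: "bounded_linear ?T"
    using lin by (simp add: linear_conv_bounded_linear)
  have bij: "bij (\<lambda>x. C + ?T x)"
  proof (rule bijI)
    show "inj (\<lambda>x. C + ?T x)" using inj by (simp add: inj_def)
    show "surj (\<lambda>x. C + ?T x)"
      by (rule surjI[where f = "\<lambda>z. inv ?T (z - C)"]) (simp add: surj_f_inv_f[OF surj])
  qed
  have invl: "bounded_linear (inv ?T)"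
    using inj_linear_imp_inv_linear[OF lin inj] by (simp add: linear_conv_bounded_linear)
  have inv: "inv (\<lambda>x. C + ?T x) = (\<lambda>z. inv ?T (z - C))"
    by (rule inv_equality) (simp_all add: inj inv_f_f surj_f_inv_f[OF surj])
  have D: "frechet_derivative (\<lambda>x. C + ?T x) (at p) = ?T" for p
    by (rule frechet_derivative_at[symmetric])
      (auto intro!: derivative_eq_intros bounded_linear.has_derivative[OF bl])
  show ?thesis
    unfolding isometry52_def inv D
    using bij ip by (auto intro!: smooth_on_linear[OF bl] smooth_on_linear[OF invl] smooth_intros)
qed

text \<open>Congruence seen from the chart: the parameters are smooth functions of the point, and no
  invertibility is claimed. That is added once for all cylinders in
  \<open>locally_congruent_chartI\<close>.\<close>

definition chart_congruent ::
  "(real^4) set \<Rightarrow> (real^4 \<Rightarrow> real^5) \<Rightarrow> real^4 \<Rightarrow> real set \<Rightarrow> (real \<Rightarrow> real \<Rightarrow> real \<Rightarrow> real \<Rightarrow> real^5) \<Rightarrow> bool" where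
  "chart_congruent U y q0 I L \<longleftrightarrow> (\<exists>U' f C s t u v. open U' \<and> q0 \<in> U' \<and> U' \<subseteq> U \<and> orthonormal52 f \<and>
     smooth_on U' s \<and> smooth_on U' t \<and> smooth_on U' u \<and> smooth_on U' v \<and>
     (\<forall>q\<in>U'. s q \<in> I \<and> y q = C + frame_combination f (L (s q) (t q) (u q) (v q))))"

text \<open>Differentiability of \<open>L\<close> serves the chain rule, by which a vector killed by
  the derivative of the parameter map \<open>\<Phi>\<close> is killed by that of \<open>y\<close>.
  The rest transports the local inverse \<open>g\<close> to \<open>M\<close>, and to all other
  charts through their transition maps with \<open>c\<close>.\<close>

lemma locally_congruent_chartI:
  fixes M :: "'m::t2_space set"
  assumes man: "smooth_manifold4 M A" and ch: "(D, c) \<in> A" and p: "p \<in> D"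
    and im: "immersion_index2 (c ` D) (x \<circ> inv_into D c)"
    and cc: "chart_congruent (c ` D) (x \<circ> inv_into D c) (c p) I L"
    and L: "\<And>w::real^4. w $ 1 \<in> I \<Longrightarrow> (\<lambda>w::real^4. L (w $ 1) (w $ 2) (w $ 3) (w $ 4)) differentiable at w"
  shows "locally_congruent M A x p I L"
proof -
  let ?y = "x \<circ> inv_into D c" and ?i = "inv_into D c"
  have D: "open D" "open (c ` D)" "homeomorphism D (c ` D) c ?i" "D \<subseteq> M"
    using man ch by (auto simp: smooth_manifold4_def)
  have trans: "smooth_on (c1 ` (D1 \<inter> D2)) (c2 \<circ> inv_into D1 c1)" if "(D1, c1) \<in> A" "(D2, c2) \<in> A" for D1 c1 D2 c2
    using man that by (fastforce simp: smooth_manifold4_def)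
  have chart: "open D1" "open (c1 ` D1)" "homeomorphism D1 (c1 ` D1) c1 (inv_into D1 c1)" if "(D1, c1) \<in> A" for D1 c1
    using man that by (auto simp: smooth_manifold4_def)
  have open_image: "open (c1 ` S)" if "(D1, c1) \<in> A" "open S" "S \<subseteq> D1" for D1 c1 S
  proof -
    have "openin (top_of_set D1) S"
      using that chart(1)[OF that(1)] by (simp add: openin_open_eq)
    then have "openin (top_of_set (c1 ` D1)) (c1 ` S)"
      by (rule homeomorphism_imp_open_map[OF chart(3)[OF that(1)]])
    then show ?thesis
      using chart(2)[OF that(1)] by (simp add: openin_open_eq)
  qed
  obtain U f C s t u v where U: "open U" "c p \<in> U" "U \<subseteq> c ` D" and f: "orthonormal52 f"
    and st: "smooth_on U s" "smooth_on U t" "smooth_on U u" "smooth_on U v"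
    and sI: "\<And>q. q \<in> U \<Longrightarrow> s q \<in> I"
    and y: "\<And>q. q \<in> U \<Longrightarrow> ?y q = C + frame_combination f (L (s q) (t q) (u q) (v q))"
    using cc unfolding chart_congruent_def by blast
  define \<Phi> :: "real^4 \<Rightarrow> real^4" where
    "\<Phi> = (\<lambda>q. \<chi> i. if i = 1 then s q else if i = 2 then t q else if i = 3 then u q else v q)"
  have \<Phi>n: "\<Phi> q $ 1 = s q" "\<Phi> q $ 2 = t q" "\<Phi> q $ 3 = u q" "\<Phi> q $ 4 = v q" for q
    by (simp_all add: \<Phi>_def)
  have s\<Phi>: "smooth_on U \<Phi>"
    unfolding \<Phi>_def
  proof (rule smooth_on_vec_lambda[OF U(1)])
    show "smooth_on U (\<lambda>q. if i = 1 then s q else if i = 2 then t q else if i = 3 then u q else v q)" for i :: 4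
      using st by (cases "i = 1"; cases "i = 2"; cases "i = 3") simp_all
  qed
  define F where "F = (\<lambda>z. C + frame_combination f z)"
  define L' where "L' = (\<lambda>w::real^4. L (w $ 1) (w $ 2) (w $ 3) (w $ 4))"
  have yF: "?y q = F (L' (\<Phi> q))" if "q \<in> U" for q
    unfolding F_def L'_def \<Phi>n by (rule y[OF that])
  have inj\<Phi>: "inj (frechet_derivative \<Phi> (at q))" if q: "q \<in> U" for q
  proof -
    have D\<Phi>: "(\<Phi> has_derivative frechet_derivative \<Phi> (at q)) (at q)"
      by (rule smooth_on_has_derivative[OF s\<Phi> U(1) q])
    have bl: "bounded_linear (frame_combination f)"
      using linear_frame_combination by (simp add: linear_conv_bounded_linear)
    have "L' differentiable at (\<Phi> q)"
      unfolding L'_def using L[of "\<Phi> q"] by (simp add: \<Phi>n sI[OF q])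
    then obtain DL where DL: "(L' has_derivative DL) (at (\<Phi> q))"
      by (auto simp: differentiable_def)
    have "((\<lambda>q. F (L' (\<Phi> q))) has_derivative (\<lambda>h. frame_combination f (DL (frechet_derivative \<Phi> (at q) h)))) (at q)"
      unfolding F_def
      using bounded_linear.has_derivative[OF bl has_derivative_compose[OF D\<Phi> DL]]
      by (auto intro!: derivative_eq_intros)
    then have "(?y has_derivative (\<lambda>h. frame_combination f (DL (frechet_derivative \<Phi> (at q) h)))) (at q)"
      by (rule has_derivative_transform_within_open[OF _ U(1) q]) (simp add: yF[symmetric])
    then have eq: "frechet_derivative ?y (at q) = (\<lambda>h. frame_combination f (DL (frechet_derivative \<Phi> (at q) h)))"
      by (rule frechet_derivative_at[symmetric])
    have "inj (frechet_derivative ?y (at q))"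
      using im q U(3) by (auto simp: immersion_index2_def)
    then show ?thesis
      by (simp add: eq inj_def)
  qed
  obtain U' W g where U': "open U'" "U' \<subseteq> U" "c p \<in> U'" and W: "open W"
    and hom: "homeomorphism U' W \<Phi> g" and g: "smooth_on W g"
    by (rule smooth_local_inverse[OF U(1) s\<Phi> U(2) inj\<Phi>])
  have gU: "g w \<in> U'" "\<Phi> (g w) = w" if "w \<in> W" for w
    using hom that by (auto simp: homeomorphism_def)
  have \<Phi>W: "\<Phi> q \<in> W" "g (\<Phi> q) = q" if "q \<in> U'" for q
    using hom that by (auto simp: homeomorphism_def)
  have U'D: "U' \<subseteq> c ` D" using U' U by blast
  define V where "V = ?i ` U'"
  define h where "h = ?i \<circ> g"
  define h' where "h' = \<Phi> \<circ> c"
  have ic: "?i (c a) = a" if "a \<in> D" for a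
    using D(3) that by (simp add: homeomorphism_def)
  have ci: "c (?i q) = q" "?i q \<in> D" if "q \<in> c ` D" for q
    using D(3) that by (auto simp: homeomorphism_def)
  have VD: "V \<subseteq> D" using ci U'D by (auto simp: V_def)
  have "(\<lambda>q. c (?i q)) ` U' = (\<lambda>q. q) ` U'"
    by (rule image_cong) (use ci U'D in auto)
  then have cV: "c ` V = U'" by (simp add: V_def image_image)
  have "V = D \<inter> c -` U'"
  proof (intro equalityI subsetI)
    fix a assume "a \<in> V"
    then show "a \<in> D \<inter> c -` U'" using VD cV by auto
  next
    fix a assume "a \<in> D \<inter> c -` U'"
    then show "a \<in> V"
      unfolding V_def by (intro image_eqI[of _ _ "c a"]) (auto simp: ic)
  qed
  then have oV: "open V"
    using continuous_open_preimage[OF homeomorphism_cont1[OF D(3)] D(1) U'(1)] by simp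
  have pV: "p \<in> V"
    unfolding V_def by (intro image_eqI[of _ _ "c p"]) (simp_all add: U'(3) p ic)
  have homV: "homeomorphism W V h h'"
    unfolding h_def h'_def
  proof (rule homeomorphism_compose[OF homeomorphism_symD[OF hom]])
    show "homeomorphism U' V ?i c"
      by (rule homeomorphism_of_subsets[OF homeomorphism_symD[OF D(3)] U'D VD V_def[symmetric]])
  qed
  have hW: "h w \<in> V" if "w \<in> W" for w
    using homV that by (auto simp: homeomorphism_def)
  have diffeo: "diffeo_onto_open A W V h"
    unfolding diffeo_onto_open_def
  proof (intro exI[of _ h'] conjI homV ballI, safe)
    fix D1 c1 assume c1: "(D1, c1) \<in> A"
    have "W \<inter> h -` D1 = {w \<in> W. h w \<in> D1}" by auto
    then have oW: "open {w \<in> W. h w \<in> D1}"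
      using continuous_open_preimage[OF homeomorphism_cont1[OF homV] W chart(1)[OF c1]] by simp
    have "smooth_on {w \<in> W. h w \<in> D1} (\<lambda>w. (c1 \<circ> ?i) (g w))"
    proof (rule smooth_on_compose[OF oW _ trans[OF ch c1]])
      show "open (c ` (D \<inter> D1))"
        by (rule open_image[OF ch]) (use D(1) chart(1)[OF c1] in auto)
      show "smooth_on {w \<in> W. h w \<in> D1} g"
        by (rule smooth_on_subset[OF g]) auto
      show "g ` {w \<in> W. h w \<in> D1} \<subseteq> c ` (D \<inter> D1)"
      proof clarify
        fix w assume "w \<in> W" "h w \<in> D1"
        then show "g w \<in> c ` (D \<inter> D1)"
          using gU(1)[of w] U'D ci[of "g w"] by (intro image_eqI[of _ _ "?i (g w)"]) (auto simp: h_def)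
      qed
    qed
    then show "smooth_on {w \<in> W. h w \<in> D1} (c1 \<circ> h)"
      by (simp add: h_def comp_def)
    have oV1: "open (c1 ` (V \<inter> D1))"
      by (rule open_image[OF c1]) (use oV chart(1)[OF c1] in auto)
    have i1: "inv_into D1 c1 (c1 a) = a" if "a \<in> D1" for a
      using chart(3)[OF c1] that by (simp add: homeomorphism_def)
    have "smooth_on (c1 ` (V \<inter> D1)) (\<lambda>z. \<Phi> ((c \<circ> inv_into D1 c1) z))"
    proof (rule smooth_on_compose[where f = \<Phi> and g = "c \<circ> inv_into D1 c1", OF oV1 U'(1)])
      show "smooth_on U' \<Phi>" by (rule smooth_on_subset[OF s\<Phi> U'(2)])
      show "smooth_on (c1 ` (V \<inter> D1)) (c \<circ> inv_into D1 c1)"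
        by (rule smooth_on_subset[OF trans[OF c1 ch]]) (use VD in auto)
      show "(c \<circ> inv_into D1 c1) ` (c1 ` (V \<inter> D1)) \<subseteq> U'"
        using i1 cV by auto
    qed
    then show "smooth_on (c1 ` (V \<inter> D1)) (h' \<circ> inv_into D1 c1)"
      by (simp add: h'_def comp_def)
  qed
  have WI: "w $ 1 \<in> I" if "w \<in> W" for w
    using gU[OF that] U'(2) sI[of "g w"] \<Phi>n(1)[of "g w"] by auto
  have "x (h w) = F (L (w $ 1) (w $ 2) (w $ 3) (w $ 4))" if "w \<in> W" for w
    using yF[of "g w"] gU[OF that] U'(2) by (auto simp: h_def L'_def)
  moreover have "isometry52 F"
    unfolding F_def by (rule isometry52_frame_combination[OF f])
  ultimately show ?thesis
    unfolding locally_congruent_def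
    using oV pV VD D(4) W WI diffeo by blast
qed

section \<open>Angular coordinates on the unit quadrics\<close>

lemma open_inter_preimage_real:
  fixes f :: "'a::real_normed_vector \<Rightarrow> real"
  assumes "open U" "smooth_on U f"
  shows "open {q \<in> U. f q > 0}"
proof -
  have "{q \<in> U. f q > 0} = U \<inter> f -` {0<..}" by auto
  then show ?thesis
    using continuous_open_preimage[OF smooth_on_continuous[OF assms(2)] assms(1) open_greaterThan] by simp
qed

text \<open>Polar coordinates restricted to the right half plane, where \<open>arctan\<close> gives
  the angle and is smooth.\<close>

lemma polar_angle:
  assumes "b > (0::real)"
  shows "sqrt (b\<^sup>2 + c\<^sup>2) * cos (arctan (c / b)) = b" and "sqrt (b\<^sup>2 + c\<^sup>2) * sin (arctan (c / b)) = c"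
proof -
  have "1 + (c / b)\<^sup>2 = (b\<^sup>2 + c\<^sup>2) / b\<^sup>2"
    using assms by (simp add: field_simps)
  then have s: "sqrt (1 + (c / b)\<^sup>2) = sqrt (b\<^sup>2 + c\<^sup>2) / b"
    using assms by (simp add: real_sqrt_divide)
  have p: "sqrt (b\<^sup>2 + c\<^sup>2) > 0"
    using assms by (simp add: add_pos_nonneg)
  show "sqrt (b\<^sup>2 + c\<^sup>2) * cos (arctan (c / b)) = b" "sqrt (b\<^sup>2 + c\<^sup>2) * sin (arctan (c / b)) = c"
    unfolding cos_arctan sin_arctan s using assms p by (simp_all add: field_simps)
qed

text \<open>Upper sheet of the two-sheeted hyperboloid. Positivity of \<open>b\<close> also excludes
  the pole t = 0, where the square root below would fail to be smooth.\<close>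

lemma elliptic_angles:
  fixes a b c :: "'a::real_normed_vector \<Rightarrow> real"
  assumes U: "open U" "smooth_on U a" "smooth_on U b" "smooth_on U c"
    and rel: "\<And>q. q \<in> U \<Longrightarrow> (a q)\<^sup>2 - (b q)\<^sup>2 - (c q)\<^sup>2 = 1" and pos: "\<And>q. q \<in> U \<Longrightarrow> a q > 0 \<and> b q > 0"
  shows "\<exists>t u. smooth_on U t \<and> smooth_on U u \<and>
    (\<forall>q\<in>U. a q = cosh (t q) \<and> b q = sinh (t q) * cos (u q) \<and> c q = sinh (t q) * sin (u q))"
proof (intro exI conjI ballI)
  let ?t = "\<lambda>q. arsinh (sqrt ((b q)\<^sup>2 + (c q)\<^sup>2))" and ?u = "\<lambda>q. arctan (c q / b q)"
  have p: "(b q)\<^sup>2 + (c q)\<^sup>2 > 0" "b q \<noteq> 0" if "q \<in> U" for q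
    using pos[OF that] by (auto simp: add_pos_nonneg)
  show "smooth_on U ?t" "smooth_on U ?u"
    by (intro smooth_intros U p; assumption)+
  fix q assume q: "q \<in> U"
  have "sqrt ((b q)\<^sup>2 + (c q)\<^sup>2 + 1) = a q"
    using rel[OF q] pos[OF q] by (intro real_sqrt_unique) auto
  then show "a q = cosh (?t q)"
    by (simp add: cosh_arsinh_real)
  show "b q = sinh (?t q) * cos (?u q)" "c q = sinh (?t q) * sin (?u q)"
    using polar_angle[of "b q" "c q"] pos[OF q] by simp_all
qed

text \<open>The unit sphere with \<open>t\<close> the angle from the \<open>a\<close>-axis; writing
  it with \<open>arctan\<close> of \<open>a\<close> over the distance to that axis keeps it smooth
  where \<open>b\<close> is positive.\<close>

lemma spherical_angles:
  fixes a b c :: "'a::real_normed_vector \<Rightarrow> real"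
  assumes U: "open U" "smooth_on U a" "smooth_on U b" "smooth_on U c"
    and rel: "\<And>q. q \<in> U \<Longrightarrow> (a q)\<^sup>2 + (b q)\<^sup>2 + (c q)\<^sup>2 = 1" and pos: "\<And>q. q \<in> U \<Longrightarrow> b q > 0"
  shows "\<exists>t u. smooth_on U t \<and> smooth_on U u \<and>
    (\<forall>q\<in>U. a q = cos (t q) \<and> b q = sin (t q) * cos (u q) \<and> c q = sin (t q) * sin (u q))"
proof (intro exI conjI ballI)
  let ?r = "\<lambda>q. sqrt ((b q)\<^sup>2 + (c q)\<^sup>2)"
  let ?t = "\<lambda>q. pi / 2 - arctan (a q / ?r q)" and ?u = "\<lambda>q. arctan (c q / b q)"
  have p: "(b q)\<^sup>2 + (c q)\<^sup>2 > 0" "b q \<noteq> 0" "?r q \<noteq> 0" if "q \<in> U" for q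
    using pos[OF that] by (auto simp: add_pos_nonneg add_nonneg_eq_0_iff)
  show "smooth_on U ?t" "smooth_on U ?u"
    by (intro smooth_intros U p; assumption)+
  fix q assume q: "q \<in> U"
  have r: "?r q > 0" using p(1)[OF q] by simp
  have one: "sqrt ((?r q)\<^sup>2 + (a q)\<^sup>2) = 1"
    using rel[OF q] p(1)[OF q] by (simp add: algebra_simps)
  have "cos (?t q) = a q" "sin (?t q) = ?r q"
    using polar_angle[OF r, of "a q"] unfolding one by (simp_all add: cos_diff sin_diff)
  then show "a q = cos (?t q)" "b q = sin (?t q) * cos (?u q)" "c q = sin (?t q) * sin (?u q)"
    using polar_angle[of "b q" "c q"] pos[OF q] by simp_all
qed

text \<open>The one-sheeted hyperboloid has no pole: \<open>t\<close> is the \<open>arsinh\<close>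
  of \<open>a\<close> throughout, and positivity of \<open>b\<close> is a condition for the angle
  \<open>u\<close> only.\<close>

lemma hyperbolic_angles:
  fixes a b c :: "'a::real_normed_vector \<Rightarrow> real"
  assumes U: "open U" "smooth_on U a" "smooth_on U b" "smooth_on U c"
    and rel: "\<And>q. q \<in> U \<Longrightarrow> (b q)\<^sup>2 + (c q)\<^sup>2 - (a q)\<^sup>2 = 1" and pos: "\<And>q. q \<in> U \<Longrightarrow> b q > 0"
  shows "\<exists>t u. smooth_on U t \<and> smooth_on U u \<and>
    (\<forall>q\<in>U. a q = sinh (t q) \<and> b q = cosh (t q) * cos (u q) \<and> c q = cosh (t q) * sin (u q))"
proof (intro exI conjI ballI)
  let ?t = "\<lambda>q. arsinh (a q)" and ?u = "\<lambda>q. arctan (c q / b q)"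
  have p: "b q \<noteq> 0" if "q \<in> U" for q
    using pos[OF that] by auto
  show "smooth_on U ?t" "smooth_on U ?u"
    by (intro smooth_intros U p; assumption)+
  fix q assume q: "q \<in> U"
  show "a q = sinh (?t q)" by simp
  have "(a q)\<^sup>2 + 1 = (b q)\<^sup>2 + (c q)\<^sup>2"
    using rel[OF q] by simp
  then have "cosh (?t q) = sqrt ((b q)\<^sup>2 + (c q)\<^sup>2)"
    by (simp add: cosh_arsinh_real)
  then show "b q = cosh (?t q) * cos (?u q)" "c q = cosh (?t q) * sin (?u q)"
    using polar_angle[of "b q" "c q"] pos[OF q] by simp_all
qed

section \<open>Cylinders over surfaces of revolution\<close>

lemma open_interval_antiderivative:
  fixes g :: "real \<Rightarrow> real"
  assumes "a < b" "smooth_on {a<..<b} g"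
  obtains F where "smooth_on {a<..<b} F" "\<And>x. x \<in> {a<..<b} \<Longrightarrow> (F has_real_derivative g x) (at x)"
proof -
  have "isCont g x" if "x \<in> {a<..<b}" for x
    using smooth_on_continuous[OF assms(2)] that continuous_on_eq_continuous_at open_greaterThanLessThan by blast
  then obtain F where F: "\<forall>x. ereal a < x \<longrightarrow> x < ereal b \<longrightarrow> (F has_vector_derivative g x) (at x)"
    using einterval_antiderivative[of "ereal a" "ereal b" g] assms(1) by auto
  then have D: "(F has_real_derivative g x) (at x)" if "x \<in> {a<..<b}" for x
    using that by (simp add: has_real_derivative_iff_has_vector_derivative)
  show thesis
    by (rule that[OF smooth_on_real_derivI[OF open_greaterThanLessThan D assms(2)] D])
qed

text \<open>Solves \<rho>' = sqrt (c - \<epsilon> \<rho>^(-4/3)) by separation of variables: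
  \<open>S\<close> integrates the reciprocal of the right-hand side, is strictly increasing, and has
  inverse \<open>\<rho>\<close>. \<open>\<Psi>\<close> is the coefficient required by
  \<open>position_nonnull\<close>. The interval \<open>J\<close> is chosen so that the radicand
  stays positive.\<close>

lemma profile_curve:
  fixes c \<epsilon> r0 :: real
  assumes c: "c \<noteq> 0" and r0: "r0 > 0" and pos: "c - \<epsilon> * r0 powr (-4/3) > 0"
  obtains J I S \<rho> \<Psi> where "open J" "r0 \<in> J" "open I" "is_interval I"
    "smooth_on J S" "smooth_on I \<rho>" "smooth_on J \<Psi>"
    "\<And>x. x \<in> J \<Longrightarrow> S x \<in> I \<and> \<rho> (S x) = x"
    "\<And>s. s \<in> I \<Longrightarrow> \<rho> s \<in> J \<and> \<rho> s > 0 \<and> c - \<epsilon> * \<rho> s powr (-4/3) > 0"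
    "\<And>s. s \<in> I \<Longrightarrow> (\<rho> has_real_derivative sqrt (c - \<epsilon> * \<rho> s powr (-4/3))) (at s)"
    "\<And>x. x \<in> J \<Longrightarrow> (\<Psi> has_real_derivative \<epsilon> * x powr (-2/3) / (c * sqrt (c - \<epsilon> * x powr (-4/3)))) (at x)"
proof -
  define G where "G x = c - \<epsilon> * x powr (-4/3)" for x :: real
  have sG: "smooth_on {0<..} G"
    unfolding G_def by (intro smooth_intros) auto
  have "open {x \<in> {0<..}. G x > 0}"
    by (rule open_inter_preimage_real[OF open_greaterThan sG])
  moreover have "r0 \<in> {x \<in> {0<..}. G x > 0}"
    using r0 pos by (simp add: G_def)
  ultimately obtain d where d: "d > 0" "ball r0 d \<subseteq> {x \<in> {0<..}. G x > 0}"
    by (rule openE)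
  define J where "J = {r0 - d<..<r0 + d}"
  have Jp: "x > 0" "G x > 0" if "x \<in> J" for x
    using d(2) that unfolding J_def by (auto simp: subset_iff dist_real_def abs_less_iff)
  have oJ: "open J" and rJ: "r0 \<in> J" and ab: "r0 - d < r0 + d"
    using d(1) by (simp_all add: J_def)
  have sGJ: "smooth_on J (\<lambda>x. sqrt (G x))"
    using Jp by (intro smooth_intros oJ smooth_on_subset[OF sG]) auto
  have g0: "sqrt (G x) \<noteq> 0" if "x \<in> J" for x using Jp[OF that] by simp
  have s1: "smooth_on J (\<lambda>x. 1 / sqrt (G x))"
    by (intro smooth_on_divide smooth_on_const oJ sGJ g0)
  have s2: "smooth_on J (\<lambda>x. \<epsilon> * x powr (-2/3) / (c * sqrt (G x)))"
    using g0 c Jp by (intro smooth_on_divide smooth_on_mult smooth_on_const smooth_on_powr smooth_on_ident oJ sGJ) auto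
  obtain S where S: "smooth_on J S" "\<And>x. x \<in> J \<Longrightarrow> (S has_real_derivative 1 / sqrt (G x)) (at x)"
    using open_interval_antiderivative[OF ab s1[unfolded J_def]] unfolding J_def by blast
  obtain \<Psi> where \<Psi>: "smooth_on J \<Psi>" "\<And>x. x \<in> J \<Longrightarrow> (\<Psi> has_real_derivative \<epsilon> * x powr (-2/3) / (c * sqrt (G x))) (at x)"
    using open_interval_antiderivative[OF ab s2[unfolded J_def]] unfolding J_def by blast
  have mono: "S x < S z" if "x \<in> J" "z \<in> J" "x < z" for x z
  proof (rule DERIV_pos_imp_increasing[OF that(3)])
    fix w assume "x \<le> w" "w \<le> z"
    then have "w \<in> J" using that by (auto simp: J_def)
    then show "\<exists>y. DERIV S w :> y \<and> 0 < y"
      using S(2) Jp by (intro exI[of _ "1 / sqrt (G w)"]) auto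
  qed
  have inj: "inj_on S J"
    by (rule linorder_inj_onI) (use mono in force)+
  define I where "I = S ` J"
  define \<rho> where "\<rho> = inv_into J S"
  have \<rho>S: "\<rho> (S x) = x" if "x \<in> J" for x
    using inj that by (simp add: \<rho>_def)
  have S\<rho>: "\<rho> s \<in> J" "S (\<rho> s) = s" if "s \<in> I" for s
    using that \<rho>S by (auto simp: I_def)
  have cS: "continuous_on J S" by (rule smooth_on_continuous[OF S(1)])
  have oI: "open I"
    unfolding I_def by (rule invariance_of_domain[OF cS oJ inj])
  have iI: "is_interval I"
    unfolding I_def is_interval_connected_1
    by (rule connected_continuous_image[OF cS]) (simp add: J_def)
  have c\<rho>: "continuous_on I \<rho>"
    unfolding I_def by (rule continuous_on_inverse_open[OF oJ cS _ \<rho>S]) simp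
  have D\<rho>: "(\<rho> has_real_derivative sqrt (G (\<rho> s))) (at s)" if s: "s \<in> I" for s
  proof -
    obtain e where e: "e > 0" "ball s e \<subseteq> I"
      using oI s by (rule openE)
    have "DERIV \<rho> s :> inverse (1 / sqrt (G (\<rho> s)))"
    proof (rule DERIV_inverse_function[where f = S and a = "s - e" and b = "s + e"])
      show "DERIV S (\<rho> s) :> 1 / sqrt (G (\<rho> s))" by (rule S(2)[OF S\<rho>(1)[OF s]])
      show "S (\<rho> z) = z" if "s - e < z" "z < s + e" for z
        using e(2) that by (intro S\<rho>) (auto simp: subset_iff dist_real_def abs_less_iff)
      show "isCont \<rho> s" using c\<rho> oI s continuous_on_eq_continuous_at by blast
    qed (use e(1) g0[OF S\<rho>(1)[OF s]] in auto)
    then show ?thesis by simp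
  qed
  \<comment> \<open>By the differential equation the derivative of \<open>\<rho>\<close> is a smooth
    function of \<open>\<rho>\<close>, so each order of regularity gives the next.\<close>
  have "Ck_on k I \<rho>" for k
  proof (induction k)
    case 0
    show ?case using c\<rho> by simp
  next
    case (Suc k)
    have "Ck_on k I (\<lambda>s. sqrt (G (\<rho> s)))"
      using sGJ S\<rho>(1) by (intro Ck_on_compose[OF oI oJ _ Suc]) (auto simp: smooth_on_def)
    from Ck_on_real_derivI[OF oI D\<rho> this] show ?case .
  qed
  then have s\<rho>: "smooth_on I \<rho>" by (simp add: smooth_on_def)
  show thesis
  proof (rule that[OF oJ rJ oI iI S(1) s\<rho> \<Psi>(1)])
    show "S x \<in> I \<and> \<rho> (S x) = x" if "x \<in> J" for x
      using \<rho>S that by (auto simp: I_def)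
    show "\<rho> s \<in> J \<and> \<rho> s > 0 \<and> c - \<epsilon> * \<rho> s powr (-4/3) > 0" if "s \<in> I" for s
      using S\<rho>(1)[OF that] Jp[OF S\<rho>(1)[OF that]] by (simp add: G_def)
  qed (use D\<rho> \<Psi>(2) in \<open>auto simp: G_def\<close>)
qed

text \<open>The square is written with the signed coefficients of the expansion, because these are
  the quantities to which the angle lemmas apply.\<close>

lemma orthonormal52_expansion:
  assumes "orthonormal52 f"
  shows "X = (\<Sum>i\<in>UNIV. (signature52 i * ip52 X (f i)) *\<^sub>R f i)"
    and "ip52 X X = (\<Sum>i\<in>UNIV. signature52 i * (signature52 i * ip52 X (f i))\<^sup>2)"
proof -
  have d: "ip52 X (f i) / signature52 i = signature52 i * ip52 X (f i)" for i
    by (simp add: signature52_def)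
  have "X = (\<Sum>i\<in>UNIV. (ip52 X (f i) / signature52 i) *\<^sub>R f i)"
    by (rule ip52_orthogonal_expansion[OF assms[unfolded orthonormal52_def, rule_format]])
      (simp add: signature52_def)
  then show e: "X = (\<Sum>i\<in>UNIV. (signature52 i * ip52 X (f i)) *\<^sub>R f i)"
    by (simp only: d)
  have "ip52 X X = ip52 X (\<Sum>i\<in>UNIV. (signature52 i * ip52 X (f i)) *\<^sub>R f i)"
    using arg_cong[OF e, of "ip52 X"] .
  also have "\<dots> = (\<Sum>i\<in>UNIV. signature52 i * (ip52 X (f i))\<^sup>2)"
    by (simp add: ip52_sum_right ip52_simps power2_eq_square mult_ac)
  also have "\<dots> = (\<Sum>i\<in>UNIV. signature52 i * (signature52 i * ip52 X (f i))\<^sup>2)"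
    by (rule sum.cong[OF refl]) (simp add: signature52_def)
  finally show "ip52 X X = (\<Sum>i\<in>UNIV. signature52 i * (signature52 i * ip52 X (f i))\<^sup>2)" .
qed

section \<open>Orthonormal frames and the six cylinders with non-null axis\<close>

definition frame52 :: "real^5 \<Rightarrow> real^5 \<Rightarrow> real^5 \<Rightarrow> real^5 \<Rightarrow> real^5 \<Rightarrow> 5 \<Rightarrow> real^5" where
  "frame52 a b c d e i = (if i = 1 then a else if i = 2 then b else if i = 3 then c else if i = 4 then d else e)"

lemma frame52_simps [simp]:
  "frame52 a b c d e 1 = a" "frame52 a b c d e 2 = b" "frame52 a b c d e 3 = c"
  "frame52 a b c d e 4 = d" "frame52 a b c d e 5 = e"
  by (simp_all add: frame52_def)

lemma signature52_simps [simp]: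
  "signature52 1 = -1" "signature52 2 = -1" "signature52 3 = 1" "signature52 4 = 1" "signature52 5 = 1"
  by (simp_all add: signature52_def)

lemma ip52_zero_commute: "ip52 a b = 0 \<Longrightarrow> ip52 b a = 0"
  by (simp add: ip52_commute)

lemma orthonormal52_frame52:
  assumes "ip52 a a = -1" "ip52 b b = -1" "ip52 c c = 1" "ip52 d d = 1" "ip52 e e = 1"
    and "ip52 a b = 0" "ip52 a c = 0" "ip52 a d = 0" "ip52 a e = 0" "ip52 b c = 0"
    and "ip52 b d = 0" "ip52 b e = 0" "ip52 c d = 0" "ip52 c e = 0" "ip52 d e = 0"
  shows "orthonormal52 (frame52 a b c d e)"
  unfolding orthonormal52_def forall_5
  using assms assms(6-15)[THEN ip52_zero_commute] by simp

text \<open>Common form of cylinders (i) to (vi): ruling \<open>V\<close>, axis \<open>W\<close>,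
  and a radius vector \<open>p\<close> of constant square orthogonal to both. \<open>B\<close> and
  \<open>B'\<close> complete \<open>V\<close>, \<open>W\<close> and the radius at \<open>q0\<close>
  to an orthogonal system.\<close>

locale revolution =
  fixes U :: "(real^4) set" and y :: "real^4 \<Rightarrow> real^5" and q0 :: "real^4" and I :: "real set"
    and \<phi> \<psi> :: "real \<Rightarrow> real" and C V W B B' :: "real^5" and p :: "real^4 \<Rightarrow> real^5" and h s :: "real^4 \<Rightarrow> real"
  assumes U: "open U" "q0 \<in> U" and sp: "smooth_on U p" and sh: "smooth_on U h" and ss: "smooth_on U s"
    and sI: "\<And>q. q \<in> U \<Longrightarrow> s q \<in> I"
    and y: "\<And>q. q \<in> U \<Longrightarrow> y q = C + h q *\<^sub>R V + \<psi> (s q) *\<^sub>R W + \<phi> (s q) *\<^sub>R p q"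
    and VW: "ip52 V W = 0" and VB: "ip52 V B = 0" "ip52 V B' = 0" and WB: "ip52 W B = 0" "ip52 W B' = 0"
    and BB': "ip52 B B' = 0"
    and pV: "\<And>q. q \<in> U \<Longrightarrow> ip52 (p q) V = 0" and pW: "\<And>q. q \<in> U \<Longrightarrow> ip52 (p q) W = 0"
    and pp: "\<And>q. q \<in> U \<Longrightarrow> ip52 (p q) (p q) = ip52 (p q0) (p q0)"
    and pB: "ip52 (p q0) B = 0" "ip52 (p q0) B' = 0"
begin

lemmas ip0 = VW VB WB BB' pB pV[OF U(2)] pW[OF U(2)]
lemmas ip0' = ip0 ip0[THEN ip52_zero_commute]

text \<open>Positivity of two coordinates of the radius vector spreads from \<open>q0\<close> to a
  neighbourhood, on which the angle lemmas apply. Quadrics that need one positive coordinate pass it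
  twice.\<close>

lemma chart_congruentI:
  fixes a b :: "real^4 \<Rightarrow> real"
  assumes f: "orthonormal52 f" and g: "smooth_on U a" "smooth_on U b"
    and pos: "a q0 > 0" "b q0 > 0"
    and angles: "\<And>A. open A \<Longrightarrow> A \<subseteq> U \<Longrightarrow> (\<And>q. q \<in> A \<Longrightarrow> a q > 0 \<and> b q > 0) \<Longrightarrow>
      \<exists>t u. smooth_on A t \<and> smooth_on A u \<and> (\<forall>q\<in>A. frame_combination f (L (s q) (t q) (u q) (h q)) =
        h q *\<^sub>R V + \<psi> (s q) *\<^sub>R W + \<phi> (s q) *\<^sub>R p q)"
  shows "chart_congruent U y q0 I L"
proof -
  define N where "N = {q \<in> {q \<in> U. a q > 0}. b q > 0}"
  have N: "N \<subseteq> U" "\<And>q. q \<in> N \<Longrightarrow> a q > 0 \<and> b q > 0" "q0 \<in> N"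
    using U pos by (auto simp: N_def)
  have oa: "open {q \<in> U. a q > 0}"
    by (rule open_inter_preimage_real[OF U(1) g(1)])
  have o: "open N"
    unfolding N_def by (rule open_inter_preimage_real[OF oa smooth_on_subset[OF g(2)]]) auto
  obtain t u where tu: "smooth_on N t" "smooth_on N u"
    "\<And>q. q \<in> N \<Longrightarrow> frame_combination f (L (s q) (t q) (u q) (h q)) = h q *\<^sub>R V + \<psi> (s q) *\<^sub>R W + \<phi> (s q) *\<^sub>R p q"
    using angles[OF o N(1,2)] by blast
  show ?thesis
    unfolding chart_congruent_def
  proof (rule exI[of _ N], rule exI[of _ f], rule exI[of _ C], rule exI[of _ s], rule exI[of _ t],
      rule exI[of _ u], rule exI[of _ h], intro conjI ballI o f tu(1,2))
    show "smooth_on N s" "smooth_on N h"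
      by (rule smooth_on_subset[OF ss N(1)], rule smooth_on_subset[OF sh N(1)])
    show "s q \<in> I" if "q \<in> N" for q using that sI N(1) by auto
    show "y q = C + frame_combination f (L (s q) (t q) (u q) (h q))" if "q \<in> N" for q
      using y[of q] that N(1) by (auto simp: tu(3) add.assoc)
  qed (use N in auto)
qed

lemma smooth_coefficient: "smooth_on U (\<lambda>q. d * ip52 (p q) X)"
  by (intro smooth_intros U sp)

text \<open>The factors \<open>d\<close>, \<open>d'\<close>, \<open>d''\<close> hold the signs of
  the frame vectors, which turn products with \<open>p\<close> into its coefficients.\<close>

lemma congruent_elliptic:
  assumes f: "orthonormal52 f" and abc: "a = (\<lambda>q. d * ip52 (p q) A)" "b = (\<lambda>q. d' * ip52 (p q) A')" "c = (\<lambda>q. d'' * ip52 (p q) A'')"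
    and rel: "\<And>q. q \<in> U \<Longrightarrow> (a q)\<^sup>2 - (b q)\<^sup>2 - (c q)\<^sup>2 = 1" and pos: "a q0 > 0" "b q0 > 0"
    and L: "\<And>q t u. q \<in> U \<Longrightarrow> a q = cosh t \<Longrightarrow> b q = sinh t * cos u \<Longrightarrow> c q = sinh t * sin u \<Longrightarrow>
      frame_combination f (L (s q) t u (h q)) = h q *\<^sub>R V + \<psi> (s q) *\<^sub>R W + \<phi> (s q) *\<^sub>R p q"
  shows "chart_congruent U y q0 I L"
proof -
  have sm: "smooth_on U a" "smooth_on U b" "smooth_on U c"
    unfolding abc by (rule smooth_coefficient)+
  show ?thesis
  proof (rule chart_congruentI[OF f sm(1,2) pos])
    fix N assume N: "open N" "N \<subseteq> U" "\<And>q. q \<in> N \<Longrightarrow> a q > 0 \<and> b q > 0"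
    obtain t u where "smooth_on N t" "smooth_on N u"
      "\<And>q. q \<in> N \<Longrightarrow> a q = cosh (t q) \<and> b q = sinh (t q) * cos (u q) \<and> c q = sinh (t q) * sin (u q)"
      using elliptic_angles[OF N(1) smooth_on_subset[OF sm(1) N(2)] smooth_on_subset[OF sm(2) N(2)]
          smooth_on_subset[OF sm(3) N(2)] rel N(3)] N(2) by blast
    then show "\<exists>t u. smooth_on N t \<and> smooth_on N u \<and> (\<forall>q\<in>N. frame_combination f (L (s q) (t q) (u q) (h q)) =
        h q *\<^sub>R V + \<psi> (s q) *\<^sub>R W + \<phi> (s q) *\<^sub>R p q)"
      using L N(2) by (intro exI[of _ t] exI[of _ u]) (auto simp: subset_iff)
  qed
qed

lemma congruent_spherical:
  assumes f: "orthonormal52 f" and abc: "a = (\<lambda>q. d * ip52 (p q) A)" "b = (\<lambda>q. d' * ip52 (p q) A')" "c = (\<lambda>q. d'' * ip52 (p q) A'')"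
    and rel: "\<And>q. q \<in> U \<Longrightarrow> (a q)\<^sup>2 + (b q)\<^sup>2 + (c q)\<^sup>2 = 1" and pos: "b q0 > 0"
    and L: "\<And>q t u. q \<in> U \<Longrightarrow> a q = cos t \<Longrightarrow> b q = sin t * cos u \<Longrightarrow> c q = sin t * sin u \<Longrightarrow>
      frame_combination f (L (s q) t u (h q)) = h q *\<^sub>R V + \<psi> (s q) *\<^sub>R W + \<phi> (s q) *\<^sub>R p q"
  shows "chart_congruent U y q0 I L"
proof -
  have sm: "smooth_on U a" "smooth_on U b" "smooth_on U c"
    unfolding abc by (rule smooth_coefficient)+
  show ?thesis
  proof (rule chart_congruentI[OF f sm(2,2) pos pos])
    fix N assume N: "open N" "N \<subseteq> U" "\<And>q. q \<in> N \<Longrightarrow> b q > 0 \<and> b q > 0"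
    obtain t u where "smooth_on N t" "smooth_on N u"
      "\<And>q. q \<in> N \<Longrightarrow> a q = cos (t q) \<and> b q = sin (t q) * cos (u q) \<and> c q = sin (t q) * sin (u q)"
      using spherical_angles[OF N(1) smooth_on_subset[OF sm(1) N(2)] smooth_on_subset[OF sm(2) N(2)]
          smooth_on_subset[OF sm(3) N(2)] rel N(3)[THEN conjunct1]] N(2) by blast
    then show "\<exists>t u. smooth_on N t \<and> smooth_on N u \<and> (\<forall>q\<in>N. frame_combination f (L (s q) (t q) (u q) (h q)) =
        h q *\<^sub>R V + \<psi> (s q) *\<^sub>R W + \<phi> (s q) *\<^sub>R p q)"
      using L N(2) by (intro exI[of _ t] exI[of _ u]) (auto simp: subset_iff)
  qed
qed

lemma congruent_hyperbolic:
  assumes f: "orthonormal52 f" and abc: "a = (\<lambda>q. d * ip52 (p q) A)" "b = (\<lambda>q. d' * ip52 (p q) A')" "c = (\<lambda>q. d'' * ip52 (p q) A'')"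
    and rel: "\<And>q. q \<in> U \<Longrightarrow> (b q)\<^sup>2 + (c q)\<^sup>2 - (a q)\<^sup>2 = 1" and pos: "b q0 > 0"
    and L: "\<And>q t u. q \<in> U \<Longrightarrow> a q = sinh t \<Longrightarrow> b q = cosh t * cos u \<Longrightarrow> c q = cosh t * sin u \<Longrightarrow>
      frame_combination f (L (s q) t u (h q)) = h q *\<^sub>R V + \<psi> (s q) *\<^sub>R W + \<phi> (s q) *\<^sub>R p q"
  shows "chart_congruent U y q0 I L"
proof -
  have sm: "smooth_on U a" "smooth_on U b" "smooth_on U c"
    unfolding abc by (rule smooth_coefficient)+
  show ?thesis
  proof (rule chart_congruentI[OF f sm(2,2) pos pos])
    fix N assume N: "open N" "N \<subseteq> U" "\<And>q. q \<in> N \<Longrightarrow> b q > 0 \<and> b q > 0"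
    obtain t u where "smooth_on N t" "smooth_on N u"
      "\<And>q. q \<in> N \<Longrightarrow> a q = sinh (t q) \<and> b q = cosh (t q) * cos (u q) \<and> c q = cosh (t q) * sin (u q)"
      using hyperbolic_angles[OF N(1) smooth_on_subset[OF sm(1) N(2)] smooth_on_subset[OF sm(2) N(2)]
          smooth_on_subset[OF sm(3) N(2)] rel N(3)[THEN conjunct1]] N(2) by blast
    then show "\<exists>t u. smooth_on N t \<and> smooth_on N u \<and> (\<forall>q\<in>N. frame_combination f (L (s q) (t q) (u q) (h q)) =
        h q *\<^sub>R V + \<psi> (s q) *\<^sub>R W + \<phi> (s q) *\<^sub>R p q)"
      using L N(2) by (intro exI[of _ t] exI[of _ u]) (auto simp: subset_iff)
  qed
qed

lemma congruent_cyl1: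
  assumes n: "ip52 V V = -1" "ip52 W W = 1" "ip52 (p q0) (p q0) = -1" "ip52 B B = 1" "ip52 B' B' = 1"
  shows "chart_congruent U y q0 I (cyl1 \<phi> \<psi>)"
proof -
  \<comment> \<open>The parametrization is singular at \<open>t = 0\<close>; the boosted frame puts \<open>q0\<close> at \<open>t = 1\<close>, \<open>u = 0\<close>.\<close>
  define X where "X = cosh 1 *\<^sub>R p q0 - sinh 1 *\<^sub>R B"
  define Y where "Y = cosh 1 *\<^sub>R B - sinh 1 *\<^sub>R p q0"
  have cs: "cosh 1 * cosh 1 = sinh 1 * sinh 1 + (1::real)"
    using cosh_square_eq[of "1::real"] by (simp add: power2_eq_square)
  have f: "orthonormal52 (frame52 V X Y B' W)"
    by (rule orthonormal52_frame52) (simp_all add: X_def Y_def ip52_simps ip0' n cs)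
  show ?thesis
  proof (rule congruent_elliptic[OF f refl refl refl, of "-1" X 1 Y 1 B'])
    fix q assume q: "q \<in> U"
    show "(- 1 * ip52 (p q) X)\<^sup>2 - (1 * ip52 (p q) Y)\<^sup>2 - (1 * ip52 (p q) B')\<^sup>2 = 1"
      using orthonormal52_expansion(2)[OF f, of "p q", symmetric] by (simp add: sum_5 pV[OF q] pW[OF q] pp[OF q] n(3))
    fix t u assume "- 1 * ip52 (p q) X = cosh t" "1 * ip52 (p q) Y = sinh t * cos u" "1 * ip52 (p q) B' = sinh t * sin u"
    then have p: "p q = cosh t *\<^sub>R X + (sinh t * cos u) *\<^sub>R Y + (sinh t * sin u) *\<^sub>R B'"
      using orthonormal52_expansion(1)[OF f, of "p q"] by (simp add: sum_5 pV[OF q] pW[OF q])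
    show "frame_combination (frame52 V X Y B' W) (cyl1 \<phi> \<psi> (s q) t u (h q)) = h q *\<^sub>R V + \<psi> (s q) *\<^sub>R W + \<phi> (s q) *\<^sub>R p q"
      unfolding p by (simp add: frame_combination_def sum_5 cyl1_def algebra_simps)
  qed (simp_all add: X_def Y_def ip52_simps ip0' n)
qed

lemma congruent_cyl2:
  assumes n: "ip52 V V = -1" "ip52 W W = -1" "ip52 (p q0) (p q0) = 1" "ip52 B B = 1" "ip52 B' B' = 1"
  shows "chart_congruent U y q0 I (cyl2 \<phi> \<psi>)"
proof -
  \<comment> \<open>The slot of \<open>p q0\<close> is that of sin t cos u, so \<open>q0\<close>
    lies at t = pi/2, u = 0, away from the poles of the sphere.\<close>
  have f: "orthonormal52 (frame52 V W B (p q0) B')"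
    by (rule orthonormal52_frame52) (simp_all add: ip0' n)
  show ?thesis
  proof (rule congruent_spherical[OF f refl refl refl, of 1 B 1 "p q0" 1 B'])
    fix q assume q: "q \<in> U"
    show "(1 * ip52 (p q) B)\<^sup>2 + (1 * ip52 (p q) (p q0))\<^sup>2 + (1 * ip52 (p q) B')\<^sup>2 = 1"
      using orthonormal52_expansion(2)[OF f, of "p q", symmetric] by (simp add: sum_5 pV[OF q] pW[OF q] pp[OF q] n(3))
    fix t u assume "1 * ip52 (p q) B = cos t" "1 * ip52 (p q) (p q0) = sin t * cos u" "1 * ip52 (p q) B' = sin t * sin u"
    then have p: "p q = cos t *\<^sub>R B + (sin t * cos u) *\<^sub>R p q0 + (sin t * sin u) *\<^sub>R B'"
      using orthonormal52_expansion(1)[OF f, of "p q"] by (simp add: sum_5 pV[OF q] pW[OF q])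
    show "frame_combination (frame52 V W B (p q0) B') (cyl2 \<phi> \<psi> (s q) t u (h q)) = h q *\<^sub>R V + \<psi> (s q) *\<^sub>R W + \<phi> (s q) *\<^sub>R p q"
      unfolding p by (simp add: frame_combination_def sum_5 cyl2_def algebra_simps)
  qed (simp_all add: n)
qed

lemma congruent_cyl3:
  assumes n: "ip52 V V = 1" "ip52 W W = 1" "ip52 (p q0) (p q0) = -1" "ip52 B B = -1" "ip52 B' B' = 1"
  shows "chart_congruent U y q0 I (cyl3 \<phi> \<psi>)"
proof -
  \<comment> \<open>The slot of \<open>p q0\<close> is that of cosh t cos u, so \<open>q0\<close>
    lies at t = u = 0; the same choice is made for the next two cylinders.\<close>
  have f: "orthonormal52 (frame52 B (p q0) B' W V)"
    by (rule orthonormal52_frame52) (simp_all add: ip0' n)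
  show ?thesis
  proof (rule congruent_hyperbolic[OF f refl refl refl, of "-1" "p q0" "-1" B 1 B'])
    fix q assume q: "q \<in> U"
    show "(- 1 * ip52 (p q) (p q0))\<^sup>2 + (- 1 * ip52 (p q) B)\<^sup>2 - (1 * ip52 (p q) B')\<^sup>2 = 1"
      using orthonormal52_expansion(2)[OF f, of "p q", symmetric] by (simp add: sum_5 pV[OF q] pW[OF q] pp[OF q] n(3))
    fix t u assume "1 * ip52 (p q) B' = sinh t" "- 1 * ip52 (p q) (p q0) = cosh t * cos u" "- 1 * ip52 (p q) B = cosh t * sin u"
    then have p: "p q = (cosh t * sin u) *\<^sub>R B + (cosh t * cos u) *\<^sub>R p q0 + sinh t *\<^sub>R B'"
      using orthonormal52_expansion(1)[OF f, of "p q"] by (simp add: sum_5 pV[OF q] pW[OF q])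
    show "frame_combination (frame52 B (p q0) B' W V) (cyl3 \<phi> \<psi> (s q) t u (h q)) = h q *\<^sub>R V + \<psi> (s q) *\<^sub>R W + \<phi> (s q) *\<^sub>R p q"
      unfolding p by (simp add: frame_combination_def sum_5 cyl3_def algebra_simps)
  qed (simp_all add: n)
qed

lemma congruent_cyl4:
  assumes n: "ip52 V V = 1" "ip52 W W = -1" "ip52 (p q0) (p q0) = 1" "ip52 B B = -1" "ip52 B' B' = 1"
  shows "chart_congruent U y q0 I (cyl4 \<phi> \<psi>)"
proof -
  have f: "orthonormal52 (frame52 W B (p q0) B' V)"
    by (rule orthonormal52_frame52) (simp_all add: ip0' n)
  show ?thesis
  proof (rule congruent_hyperbolic[OF f refl refl refl, of 1 "p q0" 1 B' "-1" B])
    fix q assume q: "q \<in> U"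
    show "(1 * ip52 (p q) (p q0))\<^sup>2 + (1 * ip52 (p q) B')\<^sup>2 - (- 1 * ip52 (p q) B)\<^sup>2 = 1"
      using orthonormal52_expansion(2)[OF f, of "p q", symmetric] by (simp add: sum_5 pV[OF q] pW[OF q] pp[OF q] n(3))
    fix t u assume "- 1 * ip52 (p q) B = sinh t" "1 * ip52 (p q) (p q0) = cosh t * cos u" "1 * ip52 (p q) B' = cosh t * sin u"
    then have p: "p q = sinh t *\<^sub>R B + (cosh t * cos u) *\<^sub>R p q0 + (cosh t * sin u) *\<^sub>R B'"
      using orthonormal52_expansion(1)[OF f, of "p q"] by (simp add: sum_5 pV[OF q] pW[OF q])
    show "frame_combination (frame52 W B (p q0) B' V) (cyl4 \<phi> \<psi> (s q) t u (h q)) = h q *\<^sub>R V + \<psi> (s q) *\<^sub>R W + \<phi> (s q) *\<^sub>R p q"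
      unfolding p by (simp add: frame_combination_def sum_5 cyl4_def algebra_simps)
  qed (simp_all add: n)
qed

lemma congruent_cyl5:
  assumes n: "ip52 V V = -1" "ip52 W W = 1" "ip52 (p q0) (p q0) = 1" "ip52 B B = -1" "ip52 B' B' = 1"
  shows "chart_congruent U y q0 I (cyl5 \<phi> \<psi>)"
proof -
  have f: "orthonormal52 (frame52 V B (p q0) B' W)"
    by (rule orthonormal52_frame52) (simp_all add: ip0' n)
  show ?thesis
  proof (rule congruent_hyperbolic[OF f refl refl refl, of 1 "p q0" 1 B' "-1" B])
    fix q assume q: "q \<in> U"
    show "(1 * ip52 (p q) (p q0))\<^sup>2 + (1 * ip52 (p q) B')\<^sup>2 - (- 1 * ip52 (p q) B)\<^sup>2 = 1"
      using orthonormal52_expansion(2)[OF f, of "p q", symmetric] by (simp add: sum_5 pV[OF q] pW[OF q] pp[OF q] n(3))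
    fix t u assume "- 1 * ip52 (p q) B = sinh t" "1 * ip52 (p q) (p q0) = cosh t * cos u" "1 * ip52 (p q) B' = cosh t * sin u"
    then have p: "p q = sinh t *\<^sub>R B + (cosh t * cos u) *\<^sub>R p q0 + (cosh t * sin u) *\<^sub>R B'"
      using orthonormal52_expansion(1)[OF f, of "p q"] by (simp add: sum_5 pV[OF q] pW[OF q])
    show "frame_combination (frame52 V B (p q0) B' W) (cyl5 \<phi> \<psi> (s q) t u (h q)) = h q *\<^sub>R V + \<psi> (s q) *\<^sub>R W + \<phi> (s q) *\<^sub>R p q"
      unfolding p by (simp add: frame_combination_def sum_5 cyl5_def algebra_simps)
  qed (simp_all add: n)
qed

lemma congruent_cyl6:
  assumes n: "ip52 V V = 1" "ip52 W W = 1" "ip52 (p q0) (p q0) = 1" "ip52 B B = -1" "ip52 B' B' = -1"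
  shows "chart_congruent U y q0 I (cyl6 \<phi> \<psi>)"
proof -
  \<comment> \<open>As for \<open>cyl1\<close>, the boost in the plane of \<open>p q0\<close> and
    \<open>B\<close> moves \<open>q0\<close> off the pole, to t = 1 and u = 0.\<close>
  define X where "X = cosh 1 *\<^sub>R p q0 - sinh 1 *\<^sub>R B"
  define Y where "Y = cosh 1 *\<^sub>R B - sinh 1 *\<^sub>R p q0"
  have cs: "cosh 1 * cosh 1 = sinh 1 * sinh 1 + (1::real)"
    using cosh_square_eq[of "1::real"] by (simp add: power2_eq_square)
  have f: "orthonormal52 (frame52 Y B' X W V)"
    by (rule orthonormal52_frame52) (simp_all add: X_def Y_def ip52_simps ip0' n cs)
  show ?thesis
  proof (rule congruent_elliptic[OF f refl refl refl, of 1 X "-1" Y "-1" B'])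
    fix q assume q: "q \<in> U"
    show "(1 * ip52 (p q) X)\<^sup>2 - (- 1 * ip52 (p q) Y)\<^sup>2 - (- 1 * ip52 (p q) B')\<^sup>2 = 1"
      using orthonormal52_expansion(2)[OF f, of "p q", symmetric] by (simp add: sum_5 pV[OF q] pW[OF q] pp[OF q] n(3))
    fix t u assume "1 * ip52 (p q) X = cosh t" "- 1 * ip52 (p q) Y = sinh t * cos u" "- 1 * ip52 (p q) B' = sinh t * sin u"
    then have p: "p q = (sinh t * cos u) *\<^sub>R Y + (sinh t * sin u) *\<^sub>R B' + cosh t *\<^sub>R X"
      using orthonormal52_expansion(1)[OF f, of "p q"] by (simp add: sum_5 pV[OF q] pW[OF q])
    show "frame_combination (frame52 Y B' X W V) (cyl6 \<phi> \<psi> (s q) t u (h q)) = h q *\<^sub>R V + \<psi> (s q) *\<^sub>R W + \<phi> (s q) *\<^sub>R p q"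
      unfolding p by (simp add: frame_combination_def sum_5 cyl6_def algebra_simps)
  qed (simp_all add: X_def Y_def ip52_simps ip0' n)
qed

end

section \<open>Classification of charts\<close>

lemma chart_congruent_mono:
  "chart_congruent U1 y q0 I L \<Longrightarrow> U1 \<subseteq> U \<Longrightarrow> chart_congruent U y q0 I L"
  unfolding chart_congruent_def by (meson subset_trans)

text \<open>The disjunction of the theorem with the congruence relation as a parameter, so that
  shrinking charts and passing to \<open>M\<close> become instances of monotonicity.\<close>

definition cylinder_alternatives ::
  "(real set \<Rightarrow> (real \<Rightarrow> real \<Rightarrow> real \<Rightarrow> real \<Rightarrow> real^5) \<Rightarrow> bool) \<Rightarrow> bool" where
  "cylinder_alternatives Q \<longleftrightarrow> (\<exists>I \<phi> \<psi>. open I \<and> is_interval I \<and> smooth_on I \<phi> \<and> smooth_on I \<psi> \<and>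
     ((Q I (cyl1 \<phi> \<psi>) \<and> (\<forall>s\<in>I. (deriv \<phi> s)^2 - (deriv \<psi> s)^2 = 1)) \<or>
      (Q I (cyl2 \<phi> \<psi>) \<and> (\<forall>s\<in>I. (deriv \<phi> s)^2 - (deriv \<psi> s)^2 = -1)) \<or>
      (Q I (cyl3 \<phi> \<psi>) \<and> (\<forall>s\<in>I. (deriv \<phi> s)^2 - (deriv \<psi> s)^2 = 1)) \<or>
      (Q I (cyl4 \<phi> \<psi>) \<and> (\<forall>s\<in>I. (deriv \<phi> s)^2 - (deriv \<psi> s)^2 = -1)) \<or>
      (Q I (cyl5 \<phi> \<psi>) \<and> (\<forall>s\<in>I. (deriv \<phi> s)^2 + (deriv \<psi> s)^2 = 1)) \<or>
      (Q I (cyl6 \<phi> \<psi>) \<and> (\<forall>s\<in>I. (deriv \<phi> s)^2 + (deriv \<psi> s)^2 = 1)) \<or>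
      (Q I (cyl7 \<psi>) \<and> (\<forall>s\<in>I. 1 - 2 * deriv \<psi> s < 0)) \<or>
      (Q I (cyl8 \<psi>) \<and> (\<forall>s\<in>I. 1 + 2 * deriv \<psi> s < 0))))"

lemma differentiable_coordinatesI:
  fixes f :: "real^4 \<Rightarrow> real^5"
  assumes "\<And>i. (\<lambda>w. f w $ i) differentiable (at w)"
  shows "f differentiable (at w)"
proof -
  have "(\<lambda>w. \<Sum>i\<in>UNIV. f w $ i *\<^sub>R axis i (1::real)) differentiable (at w)"
  proof (intro differentiable_sum ballI)
    fix i :: 5
    show "(\<lambda>w. f w $ i *\<^sub>R axis i (1::real) :: real^5) differentiable (at w)"
      by (rule differentiable_compose[OF bounded_linear_imp_differentiable[OF bounded_linear_scaleR_left] assms])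
  qed simp
  moreover have "(\<lambda>w. \<Sum>i\<in>UNIV. f w $ i *\<^sub>R axis i (1::real)) = f"
    by (simp add: fun_eq_iff vec_eq_iff axis_def if_distrib cong: if_cong)
  ultimately show ?thesis by simp
qed

lemma differentiable_nth_compose:
  fixes g :: "real \<Rightarrow> real" and w :: "real^4"
  assumes "g differentiable (at (w $ i))"
  shows "(\<lambda>w. g (w $ i)) differentiable (at w)"
proof -
  have "(\<lambda>w::real^4. w $ i) differentiable (at w)"
    by (rule bounded_linear_imp_differentiable[OF bounded_linear_vec_nth])
  then show ?thesis using assms by (rule differentiable_compose[rotated])
qed

lemma cylinder_differentiable:
  fixes w :: "real^4"
  assumes I: "open I" "smooth_on I \<phi>" "smooth_on I \<psi>" "w $ 1 \<in> I"
  shows "(\<lambda>w. cyl1 \<phi> \<psi> (w $ 1) (w $ 2) (w $ 3) (w $ 4)) differentiable (at w)"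
    and "(\<lambda>w. cyl2 \<phi> \<psi> (w $ 1) (w $ 2) (w $ 3) (w $ 4)) differentiable (at w)"
    and "(\<lambda>w. cyl3 \<phi> \<psi> (w $ 1) (w $ 2) (w $ 3) (w $ 4)) differentiable (at w)"
    and "(\<lambda>w. cyl4 \<phi> \<psi> (w $ 1) (w $ 2) (w $ 3) (w $ 4)) differentiable (at w)"
    and "(\<lambda>w. cyl5 \<phi> \<psi> (w $ 1) (w $ 2) (w $ 3) (w $ 4)) differentiable (at w)"
    and "(\<lambda>w. cyl6 \<phi> \<psi> (w $ 1) (w $ 2) (w $ 3) (w $ 4)) differentiable (at w)"
    and "(\<lambda>w. cyl7 \<psi> (w $ 1) (w $ 2) (w $ 3) (w $ 4)) differentiable (at w)"
    and "(\<lambda>w. cyl8 \<psi> (w $ 1) (w $ 2) (w $ 3) (w $ 4)) differentiable (at w)"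
proof -
  have d: "(\<lambda>w. g (w $ i)) differentiable (at w)"
    if "\<And>x. (g has_real_derivative g' x) (at x)" for g g' :: "real \<Rightarrow> real" and i
    by (rule differentiable_nth_compose) (use that real_differentiable_def in blast)
  have c: "(\<lambda>w::real^4. w $ i) differentiable (at w)" for i
    by (rule bounded_linear_imp_differentiable[OF bounded_linear_vec_nth])
  have dh: "(sinh has_real_derivative cosh x) (at x)" "(cosh has_real_derivative sinh x) (at x)" for x :: real
    by (auto intro!: derivative_eq_intros)
  note D = differentiable_nth_compose[OF smooth_on_differentiable[OF I(2,1,4)]]
    differentiable_nth_compose[OF smooth_on_differentiable[OF I(3,1,4)]]
    d[OF DERIV_sin] d[OF DERIV_cos] c
    d[OF dh(1)] d[OF dh(2)]
  have half: "(\<lambda>w. g w / 2) differentiable (at w)" if "g differentiable (at w)" for g :: "real^4 \<Rightarrow> real"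
    using differentiable_mult[OF differentiable_const[of "1/2"] that] by simp
  show "(\<lambda>w. cyl1 \<phi> \<psi> (w $ 1) (w $ 2) (w $ 3) (w $ 4)) differentiable (at w)"
    "(\<lambda>w. cyl2 \<phi> \<psi> (w $ 1) (w $ 2) (w $ 3) (w $ 4)) differentiable (at w)"
    "(\<lambda>w. cyl3 \<phi> \<psi> (w $ 1) (w $ 2) (w $ 3) (w $ 4)) differentiable (at w)"
    "(\<lambda>w. cyl4 \<phi> \<psi> (w $ 1) (w $ 2) (w $ 3) (w $ 4)) differentiable (at w)"
    "(\<lambda>w. cyl5 \<phi> \<psi> (w $ 1) (w $ 2) (w $ 3) (w $ 4)) differentiable (at w)"
    "(\<lambda>w. cyl6 \<phi> \<psi> (w $ 1) (w $ 2) (w $ 3) (w $ 4)) differentiable (at w)"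
    "(\<lambda>w. cyl7 \<psi> (w $ 1) (w $ 2) (w $ 3) (w $ 4)) differentiable (at w)"
    "(\<lambda>w. cyl8 \<psi> (w $ 1) (w $ 2) (w $ 3) (w $ 4)) differentiable (at w)"
    by (rule differentiable_coordinatesI, insert exhaust_5, 
        simp add: cyl1_def cyl2_def cyl3_def cyl4_def cyl5_def cyl6_def cyl7_def cyl8_def,
        erule_tac x = i in meta_allE, elim disjE, simp_all,
        (intro D half differentiable_mult differentiable_add differentiable_diff differentiable_power)+)+
qed

text \<open>The differentiability premise offered to the step from \<open>Q\<close> to
  \<open>Q'\<close> is what \<open>locally_congruent_chartI\<close> asks of \<open>L\<close>;
  \<open>cylinder_differentiable\<close> provides it in all eight cases.\<close>

lemma cylinder_alternatives_mono:
  assumes "cylinder_alternatives Q"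
    and Q': "\<And>I L. Q I L \<Longrightarrow> (\<And>w::real^4. w $ 1 \<in> I \<Longrightarrow>
      (\<lambda>w. L (w $ 1) (w $ 2) (w $ 3) (w $ 4)) differentiable (at w)) \<Longrightarrow> Q' I L"
  shows "cylinder_alternatives Q'"
proof -
  obtain I \<phi> \<psi> where I: "open I" "is_interval I" "smooth_on I \<phi>" "smooth_on I \<psi>" and alt:
    "(Q I (cyl1 \<phi> \<psi>) \<and> (\<forall>s\<in>I. (deriv \<phi> s)^2 - (deriv \<psi> s)^2 = 1)) \<or>
      (Q I (cyl2 \<phi> \<psi>) \<and> (\<forall>s\<in>I. (deriv \<phi> s)^2 - (deriv \<psi> s)^2 = -1)) \<or>
      (Q I (cyl3 \<phi> \<psi>) \<and> (\<forall>s\<in>I. (deriv \<phi> s)^2 - (deriv \<psi> s)^2 = 1)) \<or>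
      (Q I (cyl4 \<phi> \<psi>) \<and> (\<forall>s\<in>I. (deriv \<phi> s)^2 - (deriv \<psi> s)^2 = -1)) \<or>
      (Q I (cyl5 \<phi> \<psi>) \<and> (\<forall>s\<in>I. (deriv \<phi> s)^2 + (deriv \<psi> s)^2 = 1)) \<or>
      (Q I (cyl6 \<phi> \<psi>) \<and> (\<forall>s\<in>I. (deriv \<phi> s)^2 + (deriv \<psi> s)^2 = 1)) \<or>
      (Q I (cyl7 \<psi>) \<and> (\<forall>s\<in>I. 1 - 2 * deriv \<psi> s < 0)) \<or>
      (Q I (cyl8 \<psi>) \<and> (\<forall>s\<in>I. 1 + 2 * deriv \<psi> s < 0))"
    using assms(1) unfolding cylinder_alternatives_def by blast
  note L = cylinder_differentiable[OF I(1,3,4)]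
  show ?thesis
    unfolding cylinder_alternatives_def
    by (rule exI[of _ I], rule exI[of _ \<phi>], rule exI[of _ \<psi>], intro conjI I)
      (use alt in \<open>elim disjE conjE; blast intro: Q'[OF _ L(1)] Q'[OF _ L(2)] Q'[OF _ L(3)] Q'[OF _ L(4)]
        Q'[OF _ L(5)] Q'[OF _ L(6)] Q'[OF _ L(7)] Q'[OF _ L(8)]\<close>)
qed

abbreviation cylinder_classified :: "(real^4) set \<Rightarrow> (real^4 \<Rightarrow> real^5) \<Rightarrow> real^4 \<Rightarrow> bool" where
  "cylinder_classified U y q0 \<equiv> cylinder_alternatives (chart_congruent U y q0)"

lemma cylinder_classified_mono:
  "cylinder_classified U1 y q0 \<Longrightarrow> U1 \<subseteq> U \<Longrightarrow> cylinder_classified U y q0"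
  by (erule cylinder_alternatives_mono) (rule chart_congruent_mono)

lemma frame_chart_subset:
  assumes "frame_chart U y n e \<epsilon>" "open U1" "U1 \<subseteq> U"
  shows "frame_chart U1 y n e \<epsilon>"
proof -
  interpret frame_chart U y n e \<epsilon> by fact
  show ?thesis
    using assms(2,3) inj_y nn nt orth eps
    by unfold_locales (auto intro: smooth_on_subset[OF y] smooth_on_subset[OF n] smooth_on_subset[OF e])
qed

lemma principal_chart_subset:
  assumes "principal_chart U y n e \<epsilon> k" "open U1" "U1 \<subseteq> U"
  shows "principal_chart U1 y n e \<epsilon> k"
proof -
  interpret principal_chart U y n e \<epsilon> k by fact
  interpret F: frame_chart U1 y n e \<epsilon>
    using frame_chart_subset[OF frame_chart_axioms assms(2,3)] .
  show ?thesis
    by unfold_locales (use shape assms(3) in auto)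
qed

section \<open>The index of the induced metric in terms of the frame\<close>

context frame_chart
begin

lemma eps_cases: "\<epsilon> a = 1 \<or> \<epsilon> a = -1"
  using eps[of a] by (simp add: square_eq_1_iff)

text \<open>Sylvester's law of inertia: the maximal dimension of a negative definite subspace is the
  number of timelike frame vectors, collected in \<open>K\<close>.\<close>

lemma index_two_signature:
  assumes q: "q \<in> U" and ind: "index_on (tangent_space y q) = 2"
  shows "\<epsilon> 1 + \<epsilon> 2 + \<epsilon> 3 + \<epsilon> 4 = 0"
proof -
  define K where "K = {a. \<epsilon> a = -1}"
  let ?N = "\<lambda>W. subspace W \<and> W \<subseteq> tangent_space y q \<and> (\<forall>a\<in>W. a \<noteq> 0 \<longrightarrow> ip52 a a < 0)"
  have rep: "X = (\<Sum>a\<in>UNIV. (\<epsilon> a * ip52 X (E a q)) *\<^sub>R E a q)" if "X \<in> tangent_space y q" for X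
  proof -
    obtain v where "X = frechet_derivative y (at q) v"
      using \<open>X \<in> tangent_space y q\<close> by (auto simp: tangent_space_def)
    then have "ip52 X (n q) = 0"
      using nt[OF q, of v] by (simp add: ip52_commute)
    then show ?thesis
      using ambient_expansion[OF q, of X] by simp
  qed
  have norm: "ip52 X X = (\<Sum>a\<in>UNIV. \<epsilon> a * (ip52 X (E a q))\<^sup>2)" if "X \<in> tangent_space y q" for X
  proof -
    have "ip52 X X = ip52 X (\<Sum>a\<in>UNIV. (\<epsilon> a * ip52 X (E a q)) *\<^sub>R E a q)"
      using arg_cong[OF rep[OF that], of "ip52 X"] .
    then show ?thesis
      by (simp add: ip52_sum_right ip52_simps power2_eq_square mult.assoc)
  qed
  \<comment> \<open>On a negative definite \<open>W\<close> a vector is determined by its timelike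
    components: if they all vanish, its square is nonnegative.\<close>
  have upper: "dim W \<le> card K" if W: "?N W" for W
  proof -
    define g :: "real^5 \<Rightarrow> real^4" where "g X = (\<Sum>a\<in>K. ip52 X (E a q) *\<^sub>R axis a 1)" for X
    have lg: "linear g"
      unfolding g_def by (intro linearI) (simp_all add: ip52_simps scaleR_add_left sum.distrib scaleR_sum_right)
    have gn: "g X $ a = ip52 X (E a q)" if "a \<in> K" for X a
      unfolding g_def using that by (simp add: axis_def if_distrib sum.delta cong: if_cong)
    have ker: "X = 0" if "X \<in> W" "g X = 0" for X
    proof (rule ccontr)
      assume "X \<noteq> 0"
      then have "ip52 X X < 0" using W that by blast
      moreover have "ip52 X X \<ge> 0"
      proof -
        have z: "ip52 X (E a q) = 0" if "a \<in> K" for a using gn[OF that, of X] \<open>g X = 0\<close> by simp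
        have "X \<in> tangent_space y q" using W that by blast
        show ?thesis
          unfolding norm[OF \<open>X \<in> tangent_space y q\<close>]
        proof (rule sum_nonneg)
          fix a :: 4
          show "0 \<le> \<epsilon> a * (ip52 X (E a q))\<^sup>2"
            using z[of a] eps_cases[of a] by (cases "a \<in> K") (auto simp: K_def)
        qed
      qed
      ultimately show False by simp
    qed
    have "inj_on g (span W)"
    proof (rule inj_onI)
      fix X Y assume XY: "X \<in> span W" "Y \<in> span W" "g X = g Y"
      have sW: "subspace W" using W by blast
      then have "X - Y \<in> W" using XY(1,2) by (simp add: span_eq_iff[THEN iffD2] subspace_diff)
      moreover have "g (X - Y) = 0" using XY(3) by (simp add: linear_diff[OF lg])
      ultimately show "X = Y" using ker by fastforce
    qed
    then have "dim W = dim (g ` W)"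
      using dim_image_eq[OF lg] by simp
    also have "\<dots> \<le> card ((\<lambda>a. axis a (1::real)) ` K)"
    proof (rule dim_le_card)
      show "g ` W \<subseteq> span ((\<lambda>a. axis a 1) ` K)"
        unfolding g_def by (rule image_subsetI) (intro span_sum span_scale span_base imageI)
    qed simp
    also have "\<dots> \<le> card K" by (rule card_image_le) simp
    finally show ?thesis .
  qed
  \<comment> \<open>The span of the timelike frame vectors attains the bound.\<close>
  have lower: "\<exists>W. ?N W \<and> dim W = card K"
  proof -
    define g :: "real^4 \<Rightarrow> real^5" where "g v = (\<Sum>a\<in>UNIV. v $ a *\<^sub>R E a q)" for v
    have lg: "linear g"
      unfolding g_def by (intro linearI) (simp_all add: scaleR_add_left sum.distrib scaleR_sum_right)
    have ipg: "ip52 (g v) (E a q) = \<epsilon> a * v $ a" for v a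
      unfolding g_def by (simp add: ip52_sum_left ip52_simps ipE[OF q] if_distrib sum.delta mult.commute cong: if_cong)
    have inj: "inj g"
    proof (rule injI)
      fix v w assume "g v = g w"
      then have "\<epsilon> a * v $ a = \<epsilon> a * w $ a" for a by (simp only: ipg[symmetric])
      then show "v = w" using eps_nz by (simp add: vec_eq_iff)
    qed
    define S where "S = (\<lambda>a. axis a (1::real) :: real^4) ` K"
    define W where "W = g ` span S"
    have SB: "S \<subseteq> Basis" by (auto simp: S_def Basis_vec_def)
    have z: "v $ a = 0" if "v \<in> span S" "a \<notin> K" for v a
    proof -
      have "subspace {v::real^4. v $ a = 0}" by (simp add: subspace_def)
      moreover have "S \<subseteq> {v. v $ a = 0}" using that(2) by (auto simp: S_def axis_def)
      ultimately show ?thesis using that(1) span_minimal by blast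
    qed
    have tan: "g v \<in> tangent_space y q" for v
    proof -
      have "g v = frechet_derivative y (at q) (\<Sum>a\<in>UNIV. v $ a *\<^sub>R e a q)"
        using lin[OF q y] by (simp add: linear_sum linear_cmul g_def E_def)
      then show ?thesis by (simp add: tangent_space_def)
    qed
    have "?N W"
    proof (intro conjI ballI impI)
      show "subspace W" unfolding W_def by (intro linear_subspace_image lg subspace_span)
      show "W \<subseteq> tangent_space y q" using tan by (auto simp: W_def)
      fix X assume "X \<in> W" "X \<noteq> 0"
      then obtain v where v: "v \<in> span S" "X = g v" by (auto simp: W_def)
      then have "v \<noteq> 0" using \<open>X \<noteq> 0\<close> linear_0[OF lg] by auto
      then obtain b where b: "v $ b \<noteq> 0" by (auto simp: vec_eq_iff)
      have "ip52 X X = (\<Sum>a\<in>UNIV. \<epsilon> a * (\<epsilon> a * v $ a)\<^sup>2)"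
        using norm[OF tan[of v]] by (simp add: v ipg)
      also have "\<dots> = (\<Sum>a\<in>UNIV. - (v $ a)\<^sup>2)"
      proof (rule sum.cong[OF refl])
        fix a show "\<epsilon> a * (\<epsilon> a * v $ a)\<^sup>2 = - (v $ a)\<^sup>2"
          using z[OF v(1), of a] by (cases "a \<in> K") (auto simp: K_def)
      qed
      also have "\<dots> < 0"
        using sum_pos2[of UNIV b "\<lambda>a. (v $ a)\<^sup>2"] b by (simp add: sum_negf)
      finally show "ip52 X X < 0" .
    qed
    moreover have "dim W = card K"
    proof -
      have "dim W = dim (span S)"
        unfolding W_def by (rule dim_image_eq[OF lg]) (use inj in \<open>auto simp: inj_on_def inj_def\<close>)
      also have "\<dots> = card S"
        using independent_mono[OF independent_Basis SB] by (simp add: dim_span dim_eq_card_independent)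
      also have "\<dots> = card K"
        unfolding S_def by (rule card_image) (auto simp: inj_on_def axis_eq_axis)
      finally show ?thesis .
    qed
    ultimately show ?thesis by blast
  qed
  have "Max {dim W | W. ?N W} = card K"
  proof (rule Max_eqI)
    show "finite {dim W | W. ?N W}"
      by (rule finite_subset[of _ "{..card K}"]) (use upper in auto)
    obtain W where W: "?N W" "dim W = card K" using lower by blast
    show "card K \<in> {dim W | W. ?N W}"
      by (rule CollectI, rule exI[of _ W], intro conjI W(2)[symmetric] W(1)[THEN conjunct1]
          W(1)[THEN conjunct2, THEN conjunct1] W(1)[THEN conjunct2, THEN conjunct2])
  qed (use upper in auto)
  then have cK: "card K = 2" using ind by (simp add: index_on_def)
  have "(\<Sum>a\<in>UNIV. \<epsilon> a) = (\<Sum>a\<in>UNIV. 1 - 2 * (if a \<in> K then 1 else 0))"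
    using eps_cases by (intro sum.cong refl) (auto simp: K_def)
  also have "\<dots> = 4 - 2 * real (card K)"
    by (simp add: sum_subtractf sum_distrib_left[symmetric] sum.If_cases)
  finally show ?thesis using cK by (simp add: sum_4)
qed

end

lemma biconservative_chart_subset:
  assumes "biconservative_chart U y n e \<epsilon> k" "open U1" "convex U1" "U1 \<subseteq> U"
  shows "biconservative_chart U1 y n e \<epsilon> k"
proof -
  interpret biconservative_chart U y n e \<epsilon> k by fact
  interpret F: principal_chart U1 y n e \<epsilon> k
    using principal_chart_subset[OF principal_chart_axioms assms(2,4)] .
  show ?thesis
    by unfold_locales (use k1 k2 k3 k4 dk1 dk assms(3,4) in auto)
qed

context biconservative_chart
begin

lemma opposite_pair:
  assumes "\<epsilon> 2 + \<epsilon> 3 = 0"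
  obtains b b' where "b \<noteq> 1" "b \<noteq> 4" "b' \<noteq> 1" "b' \<noteq> 4" "b \<noteq> b'" "\<epsilon> b = -1" "\<epsilon> b' = 1"
proof (cases "\<epsilon> 2 = 1")
  case True
  then show thesis using assms by (intro that[of 3 2]) auto
next
  case False
  then show thesis using assms eps_cases[of 2] by (intro that[of 2 3]) auto
qed

text \<open>Scaling with \<open>sc\<close> makes the axis \<open>W\<close> and the radius
  \<open>p\<close> unit vectors, with squares sgn c and \<epsilon> 1 sgn c; \<open>\<phi>\<close>
  and \<open>\<psi>\<close> absorb the inverse factors. The first integral then yields the relation
  between the squared derivatives of \<open>\<phi>\<close> and \<open>\<psi>\<close>.\<close>

lemma classified_nonnull:
  assumes q0: "q0 \<in> U" and ind: "\<epsilon> 1 + \<epsilon> 2 + \<epsilon> 3 + \<epsilon> 4 = 0" and nz: "ip52 (Z q0) (Z q0) \<noteq> 0"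
  shows "cylinder_classified U y q0"
proof -
  define c where "c = ip52 (Z q0) (Z q0)"
  have c: "c \<noteq> 0" using nz by (simp add: c_def)
  have G: "c - \<epsilon> 1 * rad q0 powr (-4/3) > 0"
    using beta_eq[OF q0 q0] beta_pos[OF q0] by (simp add: c_def)
  obtain J I S \<rho> \<Psi> where J: "open J" "rad q0 \<in> J" and I: "open I" "is_interval I"
    and sm: "smooth_on J S" "smooth_on I \<rho>" "smooth_on J \<Psi>"
    and S: "\<And>x. x \<in> J \<Longrightarrow> S x \<in> I \<and> \<rho> (S x) = x"
    and \<rho>: "\<And>s. s \<in> I \<Longrightarrow> \<rho> s \<in> J \<and> \<rho> s > 0 \<and> c - \<epsilon> 1 * \<rho> s powr (-4/3) > 0"
    and D\<rho>: "\<And>s. s \<in> I \<Longrightarrow> (\<rho> has_real_derivative sqrt (c - \<epsilon> 1 * \<rho> s powr (-4/3))) (at s)"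
    and D\<Psi>: "\<And>x. x \<in> J \<Longrightarrow> (\<Psi> has_real_derivative \<epsilon> 1 * x powr (-2/3) / (c * sqrt (c - \<epsilon> 1 * x powr (-4/3)))) (at x)"
    using profile_curve[OF c rad_pos[OF q0] G] by blast
  have "open (U \<inter> rad -` J)"
    by (rule continuous_open_preimage[OF smooth_on_continuous[OF smooth_rad] U J(1)])
  moreover have "q0 \<in> U \<inter> rad -` J" using q0 J(2) by simp
  ultimately obtain d where d: "d > 0" "ball q0 d \<subseteq> U \<inter> rad -` J"
    by (rule openE)
  define U1 where "U1 = ball q0 d"
  have U1: "open U1" "convex U1" "q0 \<in> U1" "U1 \<subseteq> U" "rad ` U1 \<subseteq> J"
    using d by (auto simp: U1_def)
  have inU: "q \<in> U" if "q \<in> U1" for q using that U1(4) by blast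
  interpret R: biconservative_chart U1 y n e \<epsilon> k
    by (rule biconservative_chart_subset[OF biconservative_chart_axioms U1(1,2,4)])
  obtain C where C: "\<And>q. q \<in> U1 \<Longrightarrow>
      y q = C + height q0 q *\<^sub>R E 4 q0 + \<Psi> (rad q) *\<^sub>R Z q0 + (rad q / c) *\<^sub>R P q"
    using R.position_nonnull[OF U1(3) c_def[symmetric] c J(1) U1(5) sm(3) D\<Psi>] by blast
  define sc where "sc = sqrt \<bar>c\<bar>"
  have sc: "sc > 0" "sc * sc = \<bar>c\<bar>" using c by (simp_all add: sc_def)
  define \<phi> where "\<phi> = (\<lambda>s. \<rho> s / sc)"
  define \<psi> where "\<psi> = (\<lambda>s. sc * \<Psi> (\<rho> s))"
  define p where "p = (\<lambda>q. (sc / c) *\<^sub>R P q)"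
  define W where "W = (1 / sc) *\<^sub>R Z q0"
  have s\<phi>: "smooth_on I \<phi>"
    unfolding \<phi>_def using sc by (intro smooth_on_divide smooth_on_const I sm) auto
  have s\<psi>: "smooth_on I \<psi>"
    unfolding \<psi>_def using \<rho> by (intro smooth_on_mult smooth_on_const I smooth_on_compose[OF I(1) J(1) sm(3,2)]) auto
  have D\<phi>: "deriv \<phi> s = sqrt (c - \<epsilon> 1 * \<rho> s powr (-4/3)) / sc" if "s \<in> I" for s
    unfolding \<phi>_def by (intro DERIV_imp_deriv DERIV_cdivide D\<rho> that)
  have D\<psi>: "deriv \<psi> s = sc * (\<epsilon> 1 * \<rho> s powr (-2/3) / c)" if s: "s \<in> I" for s
  proof -
    have "((\<lambda>s. \<Psi> (\<rho> s)) has_real_derivative \<epsilon> 1 * \<rho> s powr (-2/3) / (c * sqrt (c - \<epsilon> 1 * \<rho> s powr (-4/3)))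
        * sqrt (c - \<epsilon> 1 * \<rho> s powr (-4/3))) (at s)"
      using \<rho>[OF s] by (intro DERIV_chain2[OF D\<Psi> D\<rho>] s) auto
    then have "((\<lambda>s. \<Psi> (\<rho> s)) has_real_derivative \<epsilon> 1 * \<rho> s powr (-2/3) / c) (at s)"
      using \<rho>[OF s] by (simp add: field_simps)
    then show ?thesis
      unfolding \<psi>_def by (intro DERIV_imp_deriv DERIV_cmult)
  qed
  have sq: "(deriv \<phi> s)\<^sup>2 = (c - \<epsilon> 1 * \<rho> s powr (-4/3)) / \<bar>c\<bar>" "(deriv \<psi> s)\<^sup>2 = \<rho> s powr (-4/3) / \<bar>c\<bar>" if s: "s \<in> I" for s
  proof -
    show "(deriv \<phi> s)\<^sup>2 = (c - \<epsilon> 1 * \<rho> s powr (-4/3)) / \<bar>c\<bar>"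
      using \<rho>[OF s] sc by (simp add: D\<phi>[OF s] power_divide power2_eq_square)
    have "(deriv \<psi> s)\<^sup>2 = (sc * sc) * (\<epsilon> 1 * \<epsilon> 1) * (\<rho> s powr (-2/3) * \<rho> s powr (-2/3)) / (c * c)"
      by (simp add: D\<psi>[OF s] power2_eq_square)
    also have "\<dots> = \<bar>c\<bar> * \<rho> s powr (-4/3) / (\<bar>c\<bar> * \<bar>c\<bar>)"
      unfolding sc(2) eps using \<rho>[OF s] by (simp add: powr_add[symmetric])
    also have "\<dots> = \<rho> s powr (-4/3) / \<bar>c\<bar>"
      using c by (simp del: abs_mult_self_eq)
    finally show "(deriv \<psi> s)\<^sup>2 = \<rho> s powr (-4/3) / \<bar>c\<bar>" .
  qed
  have Zc: "ip52 (Z q) (Z q) = c" if "q \<in> U1" for q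
    using Z_constant[OF q0 inU[OF that]] by (simp add: c_def)
  have ipZE: "ip52 (Z q0) (E a q0) = 0" "ip52 (E a q0) (Z q0) = 0" if "a \<noteq> 1" for a
    using ip_plane_E[OF q0 that] by (simp_all add: Z_def ip52_commute)
  have ipPE: "ip52 (P q) (E a q) = 0" if "a \<noteq> 1" "q \<in> U1" for a q
    unfolding P_def by (rule ip_plane_E[OF inU[OF that(2)] that(1)])
  have ppn: "ip52 (p q) (p q) = \<epsilon> 1 * sgn c" if "q \<in> U1" for q
  proof -
    have "ip52 (p q) (p q) = (sc * sc) / (c * c) * (\<epsilon> 1 * c)"
      by (simp add: p_def ip52_simps ip_PP[OF inU[OF that]] Zc[OF that])
    also have "\<dots> = \<epsilon> 1 * sgn c"
      unfolding sc(2) using c by (simp add: sgn_real_def abs_if)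
    finally show ?thesis .
  qed
  have WW: "ip52 W W = sgn c"
  proof -
    have "ip52 W W = c / (sc * sc)"
      by (simp add: W_def ip52_simps c_def)
    also have "\<dots> = sgn c"
      unfolding sc(2) using c by (simp add: sgn_real_def abs_if)
    finally show ?thesis .
  qed
  have rev: "revolution U1 y q0 I \<phi> \<psi> C (E 4 q0) W (E b q0) (E b' q0) p (height q0) (\<lambda>q. S (rad q))"
    if b: "b \<noteq> 1" "b \<noteq> 4" "b' \<noteq> 1" "b' \<noteq> 4" "b \<noteq> b'" for b b'
  proof
    show "smooth_on U1 p"
      unfolding p_def by (intro smooth_intros U1(1) R.smooth_P)
    show "smooth_on U1 (\<lambda>q. S (rad q))"
      by (rule smooth_on_compose[OF U1(1) J(1) sm(1) R.smooth_rad U1(5)])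
    show "smooth_on U1 (height q0)" by (rule R.smooth_height)
    fix q assume q: "q \<in> U1"
    then have rJ: "rad q \<in> J" using U1(5) by blast
    show "S (rad q) \<in> I" using S[OF rJ] by simp
    have "\<rho> (S (rad q)) = rad q" using S[OF rJ] by simp
    then show "y q = C + height q0 q *\<^sub>R E 4 q0 + \<psi> (S (rad q)) *\<^sub>R W + \<phi> (S (rad q)) *\<^sub>R p q"
      using sc(1) C[OF q] by (simp add: \<psi>_def \<phi>_def W_def p_def)
    show "ip52 (p q) (E 4 q0) = 0"
      using ipPE[OF _ q, of 4] by (simp add: p_def ip52_simps axis_constant[OF q0 inU[OF q]])
    show "ip52 (p q) W = 0"
      using ip_PZ[OF inU[OF q]] by (simp add: p_def W_def ip52_simps Z_constant[OF q0 inU[OF q]])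
    show "ip52 (p q) (p q) = ip52 (p q0) (p q0)"
      by (simp only: ppn[OF q] ppn[OF U1(3)])
  qed (use b U1 ipPE[OF _ U1(3)] in \<open>simp_all add: W_def p_def ip52_simps ipZE ipE[OF q0]\<close>)
  note ns = WW ppn[OF U1(3)] ipE[OF q0]
  have e1: "\<epsilon> 1 = -1" if "c < 0"
  proof (rule ccontr)
    assume "\<epsilon> 1 \<noteq> -1"
    then have "\<epsilon> 1 = 1" using eps_cases[of 1] by blast
    then have "rad q0 powr (-4/3) < c" using G by simp
    moreover have "0 \<le> rad q0 powr (-4/3)" by simp
    ultimately show False using that by linarith
  qed
  have cpos: "(deriv \<phi> s)\<^sup>2 + \<epsilon> 1 * (deriv \<psi> s)\<^sup>2 = 1" if "c > 0" "s \<in> I" for s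
    using that by (simp add: sq add_divide_distrib[symmetric])
  have cneg: "(deriv \<phi> s)\<^sup>2 - (deriv \<psi> s)\<^sup>2 = -1" if "c < 0" "s \<in> I" for s
    using that e1 by (simp add: sq diff_divide_distrib[symmetric])
  \<comment> \<open>As negative \<open>c\<close> forces \<open>\<epsilon> 1\<close> to be -1, three
    combinations of \<open>\<epsilon> 1\<close> and the sign of \<open>c\<close> remain. Each occurs
    with both signs of \<open>\<epsilon> 4\<close>, and the zero sum of signs then fixes
    \<open>\<epsilon> 2 + \<epsilon> 3\<close>.\<close>
  consider (1) "\<epsilon> 4 = -1" "\<epsilon> 1 = -1" "\<epsilon> 2 = 1" "\<epsilon> 3 = 1" "c > 0"
    | (2) "\<epsilon> 4 = -1" "\<epsilon> 1 = -1" "\<epsilon> 2 = 1" "\<epsilon> 3 = 1" "c < 0"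
    | (3) "\<epsilon> 4 = 1" "\<epsilon> 1 = -1" "\<epsilon> 2 + \<epsilon> 3 = 0" "c > 0"
    | (4) "\<epsilon> 4 = 1" "\<epsilon> 1 = -1" "\<epsilon> 2 + \<epsilon> 3 = 0" "c < 0"
    | (5) "\<epsilon> 4 = -1" "\<epsilon> 1 = 1" "\<epsilon> 2 + \<epsilon> 3 = 0" "c > 0"
    | (6) "\<epsilon> 4 = 1" "\<epsilon> 1 = 1" "\<epsilon> 2 = -1" "\<epsilon> 3 = -1" "c > 0"
  proof -
    have sgn: "c > 0 \<or> c < 0 \<and> \<epsilon> 1 = -1"
      using c e1 by linarith
    show ?thesis
      using eps_cases[of 1] eps_cases[of 2] eps_cases[of 3] eps_cases[of 4] ind sgn that
      by (elim disjE conjE) simp_all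
  qed
  then have "cylinder_classified U1 y q0"
  proof cases
    case 1
    then have "chart_congruent U1 y q0 I (cyl1 \<phi> \<psi>)"
      by (intro revolution.congruent_cyl1[OF rev[of 2 3]]) (simp_all add: ns)
    then show ?thesis
      unfolding cylinder_alternatives_def using 1 I s\<phi> s\<psi> cpos by auto
  next
    case 2
    then have "chart_congruent U1 y q0 I (cyl2 \<phi> \<psi>)"
      by (intro revolution.congruent_cyl2[OF rev[of 2 3]]) (simp_all add: ns)
    then show ?thesis
      unfolding cylinder_alternatives_def using 2 I s\<phi> s\<psi> cneg by auto
  next
    case 3
    obtain b b' where b: "b \<noteq> 1" "b \<noteq> 4" "b' \<noteq> 1" "b' \<noteq> 4" "b \<noteq> b'" "\<epsilon> b = -1" "\<epsilon> b' = 1"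
      using opposite_pair[OF 3(3)] .
    then have "chart_congruent U1 y q0 I (cyl3 \<phi> \<psi>)"
      using 3 by (intro revolution.congruent_cyl3[OF rev[of b b']]) (simp_all add: ns)
    then show ?thesis
      unfolding cylinder_alternatives_def using 3 I s\<phi> s\<psi> cpos by auto
  next
    case 4
    obtain b b' where b: "b \<noteq> 1" "b \<noteq> 4" "b' \<noteq> 1" "b' \<noteq> 4" "b \<noteq> b'" "\<epsilon> b = -1" "\<epsilon> b' = 1"
      using opposite_pair[OF 4(3)] .
    then have "chart_congruent U1 y q0 I (cyl4 \<phi> \<psi>)"
      using 4 by (intro revolution.congruent_cyl4[OF rev[of b b']]) (simp_all add: ns)
    then show ?thesis
      unfolding cylinder_alternatives_def using 4 I s\<phi> s\<psi> cneg by auto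
  next
    case 5
    obtain b b' where b: "b \<noteq> 1" "b \<noteq> 4" "b' \<noteq> 1" "b' \<noteq> 4" "b \<noteq> b'" "\<epsilon> b = -1" "\<epsilon> b' = 1"
      using opposite_pair[OF 5(3)] .
    then have "chart_congruent U1 y q0 I (cyl5 \<phi> \<psi>)"
      using 5 by (intro revolution.congruent_cyl5[OF rev[of b b']]) (simp_all add: ns)
    then show ?thesis
      unfolding cylinder_alternatives_def using 5 I s\<phi> s\<psi> cpos by auto
  next
    case 6
    then have "chart_congruent U1 y q0 I (cyl6 \<phi> \<psi>)"
      by (intro revolution.congruent_cyl6[OF rev[of 2 3]]) (simp_all add: ns)
    then show ?thesis
      unfolding cylinder_alternatives_def using 6 I s\<phi> s\<psi> cpos by auto
  qed
  then show ?thesis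
    using U1(4) by (rule cylinder_classified_mono)
qed

end

section \<open>Cylinders with null axis\<close>

context biconservative_chart
begin

text \<open>The parameter \<open>s\<close> is \<open>rad\<close> itself. With the product of
  \<open>T\<close> and \<open>Z\<close> equal to \<open>- rad\<close>, the equation that
  \<open>T\<close> is null becomes linear in the component along \<open>X\<close>; its solution is
  the quadratic term in \<open>t\<close> and \<open>u\<close> of the listed cylinders plus or minus
  half of \<open>s\<close>.\<close>

lemma classified_null:
  assumes q0: "q0 \<in> U" and ind: "\<epsilon> 1 + \<epsilon> 2 + \<epsilon> 3 + \<epsilon> 4 = 0" and c: "ip52 (Z q0) (Z q0) = 0"
  shows "cylinder_classified U y q0"
proof -
  note nr = null_relations[OF q0 c]
  obtain C where C: "\<And>q. q \<in> U \<Longrightarrow>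
      y q = C + height q0 q *\<^sub>R E 4 q0 + ((3/14) * rad q powr (7/3)) *\<^sub>R Z q0 + T q"
    using position_null[OF q0 c] by blast
  define A where "A = \<alpha> q0"
  have A: "A > 0" using alpha_pos[OF q0] by (simp add: A_def)
  \<comment> \<open>\<open>X\<close> and \<open>Y\<close> are \<open>E 1\<close> and \<open>n\<close> boosted so that \<open>X + Y = Z\<close>.\<close>
  define a where "a = (A + 1 / A) / 2"
  define b where "b = (A - 1 / A) / 2"
  have ab: "a * a - b * b = 1" "a + b = A"
    using A by (simp_all add: a_def b_def field_simps)
  define X where "X = a *\<^sub>R E 1 q0 + b *\<^sub>R n q0"
  define Y where "Y = b *\<^sub>R E 1 q0 + a *\<^sub>R n q0"
  have "X + Y = (a + b) *\<^sub>R E 1 q0 + (a + b) *\<^sub>R n q0"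
    by (simp add: X_def Y_def algebra_simps)
  then have XY: "X + Y = Z q0"
    by (simp add: Z_def nr(3) ab(2) A_def)
  have ipXY: "ip52 X X = -1" "ip52 Y Y = 1" "ip52 X Y = 0"
    unfolding X_def Y_def ip_plane[OF q0] nr(1) using ab(1) by simp_all
  have ipXE: "ip52 X (E d q0) = 0" "ip52 Y (E d q0) = 0" if "d \<noteq> 1" for d
    unfolding X_def Y_def by (simp_all add: ip_plane_E[OF q0 that])
  note ips = ipXY ipXY(3)[THEN ip52_zero_commute] ipXE ipXE[THEN ip52_zero_commute] ipE[OF q0] ip52_simps
  have TT: "ip52 (T q) (T q) = 0" and TZ: "ip52 (T q) X + ip52 (T q) Y = - rad q" and TV: "ip52 (T q) (E 4 q0) = 0"
    if q: "q \<in> U" for q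
  proof -
    have Zq: "Z q0 = Z q" by (rule Z_constant[OF q0 q])
    note nf = null_field[OF q c[unfolded Zq]]
    show "ip52 (T q) (T q) = 0" by (rule nf(1))
    show "ip52 (T q) X + ip52 (T q) Y = - rad q"
      using nf(2) by (simp add: ip52_simps(2)[symmetric] XY Zq)
    show "ip52 (T q) (E 4 q0) = 0"
      unfolding axis_constant[OF q0 q] T_def by (rule ip_plane_E[OF q]) simp
  qed
  have smT: "smooth_on U (\<lambda>q. d * ip52 (T q) V / rad q)" for d V
    using rad_pos by (intro smooth_on_divide smooth_on_mult smooth_on_const smooth_on_ip52 smooth_T U smooth_rad) force
  have I: "open {0::real<..}" "is_interval {0::real<..}"
    by (simp_all add: is_interval_convex_1)
  have s0: "smooth_on {0<..} (\<lambda>s::real. 0)" by (rule smooth_on_const[OF I(1)])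
  have Dw: "((\<lambda>s. (3/14) * s powr (7/3)) has_real_derivative (1/2) * s powr (4/3)) (at s)" if "s > 0" for s :: real
    using that by (auto intro!: derivative_eq_intros)
  have sw: "smooth_on {0<..} (\<lambda>s::real. (3/14) * s powr (7/3))"
    by (intro smooth_intros) auto
  have sh: "smooth_on {0<..} (\<lambda>s::real. s / 2)"
    by (intro smooth_intros) auto
  have rp: "rad q powr (4/3) \<ge> 0" for q by simp
  consider (7) "\<epsilon> 4 = -1" "\<epsilon> 2 = 1" "\<epsilon> 3 = 1" | (8) "\<epsilon> 4 = 1" "\<epsilon> 2 + \<epsilon> 3 = 0"
  proof -
    show ?thesis
      using eps_cases[of 2] eps_cases[of 3] eps_cases[of 4] ind nr(1) that
      by (elim disjE) simp_all
  qed
  then show ?thesis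
  proof cases
    case 7
    \<comment> \<open>The summand s/2 comes from the null equation for \<open>T\<close>, the other
      one from the \<open>Z\<close> term of the position. Thus 1 - 2\<psi>' = -s^(4/3).\<close>
    define \<psi> where "\<psi> = (\<lambda>s::real. s / 2 + (3/14) * s powr (7/3))"
    have "deriv \<psi> s = 1/2 + (1/2) * s powr (4/3)" if "s > 0" for s
      unfolding \<psi>_def by (intro DERIV_imp_deriv DERIV_add Dw that) (auto intro!: derivative_eq_intros)
    then have D\<psi>: "1 - 2 * deriv \<psi> s < 0" if "s \<in> {0<..}" for s
      using that by simp
    have s\<psi>: "smooth_on {0<..} \<psi>"
      unfolding \<psi>_def by (intro smooth_on_add I sh sw)
    let ?f = "frame52 X (E 4 q0) (E 2 q0) (E 3 q0) Y"
    have f: "orthonormal52 ?f"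
      by (rule orthonormal52_frame52) (simp_all add: ips 7)
    define t where "t = (\<lambda>q. 1 * ip52 (T q) (E 2 q0) / rad q)"
    define u where "u = (\<lambda>q. 1 * ip52 (T q) (E 3 q0) / rad q)"
    have "y q = C + frame_combination ?f (cyl7 \<psi> (rad q) (t q) (u q) (height q0 q))" if q: "q \<in> U" for q
    proof -
      define x where "x = - ip52 (T q) X"
      have r: "rad q > 0" by (rule rad_pos[OF q])
      have tu: "ip52 (T q) (E 2 q0) = rad q * t q" "ip52 (T q) (E 3 q0) = rad q * u q"
        using r by (simp_all add: t_def u_def)
      have Y: "ip52 (T q) Y = x - rad q" "ip52 (T q) X = - x"
        using TZ[OF q] by (simp_all add: x_def)
      have "- x\<^sup>2 + (rad q * t q)\<^sup>2 + (rad q * u q)\<^sup>2 + (x - rad q)\<^sup>2 = 0"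
        using orthonormal52_expansion(2)[OF f, of "T q", symmetric]
        by (simp add: sum_5 TT[OF q] TV[OF q] tu Y)
      then have "rad q * (2 * x) = rad q * (rad q * ((t q)\<^sup>2 + (u q)\<^sup>2) + rad q)"
        by (simp add: power2_eq_square algebra_simps)
      then have x: "x = rad q * ((t q)\<^sup>2 + (u q)\<^sup>2) / 2 + rad q / 2"
        using r by simp
      have "T q = x *\<^sub>R X + (rad q * t q) *\<^sub>R E 2 q0 + (rad q * u q) *\<^sub>R E 3 q0 + (x - rad q) *\<^sub>R Y"
        using orthonormal52_expansion(1)[OF f, of "T q"] by (simp add: sum_5 TV[OF q] tu Y)
      then show ?thesis
        unfolding C[OF q] XY[symmetric]
        by (simp add: x frame_combination_def sum_5 cyl7_def \<psi>_def algebra_simps)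
    qed
    moreover have "smooth_on U t" "smooth_on U u"
      unfolding t_def u_def by (rule smT)+
    ultimately have "chart_congruent U y q0 {0<..} (cyl7 \<psi>)"
      unfolding chart_congruent_def
      using q0 U f smooth_rad smooth_height[of q0] rad_pos
      by (intro exI[of _ U] exI[of _ ?f] exI[of _ C], rule_tac exI[of _ rad],
          rule_tac exI[of _ t], rule_tac exI[of _ u], rule_tac exI[of _ "height q0"]) simp
    then show ?thesis
      unfolding cylinder_alternatives_def using D\<psi> I s0 s\<psi> by blast
  next
    case 8
    obtain d d' where d: "d \<noteq> 1" "d \<noteq> 4" "d' \<noteq> 1" "d' \<noteq> 4" "d \<noteq> d'" "\<epsilon> d = -1" "\<epsilon> d' = 1"
      using opposite_pair[OF 8(2)] .
    define \<psi> where "\<psi> = (\<lambda>s::real. - (s / 2 + (3/14) * s powr (7/3)))"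
    have "deriv \<psi> s = - (1/2 + (1/2) * s powr (4/3))" if "s > 0" for s
      unfolding \<psi>_def by (intro DERIV_imp_deriv DERIV_minus DERIV_add Dw that) (auto intro!: derivative_eq_intros)
    then have D\<psi>: "1 + 2 * deriv \<psi> s < 0" if "s \<in> {0<..}" for s
      using that by simp
    have s\<psi>: "smooth_on {0<..} \<psi>"
      unfolding \<psi>_def by (intro smooth_on_minus smooth_on_add I sh sw)
    \<comment> \<open>Reversing \<open>X\<close> and \<open>Y\<close> gives the last coordinate the
      form first coordinate plus \<open>s\<close>, as listed; this also accounts for the sign of
      \<open>\<psi>\<close>.\<close>
    let ?f = "frame52 (- X) (E d q0) (E d' q0) (E 4 q0) (- Y)"
    have f: "orthonormal52 ?f"
      by (rule orthonormal52_frame52) (use d in \<open>simp_all add: ips 8\<close>)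
    define t where "t = (\<lambda>q. - 1 * ip52 (T q) (E d q0) / rad q)"
    define u where "u = (\<lambda>q. 1 * ip52 (T q) (E d' q0) / rad q)"
    have "y q = C + frame_combination ?f (cyl8 \<psi> (rad q) (t q) (u q) (height q0 q))" if q: "q \<in> U" for q
    proof -
      define x where "x = ip52 (T q) X"
      have r: "rad q > 0" by (rule rad_pos[OF q])
      have tu: "ip52 (T q) (E d q0) = - (rad q * t q)" "ip52 (T q) (E d' q0) = rad q * u q"
        using r by (simp_all add: t_def u_def)
      have Y: "ip52 (T q) Y = - x - rad q" "ip52 (T q) X = x"
        using TZ[OF q] by (simp_all add: x_def)
      have "- x\<^sup>2 - (rad q * t q)\<^sup>2 + (rad q * u q)\<^sup>2 + (rad q + x)\<^sup>2 = 0"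
        using orthonormal52_expansion(2)[OF f, of "T q", symmetric]
        by (simp add: sum_5 TT[OF q] TV[OF q] tu Y ip52_simps)
      then have "rad q * (2 * x) = rad q * (rad q * ((t q)\<^sup>2 - (u q)\<^sup>2) - rad q)"
        by (simp add: power2_eq_square algebra_simps)
      then have x: "x = rad q * ((t q)\<^sup>2 - (u q)\<^sup>2) / 2 - rad q / 2"
        using r by simp
      have "T q = - (x *\<^sub>R X) + (rad q * t q) *\<^sub>R E d q0 + (rad q * u q) *\<^sub>R E d' q0 - (x + rad q) *\<^sub>R Y"
        using orthonormal52_expansion(1)[OF f, of "T q"]
        by (simp add: sum_5 TV[OF q] tu Y ip52_simps algebra_simps)
      then show ?thesis
        unfolding C[OF q] XY[symmetric]
        by (simp add: x frame_combination_def sum_5 cyl8_def \<psi>_def algebra_simps)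
    qed
    moreover have "smooth_on U t" "smooth_on U u"
      unfolding t_def u_def by (rule smT)+
    ultimately have "chart_congruent U y q0 {0<..} (cyl8 \<psi>)"
      unfolding chart_congruent_def
      using q0 U f smooth_rad smooth_height[of q0] rad_pos
      by (intro exI[of _ U] exI[of _ ?f] exI[of _ C], rule_tac exI[of _ rad],
          rule_tac exI[of _ t], rule_tac exI[of _ u], rule_tac exI[of _ "height q0"]) simp
    then show ?thesis
      unfolding cylinder_alternatives_def using D\<psi> I s0 s\<psi> by blast
  qed
qed

end

section \<open>Normalization of signs and passage to the manifold\<close>

lemma principal_chart_classified:
  assumes "principal_chart U y n e \<epsilon> k" and q0: "q0 \<in> U"
    and ind: "\<epsilon> 1 + \<epsilon> 2 + \<epsilon> 3 + \<epsilon> 4 = 0" and bc: "biconservative_on U y n"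
    and grad: "\<And>q. q \<in> U \<Longrightarrow> \<exists>c. c \<noteq> 0 \<and> e 1 q = c *\<^sub>R grad_H y n q"
    and k: "\<And>q. q \<in> U \<Longrightarrow> k 3 q = k 2 q \<and> k 4 q = 0 \<and> k 2 q \<noteq> 0"
  shows "cylinder_classified U y q0"
proof -
  interpret principal_chart U y n e \<epsilon> k by fact
  have tr: "dd trS 1 q \<noteq> 0" "\<And>a. a \<noteq> 1 \<Longrightarrow> dd trS a q = 0" if "q \<in> U" for q
    using grad[OF that] gradient_direction[OF that] by blast+
  have k1: "k 1 q = - (2/3) * k 2 q" if "q \<in> U" for q
    using biconservative_principal_curvature[OF that bc tr(1)[OF that]] k[OF that] by (simp add: sum_4)
  have trk: "k 2 q = (3/4) * trS q" if "q \<in> U" for q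
    using k1[OF that] k[OF that] by (simp add: sum_4)
  have dk: "dd (k 2) a q = (3/4) * dd trS a q" if "q \<in> U" for a q
  proof -
    have "dd (k 2) a q = dd (\<lambda>q. (3/4) * trS q) a q"
      by (rule dd_cong[OF that trk])
    also have "\<dots> = (3/4) * dd trS a q"
      by (rule frechet_derivative_linear_image[OF bounded_linear_mult_right smooth_on_differentiable[OF smooth_trS U that]])
    finally show ?thesis .
  qed
  \<comment> \<open>Reversing \<open>n\<close> by \<open>\<tau>\<close> makes \<open>k 2\<close>
    positive at \<open>q0\<close>; reversing \<open>e 1\<close> by \<open>\<sigma>\<close> then
    makes its derivative along \<open>e 1\<close> negative there. \<open>F\<close> and
    \<open>G'\<close> turn these into open conditions that persist on a ball.\<close>
  define \<tau> where "\<tau> = sgn (k 2 q0)"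
  define \<sigma> where "\<sigma> = - \<tau> * sgn (dd (k 2) 1 q0)"
  have nz: "k 2 q0 \<noteq> 0" "dd (k 2) 1 q0 \<noteq> 0"
    unfolding dk[OF q0] using k[OF q0] tr(1)[OF q0] by simp_all
  have sq: "\<tau> * \<tau> = 1" "\<sigma> * \<sigma> = 1"
    using nz by (auto simp: \<tau>_def \<sigma>_def sgn_if)
  define F where "F = (\<lambda>q. \<tau> * k 2 q)"
  define G' where "G' = (\<lambda>q. - (\<sigma> * \<tau>) * dd (k 2) 1 q)"
  have sFG: "smooth_on U F" "smooth_on U G'"
    unfolding F_def G'_def by (intro smooth_intros U smooth_k e)+
  have o1: "open {q \<in> U. F q > 0}" by (rule open_inter_preimage_real[OF U sFG(1)])
  have sp: "0 < sgn z * z" if "z \<noteq> 0" for z :: real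
    using that by (simp add: sgn_if)
  have "open {q \<in> {q \<in> U. F q > 0}. G' q > 0}"
    by (rule open_inter_preimage_real[OF o1 smooth_on_subset[OF sFG(2)]]) auto
  moreover have "- (\<sigma> * \<tau>) = sgn (dd (k 2) 1 q0)"
    using sq by (simp add: \<sigma>_def mult.assoc[symmetric])
  then have "q0 \<in> {q \<in> {q \<in> U. F q > 0}. G' q > 0}"
    using q0 sp[OF nz(1)] sp[OF nz(2)] by (simp only: F_def G'_def \<tau>_def[symmetric] mem_Collect_eq)
  ultimately obtain d where d: "d > 0" "ball q0 d \<subseteq> {q \<in> {q \<in> U. F q > 0}. G' q > 0}"
    by (rule openE)
  let ?B = "ball q0 d"
  have B: "?B \<subseteq> U" "\<And>q. q \<in> ?B \<Longrightarrow> F q > 0" "\<And>q. q \<in> ?B \<Longrightarrow> G' q > 0"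
    using d(2) by blast+
  interpret R: principal_chart ?B y n e \<epsilon> k
    by (rule principal_chart_subset[OF principal_chart_axioms open_ball B(1)])
  let ?n = "\<lambda>q. \<tau> *\<^sub>R n q" and ?e = "\<lambda>i q. (if i = 1 then \<sigma> else 1) *\<^sub>R e i q" and ?k = "\<lambda>i q. \<tau> * k i q"
  interpret F: principal_chart ?B y ?n ?e \<epsilon> ?k
    by (rule R.principal_chart_flip[OF sq(2,1)])
  interpret Bc: biconservative_chart ?B y ?n ?e \<epsilon> ?k
  proof
    fix q assume q: "q \<in> ?B"
    then have qU: "q \<in> U" using B(1) by blast
    show "\<tau> * k 1 q = - (2/3) * (\<tau> * k 2 q)" using k1[OF qU] by simp
    show "0 < \<tau> * k 2 q" using B(2)[OF q] by (simp add: F_def)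
    show "\<tau> * k 3 q = \<tau> * k 2 q" "\<tau> * k 4 q = 0" using k[OF qU] by simp_all
    have D: "frechet_derivative (\<lambda>q. \<tau> * k 2 q) (at q) (s *\<^sub>R e a q) = \<tau> * (s * dd (k 2) a q)" for s a
      using frechet_derivative_linear_image[OF bounded_linear_mult_right smooth_on_differentiable[OF smooth_k U qU]]
        linear_cmul[OF lin[OF qU smooth_k]] by simp
    show "frechet_derivative (\<lambda>q. \<tau> * k 2 q) (at q) (?e 1 q) < 0"
      unfolding D using B(3)[OF q] by (simp add: G'_def mult_ac)
    show "frechet_derivative (\<lambda>q. \<tau> * k 2 q) (at q) (?e a q) = 0" if "a \<noteq> 1" for a
      unfolding D dk[OF qU] tr(2)[OF qU that] by simp
  qed simp
  have "q0 \<in> ?B" using d(1) by simp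
  then have "cylinder_classified ?B y q0"
    using Bc.classified_null[OF _ ind] Bc.classified_nonnull[OF _ ind] by blast
  then show ?thesis using cylinder_classified_mono B(1) by blast
qed

lemma chart_classified:
  assumes U: "open U" "q0 \<in> U" and im: "immersion_index2 U y" and un: "unit_normal U y n"
    and bc: "biconservative_on U y n" and gp: "grad_H_proper_on U y n" and ds: "diag_shape_on U y n"
  shows "cylinder_classified U y q0"
proof -
  obtain U' e k where U': "open U'" "q0 \<in> U'" "U' \<subseteq> U" and pf: "principal_frame U' y n e k"
    and k: "\<And>q. q \<in> U' \<Longrightarrow> k 3 q = k 2 q \<and> k 4 q = 0 \<and> k 2 q \<noteq> 0"
    using ds U(2) unfolding diag_shape_on_def by meson
  have y: "smooth_on U' y" and n: "smooth_on U' n" and e: "\<And>i. smooth_on U' (e i)"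
    using im un pf U'(3) smooth_on_subset by (auto simp: immersion_index2_def unit_normal_def principal_frame_def)
  define m where "m i q = metric y q (e i q) (e i q)" for i q
  define \<epsilon> where "\<epsilon> i = m i q0" for i
  have abs: "\<bar>m i q\<bar> = 1" if "q \<in> U'" for i q
    using pf that by (simp add: principal_frame_def m_def)
  have ee: "\<epsilon> i * \<epsilon> i = 1" for i
    using abs[OF U'(2), of i] by (simp add: \<epsilon>_def abs_square_eq_1 power2_eq_square[symmetric])
  have sm: "smooth_on U' (\<lambda>q. \<epsilon> i * m i q)" for i
    unfolding m_def metric_def by (intro smooth_intros U' y e)
  \<comment> \<open>Where each square \<open>m i\<close> has the same sign as at \<open>q0\<close>,
    it equals \<open>\<epsilon> i\<close>, because its absolute value is 1.\<close>
  define O' where "O' = (\<Inter>i\<in>UNIV. {q \<in> U'. \<epsilon> i * m i q > 0})"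
  have "open O'"
    unfolding O'_def by (intro open_INT open_inter_preimage_real U' sm ballI) simp
  moreover have q0O: "q0 \<in> O'"
    using U'(2) ee by (simp add: O'_def \<epsilon>_def[symmetric])
  moreover have OU: "O' \<subseteq> U'" by (auto simp: O'_def)
  ultimately have O': "open O'" "q0 \<in> O'" "O' \<subseteq> U'" by auto
  have meps: "m i q = \<epsilon> i" if "q \<in> O'" for i q
  proof -
    have "\<epsilon> i * m i q > 0" "\<bar>m i q\<bar> = 1" "\<bar>\<epsilon> i\<bar> = 1"
      using that abs[of q i] abs[OF U'(2), of i] OU by (auto simp: O'_def \<epsilon>_def)
    then show ?thesis by (auto simp: abs_if zero_less_mult_iff split: if_splits)
  qed
  interpret F: frame_chart O' y n e \<epsilon>
  proof
    fix q i j v assume q: "q \<in> O'"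
    then have qU: "q \<in> U'" "q \<in> U" using OU U'(3) by auto
    show "inj (frechet_derivative y (at q))"
      using im qU by (simp add: immersion_index2_def)
    show "ip52 (n q) (n q) = 1" "ip52 (n q) (frechet_derivative y (at q) v) = 0"
      using un qU by (auto simp: unit_normal_def tangent_space_def)
    show "ip52 (frechet_derivative y (at q) (e i q)) (frechet_derivative y (at q) (e j q)) = (if i = j then \<epsilon> i else 0)"
    proof (cases "i = j")
      case True
      then show ?thesis using meps[OF q, of i] by (simp add: m_def metric_def)
    next
      case False
      then show ?thesis using pf qU by (simp add: principal_frame_def metric_def)
    qed
  qed (use O' ee smooth_on_subset[OF y OU] smooth_on_subset[OF n OU] smooth_on_subset[OF e OU] in auto)
  interpret P: principal_chart O' y n e \<epsilon> k
  proof
    fix q a assume q: "q \<in> O'"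
    then have "shape_op y n q (e a q) = k a q *\<^sub>R e a q"
      using pf OU by (auto simp: principal_frame_def)
    then show "frechet_derivative n (at q) (e a q) = - (k a q *\<^sub>R frechet_derivative y (at q) (e a q))"
      using F.shape_op_eq[OF q, of "e a q"] linear_cmul[OF F.lin[OF q F.y], of "k a q" "e a q"]
      by (simp add: minus_equation_iff)
  qed
  have "index_on (tangent_space y q0) = 2"
    using im U(2) by (simp add: immersion_index2_def)
  then have ind: "\<epsilon> 1 + \<epsilon> 2 + \<epsilon> 3 + \<epsilon> 4 = 0"
    by (rule F.index_two_signature[OF O'(2)])
  have bc': "biconservative_on O' y n"
    using bc OU U'(3) by (auto simp: biconservative_on_def)
  have "cylinder_classified O' y q0"
  proof (rule principal_chart_classified[OF P.principal_chart_axioms O'(2) ind bc'])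
    fix q assume q: "q \<in> O'"
    then have qU: "q \<in> U'" "q \<in> U" using OU U'(3) by auto
    show "k 3 q = k 2 q \<and> k 4 q = 0 \<and> k 2 q \<noteq> 0" by (rule k[OF qU(1)])
    have "e 1 q = (1 / sqrt \<bar>metric y q (grad_H y n q) (grad_H y n q)\<bar>) *\<^sub>R grad_H y n q"
      using pf qU by (simp add: principal_frame_def)
    moreover have "1 / sqrt \<bar>metric y q (grad_H y n q) (grad_H y n q)\<bar> \<noteq> 0"
      using gp qU by (simp add: grad_H_proper_on_def)
    ultimately show "\<exists>c. c \<noteq> 0 \<and> e 1 q = c *\<^sub>R grad_H y n q" by blast
  qed
  then show ?thesis
    using cylinder_classified_mono OU U'(3) by blast
qed

theorem theorem3p13:
  fixes M :: "'m::{t2_space, second_countable_topology} set"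
    and A :: "'m atlas4"
    and x N :: "'m \<Rightarrow> real^5"
  assumes "oriented_hypersurface_index2 M A x N"
    and "biconservative A x N"
    and "grad_H_proper A x N"
    and "diag_shape A x N"
  shows "\<forall>p\<in>M. \<exists>(I :: real set) (\<phi> :: real \<Rightarrow> real) (\<psi> :: real \<Rightarrow> real).
     open I \<and> is_interval I \<and> smooth_on I \<phi> \<and> smooth_on I \<psi> \<and>
     ((locally_congruent M A x p I (cyl1 \<phi> \<psi>) \<and> (\<forall>s\<in>I. (deriv \<phi> s)^2 - (deriv \<psi> s)^2 = 1)) \<or>
      (locally_congruent M A x p I (cyl2 \<phi> \<psi>) \<and> (\<forall>s\<in>I. (deriv \<phi> s)^2 - (deriv \<psi> s)^2 = -1)) \<or>
      (locally_congruent M A x p I (cyl3 \<phi> \<psi>) \<and> (\<forall>s\<in>I. (deriv \<phi> s)^2 - (deriv \<psi> s)^2 = 1)) \<or>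
      (locally_congruent M A x p I (cyl4 \<phi> \<psi>) \<and> (\<forall>s\<in>I. (deriv \<phi> s)^2 - (deriv \<psi> s)^2 = -1)) \<or>
      (locally_congruent M A x p I (cyl5 \<phi> \<psi>) \<and> (\<forall>s\<in>I. (deriv \<phi> s)^2 + (deriv \<psi> s)^2 = 1)) \<or>
      (locally_congruent M A x p I (cyl6 \<phi> \<psi>) \<and> (\<forall>s\<in>I. (deriv \<phi> s)^2 + (deriv \<psi> s)^2 = 1)) \<or>
      (locally_congruent M A x p I (cyl7 \<psi>) \<and> (\<forall>s\<in>I. 1 - 2 * deriv \<psi> s < 0)) \<or>
      (locally_congruent M A x p I (cyl8 \<psi>) \<and> (\<forall>s\<in>I. 1 + 2 * deriv \<psi> s < 0)))"
proof (rule ballI, unfold cylinder_alternatives_def[symmetric, of "locally_congruent M A x _"])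
  fix p assume "p \<in> M"
  have man: "smooth_manifold4 M A"
    using assms(1) by (simp add: oriented_hypersurface_index2_def)
  then obtain D c where ch: "(D, c) \<in> A" and p: "p \<in> D"
    using \<open>p \<in> M\<close> by (auto simp: smooth_manifold4_def)
  let ?y = "x \<circ> inv_into D c" and ?n = "N \<circ> inv_into D c"
  have im: "immersion_index2 (c ` D) ?y" and un: "unit_normal (c ` D) ?y ?n"
    using assms(1) ch by (auto simp: oriented_hypersurface_index2_def)
  have "open (c ` D)"
    using man ch by (auto simp: smooth_manifold4_def)
  moreover have "biconservative_on (c ` D) ?y ?n" "grad_H_proper_on (c ` D) ?y ?n" "diag_shape_on (c ` D) ?y ?n"
    using assms(2-4) ch by (auto simp: biconservative_def grad_H_proper_def diag_shape_def)
  ultimately have "cylinder_classified (c ` D) ?y (c p)"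
    using p im un by (intro chart_classified) auto
  then show "cylinder_alternatives (locally_congruent M A x p)"
    by (rule cylinder_alternatives_mono) (rule locally_congruent_chartI[OF man ch p im])
qed

end
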